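(* Let $s>0$ satisfy $\tfrac12-|\sigma|<s<\varsigma$, where $n\in C^{\varsigma}_{\mathrm{loc}}$ and $\varsigma<1+q$. If $q\ge4\ell$, then there are no nonzero solutions $u\in H^s\cap L^\infty$ of $$Lu-\nu u+n(u)=0$$ with speed $\nu$ satisfying $\nu-\mathfrak m(0)\gtrsim-\|u\|_\infty^q$, provided $\|u\|_s$ and $\|u\|_\infty$ are sufficiently small; that is, for every constant $C>0$ there is $\delta>0$ such that if $u\in H^s\cap L^\infty$ solves the equation with speed $\nu\in\mathbb R$, $\nu-\mathfrak m(0)\ge-C\|u\|_\infty^q$, $\|u\|_s<\delta$ and $\|u\|_\infty<\delta$, then $u=0$. In particular, this excludes small solitary waves in $H^s\cap L^\infty$ with supercritical speed $\nu>\mathfrak m(0)$ when $q\ge4\ell$.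
   Context: Notation. $\langle\xi\rangle=\sqrt{1+\xi^2}$; $\mathscr F(\varphi)(\xi)=\widehat\varphi(\xi)=\frac1{\sqrt{2\pi}}\int_{\mathbb R}\varphi(x)e^{-i\xi x}\,dx$. $A\lesssim B$ (or $B\gtrsim A$) means $A\le cB$ for a constant $c>0$ independent of $A$ and $B$. $H^s$ is the space of real-valued $u\in L^2(\mathbb R)$ with $\|u\|_s:=\|\langle\cdot\rangle^s\widehat u\|_{L^2}<\infty$; $\|\cdot\|_\infty$ is the $L^\infty$ norm. Assumptions. (A1) $L$ is a Fourier multiplier operator, $\widehat{Lu}=\mathfrak m\,\widehat u$, with even symbol $\mathfrak m:\mathbb R\to\mathbb R$ satisfying $|\mathfrak m(\xi)|\lesssim\langle\xi\rangle^{\sigma}$ for some $\sigma<0$; the kernel $K:=\mathscr F^{-1}(\mathfrak m)$ belongs to $L^1(\mathbb R)$, so that $Lu=\frac1{\sqrt{2\pi}}K*u$; $\mathfrak m$ has a strictly positive unique global maximum at $0$ and is $C^{2\ell}$ around $0$ for some $\ell\in\mathbb Z_+$ (positive integer), with $\mathfrak m^{(2\ell)}(0)<0$ and Maclaurin expansion $\mathfrak m(\xi)=\mathfrak m(0)+\frac{\mathfrak m^{(2\ell)}(0)}{(2\ell)!}\xi^{2\ell}+O(|\xi|^{2\ell+2})$. (A2), here with $q\ge4\ell$: $n:\mathbb R\to\mathbb R$ is locally Lipschitz and $n=n_q+n_{\mathrm r}$, where either $n_q(x)=\gamma|x|^{1+q}$ with a constant $\gamma\ne0$, or $n_q(x)=\gamma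 x|x|^q$ with $\gamma>0$. If $n\in C^\varsigma_{\mathrm{loc}}$ for some real $\varsigma<1+q$, then $n_{\mathrm r}^{(j)}(x)=o(|x|^{1+q-j})$ as $x\to0$ for all $j=0,1,\dots,\lfloor\varsigma\rfloor$ (in particular $n^{(j)}(x)=O(|x|^{1+q-j})$ for these $j$). When $n$ is merely locally Lipschitz it is assumed that $n'(x)=O(|x|^q)$ almost everywhere as $x\to0$. ($C^\varsigma_{\mathrm{loc}}$ is the usual local Hölder class; a locally Lipschitz $n$ lies in it for every $\varsigma\in(0,1)$.) *)

theory Defs
  imports "HOL-Probability.Probability" "HOL-Library.Landau_Symbols"
begin

(* Elements of L^2, H^s and L^infty are represented by Borel functions; every notion
   below is invariant under changes on null sets, and equality of classes is "AE". *)

definition square_integrable :: "(real \<Rightarrow> 'a::{banach, second_countable_topology}) \<Rightarrow> bool" where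
  "square_integrable f \<longleftrightarrow>
     f \<in> borel_measurable lborel \<and> integrable lborel (\<lambda>x. (norm (f x))\<^sup>2)"

definition L2_norm :: "(real \<Rightarrow> 'a::{banach, second_countable_topology}) \<Rightarrow> real" where
  "L2_norm f = sqrt (LINT x|lborel. (norm (f x))\<^sup>2)"

definition Linf :: "(real \<Rightarrow> real) set" where
  "Linf = {u. u \<in> borel_measurable lborel \<and> esssup lborel (\<lambda>x. ereal \<bar>u x\<bar>) < \<infinity>}"

definition Linf_norm :: "(real \<Rightarrow> real) \<Rightarrow> real" where
  "Linf_norm u = real_of_ereal (esssup lborel (\<lambda>x. ereal \<bar>u x\<bar>))"

definition fourier_L1 :: "(real \<Rightarrow> complex) \<Rightarrow> real \<Rightarrow> complex" where
  "fourier_L1 f \<xi> =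
     (1 / sqrt (2 * pi)) *\<^sub>R (LINT x|lborel. f x * exp (- (\<i> * of_real \<xi> * of_real x)))"

(* The Fourier transform on L^2 as the L^2-limit of the transforms of the truncations of f to
   [-R, R]. The limit is expressed by the nonnegative integral, since the Bochner integral
   of a non-integrable function is 0. *)
definition has_fourier_L2 :: "(real \<Rightarrow> complex) \<Rightarrow> (real \<Rightarrow> complex) \<Rightarrow> bool" where
  "has_fourier_L2 f g \<longleftrightarrow>
     square_integrable f \<and> square_integrable g \<and>
     ((\<lambda>R. \<integral>\<^sup>+\<xi>. ennreal ((norm (fourier_L1 (\<lambda>x. indicator {-R..R} x *\<^sub>R f x) \<xi> - g \<xi>))\<^sup>2) \<partial>lborel)
        \<longlongrightarrow> 0) at_top"

definition fourier_L2 :: "(real \<Rightarrow> complex) \<Rightarrow> real \<Rightarrow> complex" where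
  "fourier_L2 f = (SOME g. has_fourier_L2 f g)"

definition bracket :: "real \<Rightarrow> real" where
  "bracket \<xi> = sqrt (1 + \<xi>\<^sup>2)"

definition sobolev_weighted :: "real \<Rightarrow> (real \<Rightarrow> real) \<Rightarrow> real \<Rightarrow> complex" where
  "sobolev_weighted s u \<xi> = (bracket \<xi> powr s) *\<^sub>R fourier_L2 (\<lambda>x. of_real (u x)) \<xi>"

definition sobolev :: "real \<Rightarrow> (real \<Rightarrow> real) set" where
  "sobolev s = {u. square_integrable u \<and> square_integrable (sobolev_weighted s u)}"

definition sobolev_norm :: "real \<Rightarrow> (real \<Rightarrow> real) \<Rightarrow> real" where
  "sobolev_norm s u = L2_norm (sobolev_weighted s u)"

(* For bounded measurable m and f in L^2, the L^2 function with transform m times that of f. *)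
definition fourier_multiplier :: "(real \<Rightarrow> real) \<Rightarrow> (real \<Rightarrow> complex) \<Rightarrow> real \<Rightarrow> complex" where
  "fourier_multiplier m f =
     (SOME w. square_integrable w \<and>
        (AE \<xi> in lborel. fourier_L2 w \<xi> = of_real (m \<xi>) * fourier_L2 f \<xi>))"

definition solves_steady ::
  "(real \<Rightarrow> real) \<Rightarrow> (real \<Rightarrow> real) \<Rightarrow> real \<Rightarrow> (real \<Rightarrow> real) \<Rightarrow> bool" where
  "solves_steady m n \<nu> u \<longleftrightarrow>
     (AE x in lborel.
        fourier_multiplier m (\<lambda>y. of_real (u y)) x - of_real (\<nu> * u x) + of_real (n (u x)) = 0)"

(* k-fold continuous differentiability; meant for open S. *)
definition Ck_on :: "nat \<Rightarrow> (real \<Rightarrow> real) \<Rightarrow> real set \<Rightarrow> bool" where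
  "Ck_on k f S \<longleftrightarrow>
     (\<forall>j<k. \<forall>x\<in>S. (deriv ^^ j) f differentiable (at x)) \<and> continuous_on S ((deriv ^^ k) f)"

(* For integer exponents the Hoelder condition is only local boundedness of differences,
   so the class is then C^k. *)
definition holder_loc :: "real \<Rightarrow> (real \<Rightarrow> real) \<Rightarrow> bool" where
  "holder_loc \<zeta> f \<longleftrightarrow>
     (let k = nat \<lfloor>\<zeta>\<rfloor> in
        Ck_on k f UNIV \<and>
        (\<forall>S. compact S \<longrightarrow>
           (\<exists>C. \<forall>x\<in>S. \<forall>y\<in>S. \<bar>(deriv ^^ k) f x - (deriv ^^ k) f y\<bar> \<le> C * \<bar>x - y\<bar> powr (\<zeta> - real k))))"

(* The kernel K is the inverse transform of m, expressed as the pointwise identity F(K) = m.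
   Requiring it everywhere, not just almost everywhere, identifies m with its continuous
   representative; the strict maximum at 0 is not a condition on the a.e. class. *)
definition admissible_symbol :: "(real \<Rightarrow> real) \<Rightarrow> real \<Rightarrow> nat \<Rightarrow> bool" where
  "admissible_symbol m \<sigma> l \<longleftrightarrow>
     (\<forall>\<xi>. m (- \<xi>) = m \<xi>) \<and>
     \<sigma> < 0 \<and> (\<exists>c>0. \<forall>\<xi>. \<bar>m \<xi>\<bar> \<le> c * bracket \<xi> powr \<sigma>) \<and>
     (\<exists>K :: real \<Rightarrow> real. integrable lborel K \<and>
        (\<forall>\<xi>. fourier_L1 (\<lambda>x. of_real (K x)) \<xi> = of_real (m \<xi>))) \<and>
     m 0 > 0 \<and> (\<forall>\<xi>. \<xi> \<noteq> 0 \<longrightarrow> m \<xi> < m 0) \<and>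
     l \<ge> 1 \<and> (\<exists>\<epsilon>>0. Ck_on (2 * l) m (ball 0 \<epsilon>)) \<and>
     (deriv ^^ (2 * l)) m 0 < 0 \<and>
     (\<lambda>\<xi>. m \<xi> - (m 0 + (deriv ^^ (2 * l)) m 0 / fact (2 * l) * \<xi> ^ (2 * l)))
       \<in> O[at 0](\<lambda>\<xi>. \<bar>\<xi>\<bar> ^ (2 * l + 2))"

(* The time argument of the library's local_lipschitz is a dummy.
   "Merely locally Lipschitz" is read as: not C^1. *)
definition admissible_nonlinearity :: "(real \<Rightarrow> real) \<Rightarrow> real \<Rightarrow> bool" where
  "admissible_nonlinearity n q \<longleftrightarrow>
     local_lipschitz (UNIV :: real set) UNIV (\<lambda>_. n) \<and>
     (\<exists>n\<^sub>q n\<^sub>r. (\<forall>x. n x = n\<^sub>q x + n\<^sub>r x) \<and>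
        ((\<exists>\<gamma>. \<gamma> \<noteq> 0 \<and> (\<forall>x. n\<^sub>q x = \<gamma> * \<bar>x\<bar> powr (1 + q))) \<or>
         (\<exists>\<gamma>>0. \<forall>x. n\<^sub>q x = \<gamma> * x * \<bar>x\<bar> powr q)) \<and>
        (\<forall>\<zeta>. 0 < \<zeta> \<and> \<zeta> < 1 + q \<and> holder_loc \<zeta> n \<longrightarrow>
           (\<forall>j\<le>nat \<lfloor>\<zeta>\<rfloor>. (deriv ^^ j) n\<^sub>r \<in> o[at 0](\<lambda>x. \<bar>x\<bar> powr (1 + q - real j))))) \<and>
     (\<not> Ck_on 1 n UNIV \<longrightarrow>
        (\<exists>c>0. \<exists>\<epsilon>>0. AE x in lborel. \<bar>x\<bar> < \<epsilon> \<longrightarrow>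
           n differentiable (at x) \<and> \<bar>deriv n x\<bar> \<le> c * \<bar>x\<bar> powr q))"

end

theory Submission
  imports Defs
begin

text \<open>
The idea is to bound the supremum \<open>U\<close> of a small solution by a small multiple of itself. On the Fourier side the equation
reads \<open>(\<nu> - m \<xi>) * v \<xi> = g \<xi>\<close>, where \<open>v\<close> and \<open>g\<close> are the transforms of \<open>u\<close> and \<open>n u\<close>, and \<open>n u = O(U^q * \<bar>u\<bar>)\<close>.
Since \<open>m 0 - m \<xi>\<close> is at least \<open>c * \<bar>\<xi>\<bar>^(2l)\<close> for \<open>\<bar>\<xi>\<bar> \<le> 1\<close> and at least \<open>c\<close> beyond, the factor \<open>\<nu> - m \<xi>\<close> is elliptic except for
frequencies below a threshold \<open>\<mu>\<close> of size \<open>U^(q / (2l))\<close>. A function with frequencies below \<open>\<mu>\<close> is bounded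
by a constant times \<open>sqrt \<mu>\<close> times its L2 norm, and \<open>sqrt \<mu>\<close> is of size \<open>U^(q / (4l))\<close>,
which for \<open>U \<le> 1\<close> is at most \<open>U\<close> because \<open>q \<ge> 4 l\<close>. As the L2 norm of \<open>u\<close>
is below \<open>\<delta>\<close>, these frequencies contribute at most a multiple of \<open>\<delta> * U\<close>. The frequencies between \<open>\<mu>\<close> and 1 are controlled by
\<open>\<bar>g \<xi>\<bar> / \<bar>\<xi>\<bar>^(2l)\<close>, which after integration has the same size.

At high frequencies \<open>v = O(g)\<close> holds in L2 only, which says nothing about the supremum. There the smoothing of \<open>L\<close> is used:
repeated substitution of \<open>\<nu> u = L u + n u\<close> into itself expresses \<open>u\<close> by an iterate \<open>L^N u\<close> and terms \<open>L^j (n u)\<close>. The latter are \<open>O(U^(1 + q))\<close>,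
because \<open>L\<close> is a convolution with an integrable kernel, and the former has the transform \<open>m^N * v\<close>, which is integrable
as soon as \<open>m^N\<close> decays like \<open>1 / \<bar>\<xi>\<bar>\<close>. Altogether \<open>U\<close> is at most a constant times \<open>\<delta> * U\<close>, hence \<open>U = 0\<close>. The lemmas
carrying this argument are \<open>symbol_coercive\<close>, \<open>spectral_integral_bound\<close>, \<open>iterated_bound\<close> and \<open>no_small_solutions\<close>.

The argument requires Plancherel's theorem (\<open>energy_fourier_L2_le\<close>, \<open>energy_le_fourier_L2\<close>), a bound of a function by the L1 norm
of its transform (\<open>AE_norm_le_integral_fourier_L2\<close>) and the convolution theorem in L2 (\<open>has_fourier_L2_kernel_op\<close>). They are derived
from a single identity, the inversion formula with Gaussian cut-off (\<open>fourier_L1_inversion_gauss\<close>,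
\<open>fourier_L2_inversion_gauss\<close>), and from the convergence of Gaussian averages in L2 (\<open>energy_mollify_tendsto\<close>).
\<close>

section \<open>The space of square-integrable functions\<close>

text \<open>The squared L2 norm with values in \<open>[0, \<infinity>]\<close>: limits, Fatou's lemma and Tonelli's theorem then need no side
conditions of integrability.\<close>
definition energy :: "(real \<Rightarrow> complex) \<Rightarrow> ennreal" where
  "energy f = (\<integral>\<^sup>+x. ennreal ((norm (f x))\<^sup>2) \<partial>lborel)"

lemma square_integrable_iff_energy:
  "square_integrable f \<longleftrightarrow> f \<in> borel_measurable borel \<and> energy f < \<infinity>"
  unfolding square_integrable_def energy_def
  by (auto simp: integrable_iff_bounded)

lemma energy_eq_L2_norm:
  assumes "square_integrable f"
  shows "energy f = ennreal ((L2_norm f)\<^sup>2)"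
  using assms unfolding square_integrable_def energy_def L2_norm_def
  by (subst nn_integral_eq_integral) auto

lemma energy_cong_AE:
  assumes "AE x in lborel. norm (f x) = norm (g x)"
  shows "energy f = energy g"
  unfolding energy_def using assms by (intro nn_integral_cong_AE) auto

lemma energy_mono_AE:
  assumes "AE x in lborel. norm (f x) \<le> norm (g x)"
  shows "energy f \<le> energy g"
  unfolding energy_def
proof (rule nn_integral_mono_AE, use assms in eventually_elim)
  fix x assume "norm (f x) \<le> norm (g x)"
  then show "ennreal ((norm (f x))\<^sup>2) \<le> ennreal ((norm (g x))\<^sup>2)"
    by (intro ennreal_leI power_mono) auto
qed

lemma energy_eq_0_iff:
  assumes [measurable]: "f \<in> borel_measurable borel"
  shows "energy f = 0 \<longleftrightarrow> (AE x in lborel. f x = 0)"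
  unfolding energy_def by (subst nn_integral_0_iff_AE) auto

lemma energy_cmult:
  assumes [measurable]: "f \<in> borel_measurable borel"
  shows "energy (\<lambda>x. c * f x) = ennreal ((norm c)\<^sup>2) * energy f"
  unfolding energy_def
  by (subst nn_integral_cmult[symmetric])
     (auto simp: norm_mult power_mult_distrib ennreal_mult)

text \<open>A triangle inequality up to the factor 2. The factor is harmless for finiteness and for passing to limits.\<close>
lemma energy_add_le:
  assumes [measurable]: "f \<in> borel_measurable borel" "g \<in> borel_measurable borel"
  shows "energy (\<lambda>x. f x + g x) \<le> 2 * energy f + 2 * energy g"
proof -
  have "(norm (f x + g x))\<^sup>2 \<le> 2 * (norm (f x))\<^sup>2 + 2 * (norm (g x))\<^sup>2" for x
  proof -
    have "(norm (f x + g x))\<^sup>2 \<le> (norm (f x) + norm (g x))\<^sup>2"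
      by (intro power_mono norm_triangle_ineq) auto
    also have "\<dots> \<le> 2 * (norm (f x))\<^sup>2 + 2 * (norm (g x))\<^sup>2"
      using sum_squares_bound[of "norm (f x)" "norm (g x)"] by (simp add: power2_sum)
    finally show ?thesis .
  qed
  then have "energy (\<lambda>x. f x + g x)
      \<le> (\<integral>\<^sup>+x. ennreal (2 * (norm (f x))\<^sup>2 + 2 * (norm (g x))\<^sup>2) \<partial>lborel)"
    unfolding energy_def by (intro nn_integral_mono ennreal_leI) auto
  also have "\<dots> = 2 * energy f + 2 * energy g"
    unfolding energy_def
    by (subst nn_integral_cmult[symmetric], measurable)+
       (subst nn_integral_add[symmetric], auto simp: ennreal_mult ennreal_plus intro!: nn_integral_cong)
  finally show ?thesis .
qed

lemma energy_minus: "energy (\<lambda>x. - f x) = energy f"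
  by (simp add: energy_def)

lemma energy_diff_commute: "energy (\<lambda>x. f x - g x) = energy (\<lambda>x. g x - f x)"
  by (simp add: energy_def norm_minus_commute)

lemma energy_diff_triangle:
  assumes [measurable]: "f \<in> borel_measurable borel" "g \<in> borel_measurable borel"
    "h \<in> borel_measurable borel"
  shows "energy (\<lambda>x. f x - h x) \<le> 2 * energy (\<lambda>x. f x - g x) + 2 * energy (\<lambda>x. g x - h x)"
  using energy_add_le[of "\<lambda>x. f x - g x" "\<lambda>x. g x - h x"] by simp

lemma square_integrable_cmult:
  fixes f :: "real \<Rightarrow> complex"
  assumes "square_integrable f"
  shows "square_integrable (\<lambda>x. c * f x)"
  using assms by (auto simp: square_integrable_iff_energy energy_cmult ennreal_mult_less_top)

lemma square_integrable_add:
  fixes f g :: "real \<Rightarrow> complex"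
  assumes "square_integrable f" "square_integrable g"
  shows "square_integrable (\<lambda>x. f x + g x)"
proof -
  have "2 * energy f + 2 * energy g < \<infinity>"
    using assms by (auto simp: square_integrable_iff_energy ennreal_mult_less_top)
  then show ?thesis
    using assms energy_add_le[of f g] by (auto simp: square_integrable_iff_energy intro: le_less_trans)
qed

lemma square_integrable_diff:
  fixes f g :: "real \<Rightarrow> complex"
  assumes "square_integrable f" "square_integrable g"
  shows "square_integrable (\<lambda>x. f x - g x)"
  using square_integrable_add[OF assms(1) square_integrable_cmult[OF assms(2), of "-1"]] by simp

lemma square_integrable_bounded_mult:
  fixes f a :: "real \<Rightarrow> complex"
  assumes sq: "square_integrable f" and [measurable]: "a \<in> borel_measurable borel"
    and le: "\<And>x. norm (a x) \<le> B"
  shows "square_integrable (\<lambda>x. a x * f x)"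
    and "energy (\<lambda>x. a x * f x) \<le> ennreal (B\<^sup>2) * energy f"
proof -
  have [measurable]: "f \<in> borel_measurable borel" and fin: "energy f < \<infinity>"
    using sq by (auto simp: square_integrable_iff_energy)
  have "0 \<le> B" using order_trans[OF norm_ge_zero le] .
  then have "energy (\<lambda>x. a x * f x) \<le> energy (\<lambda>x. of_real B * f x)"
    using le by (intro energy_mono_AE) (auto simp: norm_mult intro!: mult_right_mono)
  also have "\<dots> = ennreal (B\<^sup>2) * energy f" by (simp add: energy_cmult)
  finally show le': "energy (\<lambda>x. a x * f x) \<le> ennreal (B\<^sup>2) * energy f" .
  have "ennreal (B\<^sup>2) * energy f < \<infinity>" using fin by (simp add: ennreal_mult_less_top)
  with le' show "square_integrable (\<lambda>x. a x * f x)"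
    by (auto simp: square_integrable_iff_energy intro: le_less_trans)
qed

lemma square_integrable_bounded_integrable:
  fixes f :: "real \<Rightarrow> complex"
  assumes f: "integrable lborel f" and le: "AE x in lborel. norm (f x) \<le> B"
  shows "square_integrable f"
proof -
  have [measurable]: "f \<in> borel_measurable borel" using f by auto
  have "integrable lborel (\<lambda>x. (norm (f x))\<^sup>2)"
  proof (rule Bochner_Integration.integrable_bound)
    show "integrable lborel (\<lambda>x. \<bar>B\<bar> * norm (f x))" using f by auto
    show "AE x in lborel. norm ((norm (f x))\<^sup>2) \<le> norm (\<bar>B\<bar> * norm (f x))"
      using le by eventually_elim (auto simp: power2_eq_square abs_mult intro!: mult_right_mono)
  qed auto
  then show ?thesis by (simp add: square_integrable_def)
qed

lemma square_integrable_reflect: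
  fixes f :: "real \<Rightarrow> complex"
  assumes "square_integrable f"
  shows "square_integrable (\<lambda>x. f (y - x))"
  using assms lborel_integrable_real_affine_iff[of "-1" "\<lambda>x. (norm (f x))\<^sup>2" y]
  by (auto simp: square_integrable_def)

lemma L2_norm_nonneg: "0 \<le> L2_norm f"
  by (simp add: L2_norm_def)

lemma L2_norm_mono:
  fixes f g :: "real \<Rightarrow> complex"
  assumes "square_integrable f" "square_integrable g" "energy f \<le> ennreal (c\<^sup>2) * energy g" "0 \<le> c"
  shows "L2_norm f \<le> c * L2_norm g"
proof -
  have "ennreal ((L2_norm f)\<^sup>2) \<le> ennreal ((c * L2_norm g)\<^sup>2)"
    using assms by (simp add: energy_eq_L2_norm power_mult_distrib ennreal_mult)
  then have "(L2_norm f)\<^sup>2 \<le> (c * L2_norm g)\<^sup>2" by (simp add: ennreal_le_iff)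
  then show ?thesis
    by (rule power2_le_imp_le) (simp add: assms(4) L2_norm_nonneg)
qed

lemma ennreal_norm_power2: "ennreal ((norm z)\<^sup>2) = (ennreal (norm z))\<^sup>2"
  by (simp add: ennreal_power)

lemma two_times_ennreal: "0 \<le> x \<Longrightarrow> 2 * ennreal x = ennreal (2 * x)"
  by (simp add: ennreal_mult)

lemma exists_real_below_ennreal:
  fixes a :: ennreal
  assumes "0 < a"
  shows "\<exists>e>0. ennreal e < a"
  using assms
  by (metis ennreal_enn2real ennreal_less_zero_iff dense less_le_trans less_top
      not_less_iff_gr_or_eq top.not_eq_extremum)

text \<open>For a non-integrable function the left-hand side is 0, the default value of the Bochner integral.\<close>
lemma norm_integral_le_nn_integral:
  fixes f :: "'a \<Rightarrow> 'b::{banach, second_countable_topology}"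
  shows "ennreal (norm (integral\<^sup>L M f)) \<le> (\<integral>\<^sup>+x. norm (f x) \<partial>M)"
  by (cases "integrable M f") (auto intro: integral_norm_bound_ennreal simp: not_integrable_integral_eq)

lemma integrable_mult_square_integrable:
  fixes f g :: "real \<Rightarrow> complex"
  assumes "square_integrable f" "square_integrable g"
  shows "integrable lborel (\<lambda>x. f x * g x)"
proof -
  have [measurable]: "f \<in> borel_measurable borel" "g \<in> borel_measurable borel"
    and fin: "energy f < \<infinity>" "energy g < \<infinity>"
    using assms by (auto simp: square_integrable_iff_energy)
  have "(\<integral>\<^sup>+x. ennreal (norm (f x)) * ennreal (norm (g x)) \<partial>lborel)\<^sup>2 \<le> energy f * energy g"
    unfolding energy_def ennreal_norm_power2 by (rule Cauchy_Schwarz_nn_integral) auto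
  also have "\<dots> < \<infinity>" using fin by (simp add: ennreal_mult_less_top)
  finally have "(\<integral>\<^sup>+x. ennreal (norm (f x)) * ennreal (norm (g x)) \<partial>lborel) < \<infinity>"
    by (simp add: power_less_top_ennreal)
  then show ?thesis
    by (intro integrableI_bounded) (auto simp: norm_mult ennreal_mult)
qed

text \<open>The Cauchy--Schwarz inequality.\<close>
lemma norm_integral_mult_le:
  fixes f g :: "real \<Rightarrow> complex"
  assumes [measurable]: "f \<in> borel_measurable borel" "g \<in> borel_measurable borel"
  shows "(ennreal (norm (LINT x|lborel. f x * g x)))\<^sup>2 \<le> energy f * energy g"
proof -
  have "(ennreal (norm (LINT x|lborel. f x * g x)))\<^sup>2
      \<le> (\<integral>\<^sup>+x. ennreal (norm (f x)) * ennreal (norm (g x)) \<partial>lborel)\<^sup>2"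
    using norm_integral_le_nn_integral[of lborel "\<lambda>x. f x * g x"]
    by (intro power_mono) (auto simp: norm_mult ennreal_mult)
  also have "\<dots> \<le> energy f * energy g"
    unfolding energy_def ennreal_norm_power2 by (rule Cauchy_Schwarz_nn_integral) auto
  finally show ?thesis .
qed

text \<open>Bounds on the L2 norm survive almost everywhere limits; with the extraction of almost everywhere
convergent subsequences below this is how norm inequalities are transferred from nice functions to all of L2.\<close>
lemma energy_Fatou:
  fixes f :: "nat \<Rightarrow> real \<Rightarrow> complex"
  assumes [measurable]: "\<And>k. f k \<in> borel_measurable borel"
    and lim: "AE x in lborel. (\<lambda>k. f k x) \<longlonglongrightarrow> g x"
    and le: "\<And>k. energy (f k) \<le> c"
  shows "energy g \<le> c"
proof -
  have "energy g = (\<integral>\<^sup>+x. liminf (\<lambda>k. ennreal ((norm (f k x))\<^sup>2)) \<partial>lborel)"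
    unfolding energy_def
  proof (rule nn_integral_cong_AE, use lim in eventually_elim)
    fix x assume "(\<lambda>k. f k x) \<longlonglongrightarrow> g x"
    then have "(\<lambda>k. ennreal ((norm (f k x))\<^sup>2)) \<longlonglongrightarrow> ennreal ((norm (g x))\<^sup>2)"
      by (intro tendsto_intros)
    then show "ennreal ((norm (g x))\<^sup>2) = liminf (\<lambda>k. ennreal ((norm (f k x))\<^sup>2))"
      by (intro lim_imp_Liminf[symmetric]) simp_all
  qed
  also have "\<dots> \<le> liminf (\<lambda>k. energy (f k))"
    unfolding energy_def by (rule nn_integral_liminf) measurable
  also have "\<dots> \<le> limsup (\<lambda>k. energy (f k))"
    by (rule Liminf_le_Limsup) simp
  also have "\<dots> \<le> c"
    by (intro Limsup_bounded always_eventually allI le)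
  finally show ?thesis .
qed

lemma energy_dominated_convergence:
  fixes f :: "nat \<Rightarrow> real \<Rightarrow> complex"
  assumes [measurable]: "\<And>k. f k \<in> borel_measurable borel" "w \<in> borel_measurable borel"
    and lim: "AE x in lborel. (\<lambda>k. f k x) \<longlonglongrightarrow> 0"
    and dom: "\<And>k. AE x in lborel. ennreal ((norm (f k x))\<^sup>2) \<le> w x"
    and fin: "(\<integral>\<^sup>+x. w x \<partial>lborel) < \<infinity>"
  shows "(\<lambda>k. energy (f k)) \<longlonglongrightarrow> 0"
proof -
  have "(\<lambda>k. \<integral>\<^sup>+x. ennreal ((norm (f k x))\<^sup>2) \<partial>lborel) \<longlonglongrightarrow> (\<integral>\<^sup>+x. 0 \<partial>(lborel :: real measure))"
  proof (rule nn_integral_dominated_convergence[where w = w])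
    show "AE x in lborel. (\<lambda>k. ennreal ((norm (f k x))\<^sup>2)) \<longlonglongrightarrow> 0"
      using lim
    proof eventually_elim
      fix x assume "(\<lambda>k. f k x) \<longlonglongrightarrow> 0"
      then have "(\<lambda>k. ennreal ((norm (f k x))\<^sup>2)) \<longlonglongrightarrow> ennreal ((norm (0::complex))\<^sup>2)"
        by (intro tendsto_intros)
      then show "(\<lambda>k. ennreal ((norm (f k x))\<^sup>2)) \<longlonglongrightarrow> 0" by simp
    qed
  qed (use dom fin in auto)
  then show ?thesis by (simp add: energy_def)
qed

lemma energy_tendsto_AE_subseq:
  fixes f :: "nat \<Rightarrow> real \<Rightarrow> complex"
  assumes [measurable]: "\<And>k. f k \<in> borel_measurable borel" "g \<in> borel_measurable borel"
    and lim: "(\<lambda>k. energy (\<lambda>x. f k x - g x)) \<longlonglongrightarrow> 0"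
  shows "\<exists>r. strict_mono r \<and> (AE x in lborel. (\<lambda>k. f (r k) x) \<longlonglongrightarrow> g x)"
proof -
  have "eventually (\<lambda>k. energy (\<lambda>x. f k x - g x) < 1) sequentially"
    using lim by (rule order_tendstoD) simp
  then obtain k0 where k0: "\<And>k. k \<ge> k0 \<Longrightarrow> energy (\<lambda>x. f k x - g x) < 1"
    by (auto simp: eventually_sequentially)
  have sq: "square_integrable (\<lambda>x. f (k + k0) x - g x)" for k
    using k0[of "k + k0"] less_trans[OF _ ennreal_less_top[of 1]]
    by (auto simp: square_integrable_iff_energy)
  define u where "u k x = (norm (f (k + k0) x - g x))\<^sup>2" for k x
  have "integrable lborel (u k)" for k
    using sq[of k] unfolding square_integrable_def u_def by simp
  moreover have "(\<lambda>k. LINT x|lborel. norm (u k x)) \<longlonglongrightarrow> 0"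
  proof -
    have "(LINT x|lborel. norm (u k x)) = enn2real (energy (\<lambda>x. f (k + k0) x - g x))" for k
      unfolding u_def energy_def by (subst integral_eq_nn_integral) auto
    moreover have "(\<lambda>k. enn2real (energy (\<lambda>x. f (k + k0) x - g x))) \<longlonglongrightarrow> enn2real 0"
      using lim by (intro tendsto_enn2real LIMSEQ_ignore_initial_segment[where k = k0]) auto
    ultimately show ?thesis by simp
  qed
  ultimately obtain r where r: "strict_mono r" "AE x in lborel. (\<lambda>n. u (r n) x) \<longlonglongrightarrow> 0"
    using tendsto_L1_AE_subseq[of lborel u] by auto
  have "AE x in lborel. (\<lambda>k. f (r k + k0) x) \<longlonglongrightarrow> g x"
    using r(2)
  proof eventually_elim
    fix x assume "(\<lambda>n. u (r n) x) \<longlonglongrightarrow> 0"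
    then have "(\<lambda>n. sqrt (u (r n) x)) \<longlonglongrightarrow> sqrt 0" by (intro tendsto_intros)
    then have "(\<lambda>n. norm (f (r n + k0) x - g x)) \<longlonglongrightarrow> 0" by (simp add: u_def)
    then show "(\<lambda>k. f (r k + k0) x) \<longlonglongrightarrow> g x"
      by (rule LIM_zero_cancel[OF tendsto_norm_zero_cancel])
  qed
  moreover have "strict_mono (\<lambda>k. r k + k0)" using r(1) by (simp add: strict_mono_def)
  ultimately show ?thesis by blast
qed

text \<open>The Riesz--Fischer theorem. A subsequence with geometrically small increments converges almost everywhere,
and Fatou's lemma identifies its limit as the L2 limit of the whole sequence.\<close>
lemma energy_complete:
  fixes f :: "nat \<Rightarrow> real \<Rightarrow> complex"
  assumes [measurable]: "\<And>k. f k \<in> borel_measurable borel"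
    and fin: "\<And>k. energy (f k) < \<infinity>"
    and Cauchy: "\<And>e::real. 0 < e \<Longrightarrow>
      \<exists>N. \<forall>i\<ge>N. \<forall>j\<ge>N. energy (\<lambda>x. f i x - f j x) \<le> ennreal e"
  shows "\<exists>g. square_integrable g \<and> (\<lambda>k. energy (\<lambda>x. f k x - g x)) \<longlonglongrightarrow> 0"
proof -
  have "\<forall>n. \<exists>N. \<forall>i\<ge>N. \<forall>j\<ge>N. energy (\<lambda>x. f i x - f j x) \<le> ennreal ((1/8)^n)"
    using Cauchy by simp
  then obtain N where N: "\<And>n i j. i \<ge> N n \<Longrightarrow> j \<ge> N n \<Longrightarrow>
      energy (\<lambda>x. f i x - f j x) \<le> ennreal ((1/8)^n)"
    by metis
  define r where "r n = (\<Sum>i\<le>n. N i)" for n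
  have r_mono: "r n \<le> r m" if "n \<le> m" for n m
    unfolding r_def using that by (intro sum_mono2) auto
  have r_ge: "N n \<le> r m" if "n \<le> m" for n m
  proof -
    have "N n \<le> r n" unfolding r_def by (rule member_le_sum) auto
    then show ?thesis using r_mono[OF that] by simp
  qed
  (* The weight 4^n turns the bound 8^-n on the energies of the increments into
     pointwise geometric decay almost everywhere. *)
  define d where "d n x = f (r (Suc n)) x - f (r n) x" for n x
  have [measurable]: "d n \<in> borel_measurable borel" for n
    unfolding d_def by measurable
  define S where "S x = (\<Sum>n. ennreal (4^n * (norm (d n x))\<^sup>2))" for x
  have [measurable]: "S \<in> borel_measurable borel" unfolding S_def by measurable
  have "(\<integral>\<^sup>+x. S x \<partial>lborel) = (\<Sum>n. \<integral>\<^sup>+x. ennreal (4^n * (norm (d n x))\<^sup>2) \<partial>lborel)"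
    unfolding S_def by (rule nn_integral_suminf) measurable
  also have "\<dots> \<le> (\<Sum>n. ennreal ((1/2)^n))"
  proof (rule suminf_le)
    fix n
    have "(\<integral>\<^sup>+x. ennreal (4^n * (norm (d n x))\<^sup>2) \<partial>lborel) = ennreal (4^n) * energy (d n)"
      unfolding energy_def by (subst nn_integral_cmult[symmetric]) (auto simp: ennreal_mult)
    also have "\<dots> \<le> ennreal (4^n) * ennreal ((1/8)^n)"
      unfolding d_def by (intro mult_left_mono N r_ge) auto
    also have "\<dots> = ennreal ((1/2)^n)"
      by (subst ennreal_mult[symmetric]) (auto simp flip: power_mult_distrib)
    finally show "(\<integral>\<^sup>+x. ennreal (4^n * (norm (d n x))\<^sup>2) \<partial>lborel) \<le> ennreal ((1/2)^n)" .
  qed auto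
  also have "\<dots> < \<infinity>"
    by (subst suminf_ennreal2) (auto intro!: summable_geometric)
  finally have "AE x in lborel. S x \<noteq> \<infinity>"
    by (intro nn_integral_noteq_infinite) auto
  then have conv: "AE x in lborel. convergent (\<lambda>n. f (r n) x)"
  proof eventually_elim
    fix x assume "S x \<noteq> \<infinity>"
    define c where "c = enn2real (S x)"
    have c: "ennreal c = S x" using \<open>S x \<noteq> \<infinity>\<close> by (simp add: c_def less_top)
    have "norm (d n x) \<le> sqrt c * (1/2)^n" for n
    proof -
      have four: "((2::real)^n)\<^sup>2 = 4^n"
        by (simp add: power2_eq_square flip: power_mult_distrib)
      have "ennreal (4^n * (norm (d n x))\<^sup>2) \<le> S x"
      proof -
        define F where "F k = ennreal (4^k * (norm (d k x))\<^sup>2)" for k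
        have "sum F {n} \<le> suminf F" by (rule sum_le_suminf[OF summableI]) auto
        then show ?thesis by (simp add: S_def F_def[abs_def])
      qed
      then have "ennreal (4^n * (norm (d n x))\<^sup>2) \<le> ennreal c"
        by (simp only: c)
      moreover have "0 \<le> c" by (simp add: c_def)
      ultimately have "4^n * (norm (d n x))\<^sup>2 \<le> c"
        by (subst (asm) ennreal_le_iff)
      then have "(2^n * norm (d n x))\<^sup>2 \<le> c"
        by (simp add: power_mult_distrib four)
      then have "2^n * norm (d n x) \<le> sqrt c"
        by (rule real_le_rsqrt)
      then show ?thesis by (simp add: field_simps power_divide)
    qed
    then have "summable (\<lambda>n. d n x)"
      by (intro summable_comparison_test[OF _ summable_mult[OF summable_geometric[of "1/2"]]]) auto
    then have "convergent (\<lambda>n. (\<Sum>k<n. d k x))"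
      by (simp add: summable_iff_convergent)
    then have "convergent (\<lambda>n. f (r n) x - f (r 0) x)"
      unfolding d_def by (simp only: sum_lessThan_telescope[of "\<lambda>n. f (r n) x"])
    then have "convergent (\<lambda>n. (f (r n) x - f (r 0) x) + f (r 0) x)"
      by (intro convergent_add convergent_const)
    then show "convergent (\<lambda>n. f (r n) x)" by simp
  qed
  define g where "g x = lim (\<lambda>n. f (r n) x)" for x
  have g_meas[measurable]: "g \<in> borel_measurable borel" unfolding g_def by measurable
  have glim: "AE x in lborel. (\<lambda>n. f (r n) x) \<longlonglongrightarrow> g x"
    using conv by eventually_elim (simp add: g_def convergent_LIMSEQ_iff)
  have key: "\<exists>M. \<forall>i\<ge>M. energy (\<lambda>x. f i x - g x) \<le> ennreal e" if e: "0 < e" for e :: real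
  proof -
    obtain M where M: "\<And>i j. i \<ge> M \<Longrightarrow> j \<ge> M \<Longrightarrow> energy (\<lambda>x. f i x - f j x) \<le> e"
      using Cauchy[OF e] by blast
    obtain n0 where n0: "(1/8)^n0 < e" using real_arch_pow_inv[of e "1/8"] e by auto
    have "energy (\<lambda>x. f i x - g x) \<le> e" if "i \<ge> N n0" for i
    proof (rule energy_Fatou[where f = "\<lambda>k x. f i x - f (r (k + n0)) x"])
      show "AE x in lborel. (\<lambda>k. f i x - f (r (k + n0)) x) \<longlonglongrightarrow> f i x - g x"
        using glim by eventually_elim (intro tendsto_intros LIMSEQ_ignore_initial_segment)
      show "energy (\<lambda>x. f i x - f (r (k + n0)) x) \<le> e" for k
        using N[OF that r_ge[of n0 "k + n0"]] n0 by (force intro: order_trans ennreal_leI less_imp_le)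
    qed measurable
    then show ?thesis by blast
  qed
  have lim: "(\<lambda>k. energy (\<lambda>x. f k x - g x)) \<longlonglongrightarrow> 0"
  proof (rule order_tendstoI)
    fix a :: ennreal assume "0 < a"
    then obtain e :: real where e: "e > 0" "ennreal e < a"
      using exists_real_below_ennreal by blast
    then show "eventually (\<lambda>k. energy (\<lambda>x. f k x - g x) < a) sequentially"
      using key[OF e(1)] by (force simp: eventually_sequentially intro: le_less_trans)
  qed auto
  obtain M where M: "energy (\<lambda>x. f M x - g x) \<le> ennreal 1"
    using key[of 1] by auto
  have "energy g = energy (\<lambda>x. (g x - f M x) - (- f M x))" by simp
  also have "\<dots> \<le> 2 * energy (\<lambda>x. g x - f M x) + 2 * energy (\<lambda>x. - f M x)"
    using energy_add_le[of "\<lambda>x. g x - f M x" "f M"] by (simp add: energy_minus)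
  also have "\<dots> < \<infinity>"
    using M fin[of M] by (auto simp: energy_diff_commute[of g] energy_minus ennreal_mult_less_top intro: le_less_trans)
  finally show ?thesis
    using lim g_meas by (intro exI[of _ g]) (simp add: square_integrable_iff_energy)
qed

section \<open>Translations, convolution and Gaussian averages\<close>

lemma energy_translate:
  assumes [measurable]: "f \<in> borel_measurable borel"
  shows "energy (\<lambda>x. f (x - y)) = energy f"
  unfolding energy_def
  using nn_integral_real_affine[of "\<lambda>x. ennreal ((norm (f x))\<^sup>2)" 1 "-y"]
  by (simp add: add.commute)

text \<open>Density of the continuous functions with compact support in L2. A truncation of \<open>f\<close> is bounded with bounded
support, and every measurable function is an almost everywhere limit of continuous functions; after clamping and
cutting off, dominated convergence applies.\<close>
lemma energy_approx_compactly_supported: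
  assumes sq: "square_integrable f" and e: "0 < (e::real)"
  shows "\<exists>g B R. continuous_on UNIV g \<and> (\<forall>x. norm (g x :: complex) \<le> B) \<and>
    (\<forall>x. R < \<bar>x\<bar> \<longrightarrow> g x = 0) \<and> energy (\<lambda>x. f x - g x) < ennreal e"
proof -
  have [measurable]: "f \<in> borel_measurable borel" and fin: "energy f < \<infinity>"
    using sq by (auto simp: square_integrable_iff_energy)
  define t where "t N x = (if \<bar>x\<bar> \<le> real N \<and> norm (f x) \<le> real N then f x else 0)" for N :: nat and x
  have [measurable]: "t N \<in> borel_measurable borel" for N unfolding t_def by measurable
  have "(\<lambda>N. energy (\<lambda>x. f x - t N x)) \<longlonglongrightarrow> 0"
  proof (rule energy_dominated_convergence[where w = "\<lambda>x. ennreal ((norm (f x))\<^sup>2)"])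
    have "(\<lambda>N. f x - t N x) \<longlonglongrightarrow> 0" for x
    proof (rule tendsto_eventually)
      obtain M :: nat where "max \<bar>x\<bar> (norm (f x)) \<le> M" using real_arch_simple by blast
      then have "\<forall>N\<ge>M. f x - t N x = 0" by (auto simp: t_def)
      then show "eventually (\<lambda>N. f x - t N x = 0) sequentially"
        by (auto simp: eventually_sequentially)
    qed
    then show "AE x in lborel. (\<lambda>N. f x - t N x) \<longlonglongrightarrow> 0" by simp
    show "AE x in lborel. ennreal ((norm (f x - t N x))\<^sup>2) \<le> ennreal ((norm (f x))\<^sup>2)" for N
      by (auto simp: t_def)
    show "(\<integral>\<^sup>+x. ennreal ((norm (f x))\<^sup>2) \<partial>lborel) < \<infinity>" using fin by (simp add: energy_def)
  qed measurable
  then have "eventually (\<lambda>N. energy (\<lambda>x. f x - t N x) < ennreal (e/8)) sequentially"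
    by (rule order_tendstoD) (use e in auto)
  then obtain N :: nat where N: "energy (\<lambda>x. f x - t N x) < ennreal (e/8)" "N \<ge> 1"
    by (metis (no_types, lifting) eventually_sequentially le_add1 le_add2)
  have "t N \<in> borel_measurable lebesgue"
    using measurable_completion[of "t N" lborel borel] by simp
  then have "t N measurable_on UNIV"
    by (rule lebesgue_measurable_imp_measurable_on) simp
  then obtain Z g where Z: "negligible Z" and g: "\<And>n. continuous_on UNIV (g n)"
    and glim: "\<And>x. x \<notin> Z \<Longrightarrow> (\<lambda>n. g n x) \<longlonglongrightarrow> t N x"
    unfolding measurable_on_def by auto
  (* The continuous approximants g n may be unbounded and spread over the whole line:
     clamp their values to the disc of radius N and cut off outside [-N-1, N+1]. Both operations
     leave the limit t N unchanged. *)
  define c where "c z = (real N / max (real N) (norm z)) *\<^sub>R z" for z :: complex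
  define cut where "cut x = max 0 (min 1 (real N + 1 - \<bar>x\<bar>))" for x :: real
  define h where "h n x = cut x *\<^sub>R c (g n x)" for n x
  have c_cont: "continuous_on UNIV c"
    unfolding c_def using N(2) by (intro continuous_intros) auto
  have c_le: "norm (c z) \<le> N" for z
    unfolding c_def using N(2) by (auto simp: field_simps max_def mult_left_mono)
  have c_id: "c z = z" if "norm z \<le> N" for z
    unfolding c_def using that N(2) by (simp add: max_def)
  have h_cont: "continuous_on UNIV (h n)" for n
    unfolding h_def[abs_def] cut_def
    by (intro continuous_intros continuous_on_compose2[OF c_cont] g) auto
  have [measurable]: "h n \<in> borel_measurable borel" for n
    by (rule borel_measurable_continuous_onI[OF h_cont])
  have h_le: "norm (h n x) \<le> N" for n x
  proof -
    have "\<bar>cut x\<bar> * norm (c (g n x)) \<le> 1 * real N"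
      using N(2) by (intro mult_mono c_le) (auto simp: cut_def)
    then show ?thesis by (simp add: h_def)
  qed
  have h_0: "h n x = 0" if "real N + 1 < \<bar>x\<bar>" for n and x :: real
    using that by (simp add: h_def cut_def)
  have t_le: "norm (t N x) \<le> N" for x by (simp add: t_def)
  have "(\<lambda>n. energy (\<lambda>x. t N x - h n x)) \<longlonglongrightarrow> 0"
  proof (rule energy_dominated_convergence[where
        w = "\<lambda>x. ennreal ((2 * real N)\<^sup>2) * indicator {-(real N + 1)..real N + 1} x"])
    have "AE x in lebesgue. x \<notin> Z"
      using Z by (intro AE_not_in) (simp add: negligible_iff_null_sets)
    then have "AE x in lborel. x \<notin> Z"
      by (simp add: AE_completion_iff)
    then show "AE x in lborel. (\<lambda>n. t N x - h n x) \<longlonglongrightarrow> 0"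
    proof eventually_elim
      fix x assume "x \<notin> Z"
      then have "(\<lambda>n. h n x) \<longlonglongrightarrow> cut x *\<^sub>R c (t N x)"
        unfolding h_def
        by (intro tendsto_intros isCont_tendsto_compose[OF _ glim])
           (use c_cont in \<open>auto simp: continuous_on_eq_continuous_at\<close>)
      moreover have "cut x *\<^sub>R c (t N x) = t N x"
        by (auto simp: c_id[OF t_le]) (auto simp: t_def cut_def)
      ultimately show "(\<lambda>n. t N x - h n x) \<longlonglongrightarrow> 0"
        using LIM_zero[of "\<lambda>n. h n x" "t N x"] tendsto_minus[of "\<lambda>n. h n x - t N x" 0] by simp
    qed
    show "AE x in lborel. ennreal ((norm (t N x - h n x))\<^sup>2)
        \<le> ennreal ((2 * real N)\<^sup>2) * indicator {-(real N + 1)..real N + 1} x" for n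
    proof (rule AE_I2)
      fix x :: real
      have "(norm (t N x - h n x))\<^sup>2 \<le> (2 * real N)\<^sup>2"
        using norm_triangle_ineq4[of "t N x" "h n x"] t_le[of x] h_le[of n x]
        by (intro power_mono) auto
      moreover have "t N x - h n x = 0" if "real N + 1 < \<bar>x\<bar>"
        using h_0[OF that] that by (simp add: t_def)
      ultimately show "ennreal ((norm (t N x - h n x))\<^sup>2)
        \<le> ennreal ((2 * real N)\<^sup>2) * indicator {-(real N + 1)..real N + 1} x"
        by (cases "real N + 1 < \<bar>x\<bar>") (auto simp: indicator_def intro!: ennreal_leI)
    qed
    show "(\<integral>\<^sup>+x. ennreal ((2 * real N)\<^sup>2) * indicator {-(real N + 1)..real N + 1} x \<partial>lborel) < \<infinity>"
      by (subst nn_integral_cmult_indicator) (auto simp: ennreal_mult_less_top)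
  qed measurable
  then have "eventually (\<lambda>n. energy (\<lambda>x. t N x - h n x) < ennreal (e/8)) sequentially"
    by (rule order_tendstoD) (use e in auto)
  then obtain n where n: "energy (\<lambda>x. t N x - h n x) < ennreal (e/8)"
    by (auto simp: eventually_sequentially)
  have "energy (\<lambda>x. f x - h n x) \<le> 2 * energy (\<lambda>x. f x - t N x) + 2 * energy (\<lambda>x. t N x - h n x)"
    by (rule energy_diff_triangle) measurable
  also have "\<dots> \<le> 2 * ennreal (e/8) + 2 * ennreal (e/8)"
    using N(1) n by (intro add_mono mult_left_mono) auto
  also have "\<dots> = ennreal (e/2)"
    using e by (simp add: two_times_ennreal flip: ennreal_plus)
  also have "\<dots> < ennreal e" using e by (simp add: ennreal_less_iff)
  finally show ?thesis
    using h_cont h_le h_0 by blast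
qed

text \<open>Translations are continuous in L2. For a continuous function with compact support this is dominated convergence,
and translations are isometries, so density gives the general case.\<close>
lemma energy_translate_tendsto:
  assumes sq: "square_integrable f" and y: "y \<longlonglongrightarrow> (0::real)"
  shows "(\<lambda>k. energy (\<lambda>x. f (x - y k) - f x)) \<longlonglongrightarrow> 0"
proof (rule order_tendstoI)
  have [measurable]: "f \<in> borel_measurable borel"
    using sq by (auto simp: square_integrable_iff_energy)
  fix a :: ennreal assume "0 < a"
  then obtain e :: real where e: "0 < e" "ennreal e < a"
    using exists_real_below_ennreal by blast
  (* e/12 because two applications of the triangle inequality give the coefficients 2, 4 and 4. *)
  obtain g B R where g: "continuous_on UNIV g" "\<And>x. norm (g x :: complex) \<le> B"
      "\<And>x. R < \<bar>x\<bar> \<Longrightarrow> g x = 0" "energy (\<lambda>x. f x - g x) < ennreal (e/12)"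
    using energy_approx_compactly_supported[OF sq, of "e/12"] e by auto
  have [measurable]: "g \<in> borel_measurable borel"
    by (rule borel_measurable_continuous_onI[OF g(1)])
  obtain Y where Y: "\<And>k. \<bar>y k\<bar> \<le> Y"
    using convergent_imp_Bseq[OF convergentI[OF y]] by (auto simp: Bseq_def)
  have "(\<lambda>k. energy (\<lambda>x. g (x - y k) - g x)) \<longlonglongrightarrow> 0"
  proof (rule energy_dominated_convergence[where
        w = "\<lambda>x. ennreal ((2 * B)\<^sup>2) * indicator {-(\<bar>R\<bar> + Y)..\<bar>R\<bar> + Y} x"])
    have "(\<lambda>k. g (x - y k) - g x) \<longlonglongrightarrow> 0" for x
    proof -
      have "(\<lambda>k. x - y k) \<longlonglongrightarrow> x" using tendsto_diff[OF tendsto_const y, of x] by simp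
      then have "(\<lambda>k. g (x - y k)) \<longlonglongrightarrow> g x"
        using g(1) by (intro isCont_tendsto_compose[where g = g]) (auto simp: continuous_on_eq_continuous_at)
      then show ?thesis by (simp add: LIM_zero)
    qed
    then show "AE x in lborel. (\<lambda>k. g (x - y k) - g x) \<longlonglongrightarrow> 0" by simp
    show "AE x in lborel. ennreal ((norm (g (x - y k) - g x))\<^sup>2)
        \<le> ennreal ((2 * B)\<^sup>2) * indicator {-(\<bar>R\<bar> + Y)..\<bar>R\<bar> + Y} x" for k
    proof (rule AE_I2)
      fix x :: real
      have "(norm (g (x - y k) - g x))\<^sup>2 \<le> (2 * B)\<^sup>2"
        using norm_triangle_ineq4[of "g (x - y k)" "g x"] g(2)[of "x - y k"] g(2)[of x]
        by (intro power_mono) auto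
      moreover have "g (x - y k) - g x = 0" if "\<bar>R\<bar> + Y < \<bar>x\<bar>"
        using that Y[of k] by (subst (1 2) g(3)) auto
      ultimately show "ennreal ((norm (g (x - y k) - g x))\<^sup>2)
        \<le> ennreal ((2 * B)\<^sup>2) * indicator {-(\<bar>R\<bar> + Y)..\<bar>R\<bar> + Y} x"
        by (cases "\<bar>R\<bar> + Y < \<bar>x\<bar>") (auto simp: indicator_def intro!: ennreal_leI)
    qed
    show "(\<integral>\<^sup>+x. ennreal ((2 * B)\<^sup>2) * indicator {-(\<bar>R\<bar> + Y)..\<bar>R\<bar> + Y} x \<partial>lborel) < \<infinity>"
      by (subst nn_integral_cmult_indicator) (auto simp: ennreal_mult_less_top emeasure_lborel_Icc_eq)
  qed measurable
  then have "eventually (\<lambda>k. energy (\<lambda>x. g (x - y k) - g x) < ennreal (e/12)) sequentially"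
    by (rule order_tendstoD) (use e in auto)
  then show "eventually (\<lambda>k. energy (\<lambda>x. f (x - y k) - f x) < a) sequentially"
  proof eventually_elim
    fix k assume k: "energy (\<lambda>x. g (x - y k) - g x) < ennreal (e/12)"
    have "energy (\<lambda>x. f (x - y k) - f x)
      \<le> 2 * energy (\<lambda>x. f (x - y k) - g (x - y k)) + 2 * energy (\<lambda>x. g (x - y k) - f x)"
      by (rule energy_diff_triangle) measurable
    also have "\<dots> \<le> 2 * energy (\<lambda>x. f (x - y k) - g (x - y k))
        + 2 * (2 * energy (\<lambda>x. g (x - y k) - g x) + 2 * energy (\<lambda>x. g x - f x))"
      by (intro add_left_mono mult_left_mono energy_diff_triangle) auto
    also have "energy (\<lambda>x. f (x - y k) - g (x - y k)) = energy (\<lambda>x. f x - g x)"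
      using energy_translate[of "\<lambda>x. f x - g x" "y k"] by simp
    also have "energy (\<lambda>x. g x - f x) = energy (\<lambda>x. f x - g x)"
      by (rule energy_diff_commute)
    also have "2 * energy (\<lambda>x. f x - g x) + 2 * (2 * energy (\<lambda>x. g (x - y k) - g x) + 2 * energy (\<lambda>x. f x - g x))
       \<le> 2 * ennreal (e/12) + 2 * (2 * ennreal (e/12) + 2 * ennreal (e/12))"
      using k g(4) by (intro add_mono mult_left_mono) auto
    also have "\<dots> \<le> ennreal e"
      using e(1) by (simp add: two_times_ennreal flip: ennreal_plus)
    also note e(2)
    finally show "energy (\<lambda>x. f (x - y k) - f x) < a" .
  qed
qed auto

definition conv :: "(real \<Rightarrow> real) \<Rightarrow> (real \<Rightarrow> complex) \<Rightarrow> real \<Rightarrow> complex" where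
  "conv P f x = (LINT y|lborel. P y *\<^sub>R f (x - y))"

lemma conv_measurable [measurable]:
  assumes [measurable]: "P \<in> borel_measurable borel" "f \<in> borel_measurable borel"
  shows "conv P f \<in> borel_measurable borel"
  unfolding conv_def[abs_def] by measurable

text \<open>The Cauchy--Schwarz inequality for the measure with density \<open>\<bar>P\<bar>\<close>, followed by Tonelli's theorem.
Taking \<open>G x y = f (x - y)\<close> gives Young's inequality, and \<open>G x y = f (x - y) - f x\<close> the convergence of mollifiers.\<close>
lemma energy_average_le:
  fixes P :: "real \<Rightarrow> real" and G :: "real \<Rightarrow> real \<Rightarrow> complex"
  assumes [measurable]: "P \<in> borel_measurable borel"
    "(\<lambda>(x, y). G x y) \<in> borel_measurable (borel \<Otimes>\<^sub>M borel)"
  shows "energy (\<lambda>x. LINT y|lborel. P y *\<^sub>R G x y)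
    \<le> (\<integral>\<^sup>+y. \<bar>P y\<bar> \<partial>lborel) * (\<integral>\<^sup>+y. \<bar>P y\<bar> * energy (\<lambda>x. G x y) \<partial>lborel)"
proof -
  have pt: "ennreal ((norm (LINT y|lborel. P y *\<^sub>R G x y))\<^sup>2)
      \<le> (\<integral>\<^sup>+y. \<bar>P y\<bar> \<partial>lborel) * (\<integral>\<^sup>+y. ennreal \<bar>P y\<bar> * ennreal ((norm (G x y))\<^sup>2) \<partial>lborel)" for x
  proof -
    have sq: "ennreal (sqrt a) ^ 2 = ennreal a" if "0 \<le> a" for a
      using that by (simp add: ennreal_power)
    have "ennreal ((norm (LINT y|lborel. P y *\<^sub>R G x y))\<^sup>2)
        \<le> (\<integral>\<^sup>+y. ennreal (norm (P y *\<^sub>R G x y)) \<partial>lborel)\<^sup>2"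
      unfolding ennreal_norm_power2 by (intro power_mono norm_integral_le_nn_integral) auto
    also have "(\<integral>\<^sup>+y. ennreal (norm (P y *\<^sub>R G x y)) \<partial>lborel)
      = (\<integral>\<^sup>+y. ennreal (sqrt \<bar>P y\<bar>) * ennreal (sqrt \<bar>P y\<bar> * norm (G x y)) \<partial>lborel)"
      by (intro nn_integral_cong) (auto simp: ennreal_mult[symmetric] mult.assoc[symmetric])
    also have "\<dots>\<^sup>2 \<le> (\<integral>\<^sup>+y. (ennreal (sqrt \<bar>P y\<bar>))\<^sup>2 \<partial>lborel)
        * (\<integral>\<^sup>+y. (ennreal (sqrt \<bar>P y\<bar> * norm (G x y)))\<^sup>2 \<partial>lborel)"
      by (rule Cauchy_Schwarz_nn_integral) measurable
    also have "\<dots> = (\<integral>\<^sup>+y. \<bar>P y\<bar> \<partial>lborel) * (\<integral>\<^sup>+y. ennreal \<bar>P y\<bar> * ennreal ((norm (G x y))\<^sup>2) \<partial>lborel)"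
      by (intro arg_cong2[of _ _ _ _ "(*)"] nn_integral_cong)
         (auto simp: sq ennreal_power power_mult_distrib ennreal_mult)
    finally show ?thesis .
  qed
  have "energy (\<lambda>x. LINT y|lborel. P y *\<^sub>R G x y)
      \<le> (\<integral>\<^sup>+x. (\<integral>\<^sup>+y. \<bar>P y\<bar> \<partial>lborel) * (\<integral>\<^sup>+y. ennreal \<bar>P y\<bar> * ennreal ((norm (G x y))\<^sup>2) \<partial>lborel) \<partial>lborel)"
    unfolding energy_def by (intro nn_integral_mono pt)
  also have "\<dots> = (\<integral>\<^sup>+y. \<bar>P y\<bar> \<partial>lborel)
      * (\<integral>\<^sup>+x. (\<integral>\<^sup>+y. ennreal \<bar>P y\<bar> * ennreal ((norm (G x y))\<^sup>2) \<partial>lborel) \<partial>lborel)"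
    by (intro nn_integral_cmult) measurable
  also have "(\<integral>\<^sup>+x. (\<integral>\<^sup>+y. ennreal \<bar>P y\<bar> * ennreal ((norm (G x y))\<^sup>2) \<partial>lborel) \<partial>lborel)
      = (\<integral>\<^sup>+y. (\<integral>\<^sup>+x. ennreal \<bar>P y\<bar> * ennreal ((norm (G x y))\<^sup>2) \<partial>lborel) \<partial>lborel)"
    by (rule lborel_pair.Fubini') measurable
  also have "\<dots> = (\<integral>\<^sup>+y. \<bar>P y\<bar> * energy (\<lambda>x. G x y) \<partial>lborel)"
    unfolding energy_def by (intro nn_integral_cong nn_integral_cmult) measurable
  finally show ?thesis .
qed

text \<open>Young's inequality for a kernel in L1 and a function in L2.\<close>
lemma energy_conv_le:
  assumes [measurable]: "P \<in> borel_measurable borel" "f \<in> borel_measurable borel"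
  shows "energy (conv P f) \<le> (\<integral>\<^sup>+y. \<bar>P y\<bar> \<partial>lborel)\<^sup>2 * energy f"
proof -
  have "energy (conv P f)
      \<le> (\<integral>\<^sup>+y. \<bar>P y\<bar> \<partial>lborel) * (\<integral>\<^sup>+y. \<bar>P y\<bar> * energy (\<lambda>x. f (x - y)) \<partial>lborel)"
    unfolding conv_def[abs_def] by (rule energy_average_le) measurable
  also have "(\<integral>\<^sup>+y. \<bar>P y\<bar> * energy (\<lambda>x. f (x - y)) \<partial>lborel) = (\<integral>\<^sup>+y. \<bar>P y\<bar> \<partial>lborel) * energy f"
    by (subst nn_integral_multc[symmetric]) (auto simp: energy_translate)
  finally show ?thesis by (simp add: power2_eq_square mult.assoc)
qed

lemma normal_density_le: "0 < \<epsilon> \<Longrightarrow> normal_density 0 \<epsilon> x \<le> 1 / sqrt (2 * pi * \<epsilon>\<^sup>2)"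
  by (auto simp: normal_density_def intro!: divide_right_mono)

lemma square_integrable_normal_density:
  assumes "0 < \<epsilon>"
  shows "square_integrable (\<lambda>x. complex_of_real (normal_density 0 \<epsilon> (x - y)))"
proof (rule square_integrable_bounded_integrable)
  have "(\<lambda>x. normal_density 0 \<epsilon> (x - y)) = normal_density y \<epsilon>"
    by (simp add: normal_density_def fun_eq_iff)
  then have "integrable lborel (\<lambda>x. normal_density 0 \<epsilon> (x - y))"
    using integrable_normal_density[OF assms, of y] by simp
  then show "integrable lborel (\<lambda>x. complex_of_real (normal_density 0 \<epsilon> (x - y)))"
    by simp
  show "AE x in lborel. norm (complex_of_real (normal_density 0 \<epsilon> (x - y))) \<le> 1 / sqrt (2 * pi * \<epsilon>\<^sup>2)"
    using normal_density_le[OF assms] by auto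
qed

lemma nn_integral_normal_density:
  assumes "0 < \<epsilon>"
  shows "(\<integral>\<^sup>+x. ennreal \<bar>normal_density 0 \<epsilon> x\<bar> \<partial>lborel) = 1"
  using assms by (simp add: nn_integral_eq_integral)

text \<open>Gaussian averages converge to \<open>f\<close> in L2. The error is at most the Gaussian average, over \<open>y\<close>, of the squared L2
distance between \<open>f\<close> and its translate by \<open>y\<close>; rescaling moves the small parameter from the Gaussian into that distance.\<close>
lemma energy_mollify_tendsto:
  assumes sq: "square_integrable f" and pos: "\<And>k. 0 < \<epsilon> k" and lim: "\<epsilon> \<longlonglongrightarrow> (0::real)"
  shows "(\<lambda>k. energy (\<lambda>x. conv (normal_density 0 (\<epsilon> k)) f x - f x)) \<longlonglongrightarrow> 0"
proof -
  have [measurable]: "f \<in> borel_measurable borel" and fin: "energy f < \<infinity>"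
    using sq by (auto simp: square_integrable_iff_energy)
  define om where "om y = energy (\<lambda>x. f (x - y) - f x)" for y
  have [measurable]: "om \<in> borel_measurable borel"
    unfolding om_def[abs_def] energy_def by measurable
  have om_le: "om y \<le> 4 * energy f" for y
  proof -
    have "om y \<le> 2 * energy (\<lambda>x. f (x - y)) + 2 * energy (\<lambda>x. - f x)"
      unfolding om_def using energy_add_le[of "\<lambda>x. f (x - y)" "\<lambda>x. - f x"] by simp
    also have "\<dots> = (2 + 2) * energy f"
      by (simp only: energy_minus energy_translate[OF \<open>f \<in> _\<close>] distrib_right)
    finally show ?thesis by simp
  qed
  have le: "energy (\<lambda>x. conv (normal_density 0 (\<epsilon> k)) f x - f x)
      \<le> (\<integral>\<^sup>+z. std_normal_density z * om (\<epsilon> k * z) \<partial>lborel)" for k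
  proof -
    have ek: "\<epsilon> k \<noteq> 0" "\<bar>\<epsilon> k\<bar> = \<epsilon> k" using pos[of k] by auto
    have "conv (normal_density 0 (\<epsilon> k)) f x - f x
        = (LINT y|lborel. normal_density 0 (\<epsilon> k) y *\<^sub>R (f (x - y) - f x))" for x
    proof -
      have "integrable lborel (\<lambda>y. complex_of_real (normal_density 0 (\<epsilon> k) y) * f (x - y))"
        using integrable_mult_square_integrable[OF square_integrable_normal_density[OF pos, of k 0]
            square_integrable_reflect[OF sq, of x]] by simp
      then have "integrable lborel (\<lambda>y. normal_density 0 (\<epsilon> k) y *\<^sub>R f (x - y))"
        by (simp add: scaleR_conv_of_real)
      moreover have "integrable lborel (\<lambda>y. normal_density 0 (\<epsilon> k) y *\<^sub>R f x)"
        using pos[of k] by (intro integrable_scaleR_left impI integrable_normal_density)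
      moreover have "(LINT y|lborel. normal_density 0 (\<epsilon> k) y *\<^sub>R f x) = f x"
        using pos[of k] by simp
      ultimately show ?thesis
        unfolding conv_def by (simp add: scaleR_diff_right)
    qed
    then have "energy (\<lambda>x. conv (normal_density 0 (\<epsilon> k)) f x - f x)
        = energy (\<lambda>x. LINT y|lborel. normal_density 0 (\<epsilon> k) y *\<^sub>R (f (x - y) - f x))"
      by simp
    also have "\<dots> \<le> (\<integral>\<^sup>+y. \<bar>normal_density 0 (\<epsilon> k) y\<bar> \<partial>lborel)
        * (\<integral>\<^sup>+y. \<bar>normal_density 0 (\<epsilon> k) y\<bar> * energy (\<lambda>x. f (x - y) - f x) \<partial>lborel)"
      by (rule energy_average_le) measurable
    also have "\<dots> = (\<integral>\<^sup>+y. normal_density 0 (\<epsilon> k) y * om y \<partial>lborel)"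
      unfolding nn_integral_normal_density[OF pos] om_def by simp
    also have "\<dots> = \<epsilon> k * (\<integral>\<^sup>+z. normal_density 0 (\<epsilon> k) (\<epsilon> k * z) * om (\<epsilon> k * z) \<partial>lborel)"
      by (subst nn_integral_real_affine[where c = "\<epsilon> k" and t = 0]) (use ek in auto)
    also have "\<dots> = (\<integral>\<^sup>+z. \<epsilon> k * (normal_density 0 (\<epsilon> k) (\<epsilon> k * z) * om (\<epsilon> k * z)) \<partial>lborel)"
      by (rule nn_integral_cmult[symmetric]) measurable
    also have "\<dots> = (\<integral>\<^sup>+z. std_normal_density z * om (\<epsilon> k * z) \<partial>lborel)"
    proof -
      have "\<epsilon> k * normal_density 0 (\<epsilon> k) (\<epsilon> k * z) = std_normal_density z" for z
        using pos[of k] by (simp add: normal_density_def real_sqrt_mult field_simps power_mult_distrib)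
      then have "ennreal (\<epsilon> k) * (ennreal (normal_density 0 (\<epsilon> k) (\<epsilon> k * z)) * om (\<epsilon> k * z))
          = ennreal (std_normal_density z) * om (\<epsilon> k * z)" for z
        by (metis ennreal_mult less_imp_le mult.assoc normal_density_nonneg pos)
      then show ?thesis by simp
    qed
    finally show ?thesis .
  qed
  have "(\<lambda>k. \<integral>\<^sup>+z. std_normal_density z * om (\<epsilon> k * z) \<partial>lborel) \<longlonglongrightarrow> (\<integral>\<^sup>+z. 0 \<partial>(lborel::real measure))"
  proof (rule nn_integral_dominated_convergence[where w = "\<lambda>z. std_normal_density z * (4 * energy f)"])
    show "AE z in lborel. std_normal_density z * om (\<epsilon> j * z) \<le> std_normal_density z * (4 * energy f)" for j
      by (intro AE_I2 mult_left_mono om_le) auto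
    have "(\<integral>\<^sup>+z. std_normal_density z * (4 * energy f) \<partial>lborel)
        = (\<integral>\<^sup>+z. std_normal_density z \<partial>lborel) * (4 * energy f)"
      by (rule nn_integral_multc) measurable
    also have "(\<integral>\<^sup>+z. std_normal_density z \<partial>lborel) = 1"
      using nn_integral_normal_density[of 1] by simp
    finally show "(\<integral>\<^sup>+z. std_normal_density z * (4 * energy f) \<partial>lborel) < \<infinity>"
      using fin by (simp add: ennreal_mult_less_top)
    have "(\<lambda>k. std_normal_density z * om (\<epsilon> k * z)) \<longlonglongrightarrow> ennreal (std_normal_density z) * 0" for z
    proof (intro tendsto_mult_ennreal tendsto_const)
      have "(\<lambda>k. \<epsilon> k * z) \<longlonglongrightarrow> 0" using tendsto_mult_left_zero[OF lim] .
      then show "(\<lambda>k. om (\<epsilon> k * z)) \<longlonglongrightarrow> 0"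
        unfolding om_def by (rule energy_translate_tendsto[OF sq])
    qed auto
    then show "AE z in lborel. (\<lambda>k. std_normal_density z * om (\<epsilon> k * z)) \<longlonglongrightarrow> 0" by simp
  qed measurable
  then have "(\<lambda>k. \<integral>\<^sup>+z. std_normal_density z * om (\<epsilon> k * z) \<partial>lborel) \<longlonglongrightarrow> 0" by simp
  from tendsto_sandwich[OF _ _ tendsto_const this] show ?thesis by (simp add: le)
qed

text \<open>The sequence of widths is chosen such that the convergence holds almost everywhere; pointwise bounds for the mollified
functions then hold for \<open>f\<close> itself.\<close>
lemma mollify_AE_subseq:
  assumes f: "square_integrable f"
  shows "\<exists>\<epsilon> :: nat \<Rightarrow> real. (\<forall>k. 0 < \<epsilon> k) \<and>
    (AE x in lborel. (\<lambda>k. conv (normal_density 0 (\<epsilon> k)) f x) \<longlonglongrightarrow> f x)"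
proof -
  have [measurable]: "f \<in> borel_measurable borel" using f by (auto simp: square_integrable_iff_energy)
  have "(\<lambda>k. energy (\<lambda>x. conv (normal_density 0 (1 / real (Suc k))) f x - f x)) \<longlonglongrightarrow> 0"
    using LIMSEQ_inverse_real_of_nat
    by (intro energy_mollify_tendsto[OF f]) (auto simp: inverse_eq_divide)
  from energy_tendsto_AE_subseq[OF _ _ this] obtain r where
    "AE x in lborel. (\<lambda>k. conv (normal_density 0 (1 / real (Suc (r k)))) f x) \<longlonglongrightarrow> f x"
    by auto
  then show ?thesis by (intro exI[of _ "\<lambda>k. 1 / real (Suc (r k))"]) auto
qed

section \<open>The Fourier transform of integrable functions\<close>

lemma fourier_L1_measurable [measurable]:
  assumes [measurable]: "f \<in> borel_measurable borel"
  shows "fourier_L1 f \<in> borel_measurable borel"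
  unfolding fourier_L1_def[abs_def] by measurable

lemma norm_fourier_kernel [simp]: "norm (exp (- (\<i> * of_real \<xi> * of_real x))) = 1"
  using norm_exp_i_times[of "-(\<xi> * x)"] by simp

lemma norm_fourier_L1_le: "norm (fourier_L1 f \<xi>) \<le> (1 / sqrt (2 * pi)) * (LINT x|lborel. norm (f x))"
proof -
  have "norm (LINT x|lborel. f x * exp (- (\<i> * of_real \<xi> * of_real x)))
      \<le> (LINT x|lborel. norm (f x * exp (- (\<i> * of_real \<xi> * of_real x))))"
    by (rule integral_norm_bound)
  then show ?thesis
    unfolding fourier_L1_def by (simp add: norm_mult divide_right_mono)
qed

lemma integrable_fourier_kernel:
  assumes "integrable lborel f"
  shows "integrable lborel (\<lambda>x. f x * exp (- (\<i> * of_real \<xi> * of_real x)))"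
  using assms by (rule Bochner_Integration.integrable_bound) (use assms in \<open>auto simp: norm_mult\<close>)

lemma fourier_L1_continuous:
  assumes "integrable lborel f"
  shows "continuous_on UNIV (fourier_L1 f)"
proof -
  have [measurable]: "f \<in> borel_measurable borel" using assms by auto
  have "isCont (fourier_L1 f) \<xi>" for \<xi>
    unfolding continuous_at_sequentially
  proof (intro allI impI)
    fix X :: "nat \<Rightarrow> real" assume X: "X \<longlonglongrightarrow> \<xi>"
    have "(\<lambda>k. LINT x|lborel. f x * exp (- (\<i> * of_real (X k) * of_real x)))
        \<longlonglongrightarrow> (LINT x|lborel. f x * exp (- (\<i> * of_real \<xi> * of_real x)))"
    proof (rule integral_dominated_convergence[where w = "\<lambda>x. norm (f x)"])
      show "AE x in lborel. (\<lambda>k. f x * exp (- (\<i> * of_real (X k) * of_real x)))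
          \<longlonglongrightarrow> f x * exp (- (\<i> * of_real \<xi> * of_real x))"
        by (intro AE_I2 tendsto_intros X)
    qed (use assms in \<open>auto simp: norm_mult\<close>)
    then show "(fourier_L1 f \<circ> X) \<longlonglongrightarrow> fourier_L1 f \<xi>"
      unfolding comp_def fourier_L1_def by (intro tendsto_intros)
  qed
  then show ?thesis by (simp add: continuous_at_imp_continuous_on)
qed

lemma fourier_L1_add:
  assumes "integrable lborel f" "integrable lborel g"
  shows "fourier_L1 (\<lambda>x. f x + g x) \<xi> = fourier_L1 f \<xi> + fourier_L1 g \<xi>"
  using integrable_fourier_kernel[OF assms(1), of \<xi>] integrable_fourier_kernel[OF assms(2), of \<xi>]
  by (simp add: fourier_L1_def distrib_right scaleR_add_right)

lemma fourier_L1_cmult: "fourier_L1 (\<lambda>x. c * f x) \<xi> = c * fourier_L1 f \<xi>"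
  by (simp add: fourier_L1_def mult.assoc)

lemma fourier_L1_diff:
  assumes "integrable lborel f" "integrable lborel g"
  shows "fourier_L1 (\<lambda>x. f x - g x) \<xi> = fourier_L1 f \<xi> - fourier_L1 g \<xi>"
  using fourier_L1_add[OF assms(1), of "\<lambda>x. (-1) * g x" \<xi>] assms(2)
  by (simp only: fourier_L1_cmult) simp

text \<open>Fubini's theorem; both sides are the double integral of \<open>f x * g \<xi> * exp (- \<i> * \<xi> * x)\<close>.\<close>
lemma fourier_L1_multiplication_formula:
  assumes f: "integrable lborel f" and g: "integrable lborel g"
  shows "(LINT \<xi>|lborel. fourier_L1 f \<xi> * g \<xi>) = (LINT x|lborel. f x * fourier_L1 g x)"
proof -
  have [measurable]: "f \<in> borel_measurable borel" "g \<in> borel_measurable borel" using f g by auto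
  define E where "E x \<xi> = exp (- (\<i> * of_real \<xi> * of_real x))" for x \<xi> :: real
  have [measurable]: "(\<lambda>(x, \<xi>). E x \<xi>) \<in> borel_measurable (borel \<Otimes>\<^sub>M borel)"
    unfolding E_def by measurable
  have [simp]: "norm (E x \<xi>) = 1" for x \<xi> by (simp add: E_def)
  have int: "integrable (lborel \<Otimes>\<^sub>M lborel) (\<lambda>(x, \<xi>). f x * (g \<xi> * E x \<xi>))"
  proof (rule lborel_pair.Fubini_integrable)
    show "AE x in lborel. integrable lborel (\<lambda>\<xi>. case (x, \<xi>) of (x, \<xi>) \<Rightarrow> f x * (g \<xi> * E x \<xi>))"
    proof (rule AE_I2)
      fix x
      have "integrable lborel (\<lambda>\<xi>. g \<xi> * E x \<xi>)"
        using g by (rule Bochner_Integration.integrable_bound) (auto simp: norm_mult)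
      then show "integrable lborel (\<lambda>\<xi>. case (x, \<xi>) of (x, \<xi>) \<Rightarrow> f x * (g \<xi> * E x \<xi>))" by simp
    qed
    have "integrable lborel (\<lambda>x. norm (f x) * (LINT \<xi>|lborel. norm (g \<xi>)))"
      using f by (intro integrable_mult_left integrable_norm)
    then show "integrable lborel (\<lambda>x. LINT \<xi>|lborel. norm (case (x, \<xi>) of (x, \<xi>) \<Rightarrow> f x * (g \<xi> * E x \<xi>)))"
      by (simp add: norm_mult)
  qed measurable
  have "(LINT x|lborel. f x * (LINT \<xi>|lborel. g \<xi> * E x \<xi>))
      = (LINT x|lborel. LINT \<xi>|lborel. f x * (g \<xi> * E x \<xi>))"
    by simp
  also have "\<dots> = (LINT \<xi>|lborel. LINT x|lborel. f x * (g \<xi> * E x \<xi>))"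
    using lborel_pair.Fubini_integral[OF int] by simp
  also have "\<dots> = (LINT \<xi>|lborel. (LINT x|lborel. f x * E x \<xi>) * g \<xi>)"
    by (simp add: mult.left_commute mult.commute flip: integral_mult_right_zero)
  finally have swap: "(LINT x|lborel. f x * (LINT \<xi>|lborel. g \<xi> * E x \<xi>))
      = (LINT \<xi>|lborel. (LINT x|lborel. f x * E x \<xi>) * g \<xi>)" .
  have "\<i> * of_real x * of_real \<xi> = \<i> * of_real \<xi> * of_real x" for x \<xi> :: real
    by (simp add: ac_simps)
  then have g': "fourier_L1 g x = (1 / sqrt (2 * pi)) *\<^sub>R (LINT \<xi>|lborel. g \<xi> * E x \<xi>)" for x
    unfolding fourier_L1_def E_def by presburger
  have f': "fourier_L1 f \<xi> = (1 / sqrt (2 * pi)) *\<^sub>R (LINT x|lborel. f x * E x \<xi>)" for \<xi>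
    unfolding fourier_L1_def E_def ..
  show ?thesis
    unfolding f' g' by (simp add: swap)
qed

text \<open>A cut-off in frequency: the transform of the normal density of standard deviation \<open>\<epsilon>\<close>, up to a constant factor.\<close>
definition gauss :: "real \<Rightarrow> real \<Rightarrow> complex" where
  "gauss \<epsilon> \<xi> = of_real (exp (- (\<epsilon> * \<xi>)\<^sup>2 / 2))"

lemma gauss_measurable [measurable]: "gauss \<epsilon> \<in> borel_measurable borel"
  unfolding gauss_def[abs_def] by measurable

lemma norm_gauss_le: "norm (gauss \<epsilon> \<xi>) \<le> 1"
  by (simp add: gauss_def)

lemma gauss_eq_normal_density:
  assumes "0 < \<epsilon>"
  shows "exp (- (\<epsilon> * \<xi>)\<^sup>2 / 2) = sqrt (2 * pi) / \<epsilon> * normal_density 0 (1 / \<epsilon>) \<xi>"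
  using assms by (simp add: normal_density_def real_sqrt_divide real_sqrt_mult power_mult_distrib
      field_simps)

lemma integrable_gauss:
  assumes "0 < \<epsilon>"
  shows "integrable lborel (gauss \<epsilon>)"
proof -
  have "integrable lborel (\<lambda>\<xi>. sqrt (2 * pi) / \<epsilon> * normal_density 0 (1 / \<epsilon>) \<xi>)"
    using assms by (intro integrable_mult_right integrable_normal_density) auto
  then show ?thesis
    unfolding gauss_def[abs_def] gauss_eq_normal_density[OF assms]
    by (rule integrable_of_real)
qed

lemma square_integrable_gauss:
  assumes "0 < \<epsilon>"
  shows "square_integrable (gauss \<epsilon>)"
  using integrable_gauss[OF assms] norm_gauss_le
  by (intro square_integrable_bounded_integrable[where B = 1]) auto

text \<open>The characteristic function of the standard normal distribution, rescaled.\<close>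
lemma gauss_fourier:
  assumes "0 < \<epsilon>"
  shows "(LINT \<xi>|lborel. gauss \<epsilon> \<xi> * exp (\<i> * of_real (\<xi> * s)))
    = of_real (2 * pi * normal_density 0 \<epsilon> s)"
proof -
  have "(LINT z|lborel. std_normal_density z *\<^sub>R exp (\<i> * of_real (s / \<epsilon> * z)))
      = char std_normal_distribution (s / \<epsilon>)"
    unfolding char_def by (subst integral_density) (auto simp: ac_simps)
  also have "\<dots> = of_real (exp (- (s / \<epsilon>)\<^sup>2 / 2))"
    by (simp add: char_std_normal_distribution)
  finally have "of_real (exp (- (s / \<epsilon>)\<^sup>2 / 2))
      = (LINT z|lborel. std_normal_density z *\<^sub>R exp (\<i> * of_real (s / \<epsilon> * z)))" by simp
  also have "\<dots> = \<epsilon> *\<^sub>R (LINT \<xi>|lborel. std_normal_density (\<epsilon> * \<xi>) *\<^sub>R exp (\<i> * of_real (s / \<epsilon> * (\<epsilon> * \<xi>))))"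
    using lborel_integral_real_affine[of \<epsilon>
        "\<lambda>z. std_normal_density z *\<^sub>R exp (\<i> * of_real (s / \<epsilon> * z))" 0] assms by simp
  also have "\<dots> = \<epsilon> *\<^sub>R (LINT \<xi>|lborel. (1 / sqrt (2 * pi)) *\<^sub>R (gauss \<epsilon> \<xi> * exp (\<i> * of_real (\<xi> * s))))"
    using assms
    by (intro arg_cong[where f = "\<lambda>z. \<epsilon> *\<^sub>R z"] Bochner_Integration.integral_cong)
       (auto simp: std_normal_density_def gauss_def scaleR_conv_of_real mult.commute)
  also have "\<dots> = (\<epsilon> / sqrt (2 * pi)) *\<^sub>R (LINT \<xi>|lborel. gauss \<epsilon> \<xi> * exp (\<i> * of_real (\<xi> * s)))"
    by simp
  finally have "(sqrt (2 * pi) / \<epsilon>) *\<^sub>R complex_of_real (exp (- (s / \<epsilon>)\<^sup>2 / 2))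
      = (sqrt (2 * pi) / \<epsilon>) *\<^sub>R (\<epsilon> / sqrt (2 * pi)) *\<^sub>R (LINT \<xi>|lborel. gauss \<epsilon> \<xi> * exp (\<i> * of_real (\<xi> * s)))"
    by simp
  also have "\<dots> = (LINT \<xi>|lborel. gauss \<epsilon> \<xi> * exp (\<i> * of_real (\<xi> * s)))"
    using assms by simp
  also have "(sqrt (2 * pi) / \<epsilon>) *\<^sub>R complex_of_real (exp (- (s / \<epsilon>)\<^sup>2 / 2))
      = complex_of_real (sqrt (2 * pi) / \<epsilon> * exp (- (s / \<epsilon>)\<^sup>2 / 2))"
    by (simp add: scaleR_conv_of_real)
  also have "sqrt (2 * pi) / \<epsilon> * exp (- (s / \<epsilon>)\<^sup>2 / 2) = 2 * pi * normal_density 0 \<epsilon> s"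
  proof -
    define r where "r = sqrt (2 * pi)"
    have r: "0 < r" "2 * pi = r * r" unfolding r_def by auto
    have "normal_density 0 \<epsilon> s = exp (- (s / \<epsilon>)\<^sup>2 / 2) / (r * \<epsilon>)"
      using assms by (simp add: normal_density_def real_sqrt_mult r_def power_divide mult.commute)
    then show ?thesis
      unfolding r_def[symmetric] r(2) using r(1) assms by (simp add: field_simps)
  qed
  finally show ?thesis by simp
qed

lemma gauss_tendsto:
  assumes "\<epsilon> \<longlonglongrightarrow> 0"
  shows "(\<lambda>k. gauss (\<epsilon> k) \<xi>) \<longlonglongrightarrow> 1"
proof -
  have "(\<lambda>k. complex_of_real (exp (- (\<epsilon> k * \<xi>)\<^sup>2 / 2))) \<longlonglongrightarrow> complex_of_real (exp (- (0 * \<xi>)\<^sup>2 / 2))"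
    by (intro tendsto_intros assms) auto
  then show ?thesis by (simp add: gauss_def)
qed

lemma conv_normal_density_eq:
  "conv (normal_density 0 \<epsilon>) f y = (LINT x|lborel. f x * of_real (normal_density 0 \<epsilon> (x - y)))"
proof -
  have "conv (normal_density 0 \<epsilon>) f y
      = (LINT x|lborel. normal_density 0 \<epsilon> (y - x) *\<^sub>R f x)"
    unfolding conv_def
    using lborel_integral_real_affine[of "-1" "\<lambda>x. normal_density 0 \<epsilon> (y - x) *\<^sub>R f x" y] by simp
  also have "\<dots> = (LINT x|lborel. f x * of_real (normal_density 0 \<epsilon> (x - y)))"
    by (intro Bochner_Integration.integral_cong)
       (auto simp: normal_density_def scaleR_conv_of_real power2_commute mult.commute)
  finally show ?thesis .
qed

text \<open>Modulated Gaussians are the test functions for which the multiplication formula turns into an inversion formula: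
their transforms are translated normal densities.\<close>
lemma fourier_L1_gauss_shift:
  assumes "0 < \<epsilon>"
  shows "fourier_L1 (\<lambda>\<xi>. (1 / sqrt (2 * pi)) *\<^sub>R (gauss \<epsilon> \<xi> * exp (\<i> * of_real (\<xi> * y)))) x
    = of_real (normal_density 0 \<epsilon> (x - y))"
proof -
  have "(LINT \<xi>|lborel. (1 / sqrt (2 * pi)) *\<^sub>R (gauss \<epsilon> \<xi> * exp (\<i> * of_real (\<xi> * y)))
        * exp (- (\<i> * of_real x * of_real \<xi>)))
      = (LINT \<xi>|lborel. (1 / sqrt (2 * pi)) *\<^sub>R (gauss \<epsilon> \<xi> * exp (\<i> * of_real (\<xi> * (y - x)))))"
    by (intro Bochner_Integration.integral_cong)
       (auto simp: mult.assoc exp_add[symmetric] algebra_simps)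
  also have "\<dots> = (1 / sqrt (2 * pi)) *\<^sub>R of_real (2 * pi * normal_density 0 \<epsilon> (y - x))"
    using gauss_fourier[OF assms, of "y - x"] by simp
  finally have "fourier_L1 (\<lambda>\<xi>. (1 / sqrt (2 * pi)) *\<^sub>R (gauss \<epsilon> \<xi> * exp (\<i> * of_real (\<xi> * y)))) x
    = (1 / sqrt (2 * pi)) *\<^sub>R (1 / sqrt (2 * pi)) *\<^sub>R of_real (2 * pi * normal_density 0 \<epsilon> (y - x))"
    unfolding fourier_L1_def by simp
  also have "\<dots> = complex_of_real ((1 / sqrt (2 * pi)) * (1 / sqrt (2 * pi)) * (2 * pi) * normal_density 0 \<epsilon> (y - x))"
    by (simp only: scaleR_conv_of_real of_real_mult mult.assoc)
  also have "(1 / sqrt (2 * pi)) * (1 / sqrt (2 * pi)) * (2 * pi) = 1"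
    by (simp add: field_simps flip: power2_eq_square)
  also have "normal_density 0 \<epsilon> (y - x) = normal_density 0 \<epsilon> (x - y)"
    by (simp add: normal_density_def power2_commute)
  finally show ?thesis by simp
qed

lemma integrable_gauss_shift:
  assumes "0 < \<epsilon>"
  shows "integrable lborel (\<lambda>\<xi>. (1 / sqrt (2 * pi)) *\<^sub>R (gauss \<epsilon> \<xi> * exp (\<i> * of_real (\<xi> * y))))"
proof (intro integrable_scaleR_right impI)
  show "integrable lborel (\<lambda>\<xi>. gauss \<epsilon> \<xi> * exp (\<i> * of_real (\<xi> * y)))"
    using integrable_gauss[OF assms]
    by (rule Bochner_Integration.integrable_bound) (auto simp: norm_mult)
qed

lemma fourier_L1_gauss_mult:
  "fourier_L1 (\<lambda>\<xi>. g \<xi> * gauss \<epsilon> \<xi>) (- y)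
    = (LINT \<xi>|lborel. g \<xi> * ((1 / sqrt (2 * pi)) *\<^sub>R (gauss \<epsilon> \<xi> * exp (\<i> * of_real (\<xi> * y)))))"
  by (simp add: fourier_L1_def mult.assoc ac_simps)

text \<open>The inversion formula, regularised by a Gaussian cut-off in frequency, which amounts to a Gaussian average in space.
All statements about recovering a function from its transform rest on this identity.\<close>
lemma fourier_L1_inversion_gauss:
  assumes f: "integrable lborel f" and pos: "0 < \<epsilon>"
  shows "fourier_L1 (\<lambda>\<xi>. fourier_L1 f \<xi> * gauss \<epsilon> \<xi>) (- y) = conv (normal_density 0 \<epsilon>) f y"
  unfolding fourier_L1_gauss_mult
    fourier_L1_multiplication_formula[OF f integrable_gauss_shift[OF pos]]
    fourier_L1_gauss_shift[OF pos] conv_normal_density_eq ..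

text \<open>One half of Plancherel's theorem. With a Gaussian cut-off the energy of the transform becomes, by the multiplication
and inversion formulas, the inner product of \<open>f\<close> with a Gaussian average of \<open>f\<close>, which Cauchy--Schwarz and Young bound
by the energy of \<open>f\<close>. Fatou's lemma removes the cut-off.\<close>
lemma energy_fourier_L1_le:
  assumes f: "integrable lborel f" and sq: "square_integrable f"
  shows "energy (fourier_L1 f) \<le> energy f"
proof -
  have [measurable]: "f \<in> borel_measurable borel" and fin: "energy f < \<infinity>"
    using sq by (auto simp: square_integrable_iff_energy)
  define B where "B = (1 / sqrt (2 * pi)) * (LINT x|lborel. norm (f x))"
  have B: "norm (fourier_L1 f \<xi>) \<le> B" for \<xi>
    unfolding B_def by (rule norm_fourier_L1_le)
  have B0: "0 \<le> B" using order_trans[OF norm_ge_zero B] .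
  (* Dividing by sqrt 2 makes the square of the cut-off equal to gauss \<epsilon>. *)
  define h where "h \<epsilon> \<xi> = gauss (\<epsilon> / sqrt 2) \<xi> * fourier_L1 f \<xi>" for \<epsilon> \<xi>
  have [measurable]: "h \<epsilon> \<in> borel_measurable borel" for \<epsilon> unfolding h_def by measurable
  have le: "energy (h \<epsilon>) \<le> energy f" if pos: "0 < \<epsilon>" for \<epsilon>
  proof -
    (* The transform of f' is the conjugate of that of f, so the energy of h is an integral
       of the form (transform of f') times an integrable function. *)
    define f' where "f' x = cnj (f (- x))" for x
    have f': "integrable lborel f'"
      unfolding f'_def using lborel_integrable_real_affine[OF f, of "-1" 0] by simp
    have cnj_f: "fourier_L1 f' \<xi> = cnj (fourier_L1 f \<xi>)" for \<xi>
    proof -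
      have "(LINT x|lborel. f' x * exp (- (\<i> * of_real \<xi> * of_real x)))
          = (LINT x|lborel. f' (- x) * exp (\<i> * of_real \<xi> * of_real x))"
        using lborel_integral_real_affine[of "-1" "\<lambda>x. f' x * exp (- (\<i> * of_real \<xi> * of_real x))" 0] by simp
      also have "\<dots> = cnj (LINT x|lborel. f x * exp (- (\<i> * of_real \<xi> * of_real x)))"
        by (subst Bochner_Integration.integral_cnj[symmetric]) (simp add: f'_def exp_cnj del: Bochner_Integration.integral_cnj)
      finally show ?thesis by (simp add: fourier_L1_def)
    qed
    have int: "integrable lborel (\<lambda>\<xi>. fourier_L1 f \<xi> * gauss \<epsilon> \<xi>)"
    proof (rule Bochner_Integration.integrable_bound)
      show "integrable lborel (\<lambda>\<xi>. B * norm (gauss \<epsilon> \<xi>))"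
        using integrable_gauss[OF pos] by (intro integrable_mult_right integrable_norm)
      show "AE \<xi> in lborel. norm (fourier_L1 f \<xi> * gauss \<epsilon> \<xi>) \<le> norm (B * norm (gauss \<epsilon> \<xi>))"
        using B B0 by (auto simp: norm_mult intro!: mult_right_mono)
    qed measurable
    have gauss2: "gauss (\<epsilon> / sqrt 2) \<xi> ^ 2 = gauss \<epsilon> \<xi>" for \<xi>
      by (simp add: gauss_def power_mult_distrib power_divide flip: of_real_power exp_double)
    have pt: "complex_of_real ((norm (h \<epsilon> \<xi>))\<^sup>2) = fourier_L1 f' \<xi> * (fourier_L1 f \<xi> * gauss \<epsilon> \<xi>)" for \<xi>
    proof -
      have "cnj (gauss (\<epsilon> / sqrt 2) \<xi>) = gauss (\<epsilon> / sqrt 2) \<xi>" by (simp add: gauss_def)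
      then show ?thesis
        unfolding complex_norm_square h_def cnj_f
        by (simp add: gauss2[symmetric] power2_eq_square ac_simps)
    qed
    have int_h: "integrable lborel (\<lambda>\<xi>. (norm (h \<epsilon> \<xi>))\<^sup>2)"
    proof (rule Bochner_Integration.integrable_bound)
      show "integrable lborel (\<lambda>\<xi>. B * norm (fourier_L1 f \<xi> * gauss \<epsilon> \<xi>))"
        using int by (intro integrable_mult_right integrable_norm)
      show "AE \<xi> in lborel. norm ((norm (h \<epsilon> \<xi>))\<^sup>2) \<le> norm (B * norm (fourier_L1 f \<xi> * gauss \<epsilon> \<xi>))"
      proof (rule AE_I2)
        fix \<xi>
        have "norm (complex_of_real ((norm (h \<epsilon> \<xi>))\<^sup>2)) \<le> B * norm (fourier_L1 f \<xi> * gauss \<epsilon> \<xi>)"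
          unfolding pt norm_mult cnj_f complex_mod_cnj
          by (intro mult_right_mono B) auto
        then show "norm ((norm (h \<epsilon> \<xi>))\<^sup>2) \<le> norm (B * norm (fourier_L1 f \<xi> * gauss \<epsilon> \<xi>))"
          using B0 by (simp add: norm_power)
      qed
    qed measurable
    define w where "w = (LINT \<xi>|lborel. (norm (h \<epsilon> \<xi>))\<^sup>2)"
    have "complex_of_real w = (LINT \<xi>|lborel. complex_of_real ((norm (h \<epsilon> \<xi>))\<^sup>2))"
      unfolding w_def by (simp del: of_real_power)
    also have "\<dots> = (LINT \<xi>|lborel. fourier_L1 f' \<xi> * (fourier_L1 f \<xi> * gauss \<epsilon> \<xi>))"
      by (simp only: pt)
    also have "\<dots> = (LINT x|lborel. f' x * fourier_L1 (\<lambda>\<xi>. fourier_L1 f \<xi> * gauss \<epsilon> \<xi>) x)"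
      by (rule fourier_L1_multiplication_formula[OF f' int])
    also have "\<dots> = (LINT x|lborel. cnj (f x) * conv (normal_density 0 \<epsilon>) f x)"
      using lborel_integral_real_affine[of "-1" "\<lambda>x. f' x * fourier_L1 (\<lambda>\<xi>. fourier_L1 f \<xi> * gauss \<epsilon> \<xi>) x" 0]
      by (simp add: fourier_L1_inversion_gauss[OF f pos] f'_def)
    finally have w: "complex_of_real w = (LINT x|lborel. cnj (f x) * conv (normal_density 0 \<epsilon>) f x)" .
    have w0: "0 \<le> w" unfolding w_def by simp
    have "(ennreal w)\<^sup>2 = (ennreal (norm (complex_of_real w)))\<^sup>2" using w0 by simp
    also have "\<dots> \<le> energy (\<lambda>x. cnj (f x)) * energy (conv (normal_density 0 \<epsilon>) f)"
      unfolding w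
    proof (rule norm_integral_mult_le)
      have "cnj \<in> borel_measurable borel"
        by (intro borel_measurable_continuous_onI continuous_intros)
      then show "(\<lambda>x. cnj (f x)) \<in> borel_measurable borel" by measurable
    qed measurable
    also have "energy (\<lambda>x. cnj (f x)) = energy f" by (simp add: energy_def)
    also have "energy f * energy (conv (normal_density 0 \<epsilon>) f) \<le> energy f * (1\<^sup>2 * energy f)"
      using energy_conv_le[of "normal_density 0 \<epsilon>" f]
      unfolding nn_integral_normal_density[OF pos] by (intro mult_left_mono) auto
    finally have "(ennreal w)\<^sup>2 \<le> (energy f)\<^sup>2" by (simp add: power2_eq_square)
    moreover obtain c where c: "energy f = ennreal c" "0 \<le> c"
      using fin by (cases "energy f") auto
    ultimately have "w\<^sup>2 \<le> c\<^sup>2"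
      using w0 by (simp add: ennreal_power)
    then have "ennreal w \<le> energy f"
      using c power2_le_imp_le[of w c] by (auto intro: ennreal_leI)
    also have "ennreal w = energy (h \<epsilon>)"
      unfolding w_def energy_def using int_h by (simp add: nn_integral_eq_integral)
    finally show ?thesis .
  qed
  show ?thesis
  proof (rule energy_Fatou[where f = "\<lambda>k. h (1 / real (Suc k))"])
    have "(\<lambda>k. 1 / real (Suc k) / sqrt 2) \<longlonglongrightarrow> 0"
      using tendsto_divide[OF LIMSEQ_inverse_real_of_nat tendsto_const, of "sqrt 2"]
      by (simp add: inverse_eq_divide)
    then have "(\<lambda>k. h (1 / real (Suc k)) \<xi>) \<longlonglongrightarrow> 1 * fourier_L1 f \<xi>" for \<xi>
      unfolding h_def by (intro tendsto_mult tendsto_const gauss_tendsto)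
    then show "AE \<xi> in lborel. (\<lambda>k. h (1 / real (Suc k)) \<xi>) \<longlonglongrightarrow> fourier_L1 f \<xi>"
      by simp
    show "energy (h (1 / real (Suc k))) \<le> energy f" for k by (rule le) simp
  qed measurable
qed

lemma energy_fourier_L1_diff_le:
  assumes "integrable lborel f" "square_integrable f" "integrable lborel g" "square_integrable g"
  shows "energy (\<lambda>\<xi>. fourier_L1 f \<xi> - fourier_L1 g \<xi>) \<le> energy (\<lambda>x. f x - g x)"
proof -
  have "fourier_L1 (\<lambda>x. f x - g x) = (\<lambda>\<xi>. fourier_L1 f \<xi> - fourier_L1 g \<xi>)"
    using assms by (simp add: fourier_L1_diff fun_eq_iff)
  then show ?thesis
    using energy_fourier_L1_le[of "\<lambda>x. f x - g x"] assms by (simp add: square_integrable_diff)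
qed

section \<open>The Fourier transform of square-integrable functions\<close>

definition trunc :: "real \<Rightarrow> (real \<Rightarrow> complex) \<Rightarrow> real \<Rightarrow> complex" where
  "trunc R f x = indicator {-R..R} x *\<^sub>R f x"

lemma square_integrable_trunc:
  assumes "square_integrable f"
  shows "square_integrable (trunc R f)" and "energy (trunc R f) \<le> energy f"
proof -
  have [measurable]: "f \<in> borel_measurable borel" and fin: "energy f < \<infinity>"
    using assms by (auto simp: square_integrable_iff_energy)
  have [measurable]: "trunc R f \<in> borel_measurable borel" unfolding trunc_def[abs_def] by measurable
  show le: "energy (trunc R f) \<le> energy f"
    by (intro energy_mono_AE) (auto simp: trunc_def indicator_def)
  with fin show "square_integrable (trunc R f)"
    by (auto simp: square_integrable_iff_energy intro: le_less_trans)
qed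

lemma integrable_trunc:
  assumes "square_integrable f"
  shows "integrable lborel (trunc R f)"
proof -
  have "square_integrable (\<lambda>x. complex_of_real (indicator {-R..R} x))"
  proof (rule square_integrable_bounded_integrable[where B = 1])
    show "integrable lborel (\<lambda>x. complex_of_real (indicator {-R..R} x))"
      by (rule integrable_of_real) (simp add: integrable_indicator_iff emeasure_lborel_Icc_eq)
  qed (auto simp: indicator_def)
  from integrable_mult_square_integrable[OF this assms]
  show ?thesis by (simp add: trunc_def[abs_def] scaleR_conv_of_real)
qed

lemma energy_trunc_tendsto:
  assumes sq: "square_integrable f" and R: "filterlim R at_top sequentially"
  shows "(\<lambda>k. energy (\<lambda>x. trunc (R k) f x - f x)) \<longlonglongrightarrow> 0"
proof (rule energy_dominated_convergence[where w = "\<lambda>x. ennreal ((norm (f x))\<^sup>2)"])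
  have [measurable]: "f \<in> borel_measurable borel" and fin: "energy f < \<infinity>"
    using sq by (auto simp: square_integrable_iff_energy)
  show "(\<lambda>x. trunc (R k) f x - f x) \<in> borel_measurable borel" for k
    unfolding trunc_def by measurable
  show "(\<integral>\<^sup>+x. ennreal ((norm (f x))\<^sup>2) \<partial>lborel) < \<infinity>" using fin by (simp add: energy_def)
  have "eventually (\<lambda>k. trunc (R k) f x - f x = 0) sequentially" for x
  proof -
    have "eventually (\<lambda>k. \<bar>x\<bar> \<le> R k) sequentially"
      using R by (simp add: filterlim_at_top)
    then show ?thesis by eventually_elim (auto simp: trunc_def indicator_def)
  qed
  then show "AE x in lborel. (\<lambda>k. trunc (R k) f x - f x) \<longlonglongrightarrow> 0"
    by (intro AE_I2 tendsto_eventually) simp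
  show "AE x in lborel. ennreal ((norm (trunc (R k) f x - f x))\<^sup>2) \<le> ennreal ((norm (f x))\<^sup>2)" for k
    by (auto simp: trunc_def indicator_def)
  show "(\<lambda>x. ennreal ((norm (f x))\<^sup>2)) \<in> borel_measurable borel" by measurable
qed

text \<open>The transform may be computed along any approximating sequence in the intersection of L1 and L2, not only along
truncations: the transforms of two such sequences have the same limit because the transform is a contraction.\<close>
lemma has_fourier_L2I:
  fixes h :: "nat \<Rightarrow> real \<Rightarrow> complex"
  assumes f: "square_integrable f" and g: "square_integrable g"
    and h: "\<And>k. integrable lborel (h k)" "\<And>k. square_integrable (h k)"
    and hf: "(\<lambda>k. energy (\<lambda>x. h k x - f x)) \<longlonglongrightarrow> 0"
    and hg: "(\<lambda>k. energy (\<lambda>\<xi>. fourier_L1 (h k) \<xi> - g \<xi>)) \<longlonglongrightarrow> 0"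
  shows "has_fourier_L2 f g"
proof -
  have [measurable]: "f \<in> borel_measurable borel" "g \<in> borel_measurable borel"
    "\<And>k. h k \<in> borel_measurable borel" "\<And>R. trunc R f \<in> borel_measurable borel"
    using f g h square_integrable_trunc(1)[OF f] by (auto simp: square_integrable_iff_energy)
  have "((\<lambda>R. energy (\<lambda>\<xi>. fourier_L1 (trunc R f) \<xi> - g \<xi>)) \<longlongrightarrow> 0) at_top"
  proof (rule tendsto_at_topI_sequentially)
    fix R :: "nat \<Rightarrow> real" assume R: "filterlim R at_top sequentially"
    have le: "energy (\<lambda>\<xi>. fourier_L1 (trunc (R k) f) \<xi> - g \<xi>)
      \<le> 2 * (2 * energy (\<lambda>x. trunc (R k) f x - f x) + 2 * energy (\<lambda>x. h k x - f x))
        + 2 * energy (\<lambda>\<xi>. fourier_L1 (h k) \<xi> - g \<xi>)" for k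
    proof -
      have "energy (\<lambda>\<xi>. fourier_L1 (trunc (R k) f) \<xi> - fourier_L1 (h k) \<xi>)
          \<le> energy (\<lambda>x. trunc (R k) f x - h k x)"
        by (intro energy_fourier_L1_diff_le integrable_trunc square_integrable_trunc f h)
      also have "\<dots> \<le> 2 * energy (\<lambda>x. trunc (R k) f x - f x) + 2 * energy (\<lambda>x. f x - h k x)"
        by (rule energy_diff_triangle) measurable
      also have "energy (\<lambda>x. f x - h k x) = energy (\<lambda>x. h k x - f x)" by (rule energy_diff_commute)
      finally have 1: "energy (\<lambda>\<xi>. fourier_L1 (trunc (R k) f) \<xi> - fourier_L1 (h k) \<xi>)
          \<le> 2 * energy (\<lambda>x. trunc (R k) f x - f x) + 2 * energy (\<lambda>x. h k x - f x)" .
      have "energy (\<lambda>\<xi>. fourier_L1 (trunc (R k) f) \<xi> - g \<xi>)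
        \<le> 2 * energy (\<lambda>\<xi>. fourier_L1 (trunc (R k) f) \<xi> - fourier_L1 (h k) \<xi>)
          + 2 * energy (\<lambda>\<xi>. fourier_L1 (h k) \<xi> - g \<xi>)"
        by (rule energy_diff_triangle) measurable
      also have "\<dots> \<le> 2 * (2 * energy (\<lambda>x. trunc (R k) f x - f x) + 2 * energy (\<lambda>x. h k x - f x))
          + 2 * energy (\<lambda>\<xi>. fourier_L1 (h k) \<xi> - g \<xi>)"
        by (intro add_right_mono mult_left_mono 1) auto
      finally show ?thesis .
    qed
    have "(\<lambda>k. 2 * (2 * energy (\<lambda>x. trunc (R k) f x - f x) + 2 * energy (\<lambda>x. h k x - f x))
        + 2 * energy (\<lambda>\<xi>. fourier_L1 (h k) \<xi> - g \<xi>)) \<longlonglongrightarrow> 2 * (2 * 0 + 2 * 0) + 2 * 0"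
      by (intro tendsto_add tendsto_mult_ennreal tendsto_const energy_trunc_tendsto[OF f R] hf hg) auto
    then have "(\<lambda>k. 2 * (2 * energy (\<lambda>x. trunc (R k) f x - f x) + 2 * energy (\<lambda>x. h k x - f x))
        + 2 * energy (\<lambda>\<xi>. fourier_L1 (h k) \<xi> - g \<xi>)) \<longlonglongrightarrow> 0" by simp
    from tendsto_sandwich[OF _ _ tendsto_const this]
    show "(\<lambda>k. energy (\<lambda>\<xi>. fourier_L1 (trunc (R k) f) \<xi> - g \<xi>)) \<longlonglongrightarrow> 0"
      using le by simp
  qed
  then show ?thesis
    using f g by (simp add: has_fourier_L2_def energy_def trunc_def[abs_def])
qed

lemma has_fourier_L2D:
  assumes "has_fourier_L2 f g"
  shows "square_integrable f" "square_integrable g"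
    "(\<lambda>k. energy (\<lambda>\<xi>. fourier_L1 (trunc (real k) f) \<xi> - g \<xi>)) \<longlonglongrightarrow> 0"
proof -
  show "square_integrable f" "square_integrable g" using assms by (auto simp: has_fourier_L2_def)
  have "((\<lambda>R. energy (\<lambda>\<xi>. fourier_L1 (trunc R f) \<xi> - g \<xi>)) \<longlongrightarrow> 0) at_top"
    using assms by (simp add: has_fourier_L2_def energy_def trunc_def[abs_def])
  from filterlim_compose[OF this filterlim_real_sequentially]
  show "(\<lambda>k. energy (\<lambda>\<xi>. fourier_L1 (trunc (real k) f) \<xi> - g \<xi>)) \<longlonglongrightarrow> 0" .
qed

text \<open>The transforms of the truncations form a Cauchy sequence, since the transform is a contraction on the intersection
of L1 and L2.\<close>
lemma has_fourier_L2_exists: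
  assumes f: "square_integrable f"
  shows "\<exists>g. has_fourier_L2 f g"
proof -
  define h where "h k = trunc (real k) f" for k :: nat
  have h: "integrable lborel (h k)" "square_integrable (h k)" for k
    unfolding h_def using integrable_trunc square_integrable_trunc f by auto
  have hf: "(\<lambda>k. energy (\<lambda>x. h k x - f x)) \<longlonglongrightarrow> 0"
    unfolding h_def by (rule energy_trunc_tendsto[OF f filterlim_real_sequentially])
  have [measurable]: "f \<in> borel_measurable borel" "\<And>k. h k \<in> borel_measurable borel"
    using f h by (auto simp: square_integrable_iff_energy)
  have "\<exists>g. square_integrable g \<and> (\<lambda>k. energy (\<lambda>\<xi>. fourier_L1 (h k) \<xi> - g \<xi>)) \<longlonglongrightarrow> 0"
  proof (rule energy_complete)
    show "energy (fourier_L1 (h k)) < \<infinity>" for k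
      using energy_fourier_L1_le[OF h] h(2)[of k] by (auto simp: square_integrable_iff_energy intro: le_less_trans)
    fix e :: real assume e: "0 < e"
    have "eventually (\<lambda>k. energy (\<lambda>x. h k x - f x) < ennreal (e/4)) sequentially"
      using e by (intro order_tendstoD(2)[OF hf]) auto
    then obtain N where N: "\<And>k. k \<ge> N \<Longrightarrow> energy (\<lambda>x. h k x - f x) < ennreal (e/4)"
      by (auto simp: eventually_sequentially)
    have "energy (\<lambda>\<xi>. fourier_L1 (h i) \<xi> - fourier_L1 (h j) \<xi>) \<le> ennreal e" if ij: "i \<ge> N" "j \<ge> N" for i j
    proof -
      have "energy (\<lambda>\<xi>. fourier_L1 (h i) \<xi> - fourier_L1 (h j) \<xi>) \<le> energy (\<lambda>x. h i x - h j x)"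
        by (intro energy_fourier_L1_diff_le h)
      also have "\<dots> \<le> 2 * energy (\<lambda>x. h i x - f x) + 2 * energy (\<lambda>x. f x - h j x)"
        by (rule energy_diff_triangle) measurable
      also have "\<dots> \<le> 2 * ennreal (e/4) + 2 * ennreal (e/4)"
        using N[OF ij(1)] N[OF ij(2)] unfolding energy_diff_commute[of f]
        by (intro add_mono mult_left_mono) auto
      also have "\<dots> = ennreal e" using e by (simp add: two_times_ennreal flip: ennreal_plus)
      finally show ?thesis .
    qed
    then show "\<exists>N. \<forall>i\<ge>N. \<forall>j\<ge>N. energy (\<lambda>\<xi>. fourier_L1 (h i) \<xi> - fourier_L1 (h j) \<xi>) \<le> ennreal e" by blast
  qed measurable
  then show ?thesis using has_fourier_L2I[OF f _ h hf] by blast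
qed

lemma has_fourier_L2_fourier_L2:
  "square_integrable f \<Longrightarrow> has_fourier_L2 f (fourier_L2 f)"
  unfolding fourier_L2_def by (rule someI_ex[OF has_fourier_L2_exists])

lemma has_fourier_L2_add:
  assumes 1: "has_fourier_L2 f1 g1" and 2: "has_fourier_L2 f2 g2"
  shows "has_fourier_L2 (\<lambda>x. f1 x + f2 x) (\<lambda>\<xi>. g1 \<xi> + g2 \<xi>)"
proof (rule has_fourier_L2I[where h = "\<lambda>k x. trunc (real k) f1 x + trunc (real k) f2 x"])
  note sq = has_fourier_L2D(1,2)[OF 1] has_fourier_L2D(1,2)[OF 2]
  note int = integrable_trunc[OF sq(1)] integrable_trunc[OF sq(3)]
  note sqt = square_integrable_trunc(1)[OF sq(1)] square_integrable_trunc(1)[OF sq(3)]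
  have [measurable]: "f1 \<in> borel_measurable borel" "f2 \<in> borel_measurable borel"
    "g1 \<in> borel_measurable borel" "g2 \<in> borel_measurable borel"
    "\<And>R. trunc R f1 \<in> borel_measurable borel" "\<And>R. trunc R f2 \<in> borel_measurable borel"
    using sq sqt by (auto simp: square_integrable_iff_energy)
  show "square_integrable (\<lambda>x. f1 x + f2 x)" "square_integrable (\<lambda>\<xi>. g1 \<xi> + g2 \<xi>)"
    by (intro square_integrable_add sq)+
  show "integrable lborel (\<lambda>x. trunc (real k) f1 x + trunc (real k) f2 x)"
    "square_integrable (\<lambda>x. trunc (real k) f1 x + trunc (real k) f2 x)" for k
    using int sqt by (auto intro: square_integrable_add)
  have sum0: "(\<lambda>k. energy (\<lambda>x. a k x + b k x)) \<longlonglongrightarrow> 0"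
    if [measurable]: "\<And>k. a k \<in> borel_measurable borel" "\<And>k. b k \<in> borel_measurable borel"
    and lim: "(\<lambda>k. energy (a k)) \<longlonglongrightarrow> 0" "(\<lambda>k. energy (b k)) \<longlonglongrightarrow> 0" for a b :: "nat \<Rightarrow> real \<Rightarrow> complex"
  proof -
    have "(\<lambda>k. 2 * energy (a k) + 2 * energy (b k)) \<longlonglongrightarrow> 2 * 0 + 2 * 0"
      by (intro tendsto_add tendsto_mult_ennreal tendsto_const lim) auto
    then have "(\<lambda>k. 2 * energy (a k) + 2 * energy (b k)) \<longlonglongrightarrow> 0" by simp
    from tendsto_sandwich[OF _ _ tendsto_const this] show ?thesis by (simp add: energy_add_le)
  qed
  show "(\<lambda>k. energy (\<lambda>x. trunc (real k) f1 x + trunc (real k) f2 x - (f1 x + f2 x))) \<longlonglongrightarrow> 0"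
    using sum0[OF _ _ energy_trunc_tendsto[OF sq(1) filterlim_real_sequentially]
      energy_trunc_tendsto[OF sq(3) filterlim_real_sequentially]] by (simp add: add_diff_add)
  show "(\<lambda>k. energy (\<lambda>\<xi>. fourier_L1 (\<lambda>x. trunc (real k) f1 x + trunc (real k) f2 x) \<xi> - (g1 \<xi> + g2 \<xi>))) \<longlonglongrightarrow> 0"
    using sum0[OF _ _ has_fourier_L2D(3)[OF 1] has_fourier_L2D(3)[OF 2]]
    by (simp add: add_diff_add fourier_L1_add int)
qed

lemma has_fourier_L2_cmult:
  assumes 1: "has_fourier_L2 f g"
  shows "has_fourier_L2 (\<lambda>x. c * f x) (\<lambda>\<xi>. c * g \<xi>)"
proof (rule has_fourier_L2I[where h = "\<lambda>k x. c * trunc (real k) f x"])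
  note sq = has_fourier_L2D(1,2)[OF 1]
  have [measurable]: "f \<in> borel_measurable borel" "g \<in> borel_measurable borel"
    "\<And>R. trunc R f \<in> borel_measurable borel"
    using sq square_integrable_trunc(1)[OF sq(1)] by (auto simp: square_integrable_iff_energy)
  show "square_integrable (\<lambda>x. c * f x)" "square_integrable (\<lambda>\<xi>. c * g \<xi>)"
    "square_integrable (\<lambda>x. c * trunc (real k) f x)" for k
    by (intro square_integrable_cmult square_integrable_trunc sq)+
  show "integrable lborel (\<lambda>x. c * trunc (real k) f x)" for k
    using integrable_trunc[OF sq(1)] by auto
  have cm0: "(\<lambda>k. energy (\<lambda>x. c * a k x)) \<longlonglongrightarrow> 0"
    if [measurable]: "\<And>k. a k \<in> borel_measurable borel" and lim: "(\<lambda>k. energy (a k)) \<longlonglongrightarrow> 0"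
    for a :: "nat \<Rightarrow> real \<Rightarrow> complex"
  proof -
    have "(\<lambda>k. ennreal ((norm c)\<^sup>2) * energy (a k)) \<longlonglongrightarrow> ennreal ((norm c)\<^sup>2) * 0"
      by (intro tendsto_mult_ennreal tendsto_const lim) auto
    then show ?thesis by (simp add: energy_cmult)
  qed
  show "(\<lambda>k. energy (\<lambda>x. c * trunc (real k) f x - c * f x)) \<longlonglongrightarrow> 0"
    using cm0[OF _ energy_trunc_tendsto[OF sq(1) filterlim_real_sequentially]]
    by (simp add: right_diff_distrib)
  show "(\<lambda>k. energy (\<lambda>\<xi>. fourier_L1 (\<lambda>x. c * trunc (real k) f x) \<xi> - c * g \<xi>)) \<longlonglongrightarrow> 0"
    using cm0[OF _ has_fourier_L2D(3)[OF 1]] by (simp add: right_diff_distrib fourier_L1_cmult)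
qed

lemma has_fourier_L2_diff:
  assumes "has_fourier_L2 f1 g1" "has_fourier_L2 f2 g2"
  shows "has_fourier_L2 (\<lambda>x. f1 x - f2 x) (\<lambda>\<xi>. g1 \<xi> - g2 \<xi>)"
  using has_fourier_L2_add[OF assms(1) has_fourier_L2_cmult[OF assms(2), of "-1"]] by simp

lemma energy_fourier_L2_le:
  assumes fg: "has_fourier_L2 f g"
  shows "energy g \<le> energy f"
proof -
  note sq = has_fourier_L2D(1,2)[OF fg]
  have [measurable]: "g \<in> borel_measurable borel" "\<And>R. trunc R f \<in> borel_measurable borel"
    using sq square_integrable_trunc(1)[OF sq(1)] by (auto simp: square_integrable_iff_energy)
  obtain r where r: "strict_mono r" "AE \<xi> in lborel. (\<lambda>k. fourier_L1 (trunc (real (r k)) f) \<xi>) \<longlonglongrightarrow> g \<xi>"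
    using energy_tendsto_AE_subseq[OF _ _ has_fourier_L2D(3)[OF fg]] by auto
  show ?thesis
  proof (rule energy_Fatou[OF _ r(2)])
    show "energy (fourier_L1 (trunc (real (r k)) f)) \<le> energy f" for k
      by (rule order_trans[OF energy_fourier_L1_le square_integrable_trunc(2)])
         (intro integrable_trunc square_integrable_trunc sq)+
  qed measurable
qed

lemma has_fourier_L2_unique:
  assumes "has_fourier_L2 f g1" "has_fourier_L2 f g2"
  shows "AE \<xi> in lborel. g1 \<xi> = g2 \<xi>"
proof -
  have [measurable]: "g1 \<in> borel_measurable borel" "g2 \<in> borel_measurable borel"
    using has_fourier_L2D(2)[OF assms(1)] has_fourier_L2D(2)[OF assms(2)]
    by (auto simp: square_integrable_iff_energy)
  have "energy (\<lambda>\<xi>. g1 \<xi> - g2 \<xi>) \<le> energy (\<lambda>x. f x - f x)"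
    by (rule energy_fourier_L2_le[OF has_fourier_L2_diff[OF assms]])
  then have "energy (\<lambda>\<xi>. g1 \<xi> - g2 \<xi>) = 0" by (simp add: energy_def)
  then show ?thesis by (subst (asm) energy_eq_0_iff) auto
qed

lemma has_fourier_L2_cong_AE:
  assumes fg: "has_fourier_L2 f g" and [measurable]: "f' \<in> borel_measurable borel" "g' \<in> borel_measurable borel"
    and f: "AE x in lborel. f' x = f x" and g: "AE \<xi> in lborel. g' \<xi> = g \<xi>"
  shows "has_fourier_L2 f' g'"
proof (rule has_fourier_L2I[where h = "\<lambda>k. trunc (real k) f"])
  note sq = has_fourier_L2D(1,2)[OF fg]
  have "energy f' = energy f" "energy g' = energy g"
    using f g by (auto intro!: energy_cong_AE)
  then show "square_integrable f'" "square_integrable g'"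
    using sq by (auto simp: square_integrable_iff_energy)
  show "integrable lborel (trunc (real k) f)" "square_integrable (trunc (real k) f)" for k
    using integrable_trunc[OF sq(1)] square_integrable_trunc[OF sq(1)] by auto
  have "energy (\<lambda>x. h x - f' x) = energy (\<lambda>x. h x - f x)" for h
    using f by (intro energy_cong_AE) auto
  then show "(\<lambda>k. energy (\<lambda>x. trunc (real k) f x - f' x)) \<longlonglongrightarrow> 0"
    using energy_trunc_tendsto[OF sq(1) filterlim_real_sequentially] by simp
  have "energy (\<lambda>x. h x - g' x) = energy (\<lambda>x. h x - g x)" for h
    using g by (intro energy_cong_AE) auto
  then show "(\<lambda>k. energy (\<lambda>\<xi>. fourier_L1 (trunc (real k) f) \<xi> - g' \<xi>)) \<longlonglongrightarrow> 0"
    using has_fourier_L2D(3)[OF fg] by simp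
qed

text \<open>Strong convergence in L2 implies weak convergence.\<close>
lemma integral_mult_tendsto:
  fixes a :: "nat \<Rightarrow> real \<Rightarrow> complex"
  assumes sq: "\<And>k. square_integrable (a k)" "square_integrable b" "square_integrable w"
    and lim: "(\<lambda>k. energy (\<lambda>x. a k x - b x)) \<longlonglongrightarrow> 0"
  shows "(\<lambda>k. LINT x|lborel. a k x * w x) \<longlonglongrightarrow> (LINT x|lborel. b x * w x)"
proof -
  have [measurable]: "\<And>k. a k \<in> borel_measurable borel" "b \<in> borel_measurable borel" "w \<in> borel_measurable borel"
    and fin: "energy w < \<infinity>"
    using sq by (auto simp: square_integrable_iff_energy)
  define d where "d k = (LINT x|lborel. (a k x - b x) * w x)" for k
  have le: "(ennreal (norm (d k)))\<^sup>2 \<le> energy (\<lambda>x. a k x - b x) * energy w" for k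
    unfolding d_def by (rule norm_integral_mult_le) measurable
  have "(\<lambda>k. energy (\<lambda>x. a k x - b x) * energy w) \<longlonglongrightarrow> 0 * energy w"
    using fin by (intro tendsto_mult_ennreal tendsto_const lim) auto
  then have "(\<lambda>k. energy (\<lambda>x. a k x - b x) * energy w) \<longlonglongrightarrow> 0" by simp
  from tendsto_sandwich[OF _ _ tendsto_const this]
  have "(\<lambda>k. (ennreal (norm (d k)))\<^sup>2) \<longlonglongrightarrow> 0" using le by simp
  then have "(\<lambda>k. ennreal ((norm (d k))\<^sup>2)) \<longlonglongrightarrow> ennreal 0" by (simp add: ennreal_power)
  then have "(\<lambda>k. (norm (d k))\<^sup>2) \<longlonglongrightarrow> 0"
    by (subst (asm) tendsto_ennreal_iff) auto
  then have "(\<lambda>k. sqrt ((norm (d k))\<^sup>2)) \<longlonglongrightarrow> sqrt 0" by (rule tendsto_real_sqrt)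
  then have "d \<longlonglongrightarrow> 0" by (simp add: tendsto_norm_zero_iff)
  moreover have "d = (\<lambda>k. (LINT x|lborel. a k x * w x) - (LINT x|lborel. b x * w x))"
    unfolding d_def left_diff_distrib
    using integrable_mult_square_integrable[OF sq(1) sq(3)] integrable_mult_square_integrable[OF sq(2,3)]
    by simp
  ultimately show ?thesis by (simp add: LIM_zero_iff)
qed

text \<open>Both sides of the formula for integrable functions pair the function, or its transform, with a fixed element of L2;
so the formula passes to the limit along the truncations.\<close>
lemma fourier_L2_inversion_gauss:
  assumes fg: "has_fourier_L2 f g" and pos: "0 < \<epsilon>"
  shows "fourier_L1 (\<lambda>\<xi>. g \<xi> * gauss \<epsilon> \<xi>) (- y) = conv (normal_density 0 \<epsilon>) f y"
proof -
  note sq = has_fourier_L2D(1,2)[OF fg]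
  define w where "w \<xi> = (1 / sqrt (2 * pi)) *\<^sub>R (gauss \<epsilon> \<xi> * exp (\<i> * of_real (\<xi> * y)))" for \<xi>
  have w: "square_integrable w"
  proof (rule square_integrable_bounded_integrable)
    show "integrable lborel w" unfolding w_def by (rule integrable_gauss_shift[OF pos])
    show "AE \<xi> in lborel. norm (w \<xi>) \<le> 1 / sqrt (2 * pi)"
      using norm_gauss_le by (auto simp: w_def norm_mult divide_right_mono)
  qed
  have sqF: "square_integrable (fourier_L1 (trunc (real k) f))" for k
  proof -
    have "energy (fourier_L1 (trunc (real k) f)) \<le> energy (trunc (real k) f)"
      by (intro energy_fourier_L1_le integrable_trunc square_integrable_trunc sq)
    moreover have "trunc (real k) f \<in> borel_measurable borel" "energy (trunc (real k) f) < \<infinity>"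
      using square_integrable_trunc(1)[OF sq(1), of "real k"] by (auto simp: square_integrable_iff_energy)
    ultimately show ?thesis
      by (auto simp: square_integrable_iff_energy intro: fourier_L1_measurable le_less_trans)
  qed
  have 1: "(\<lambda>k. LINT \<xi>|lborel. fourier_L1 (trunc (real k) f) \<xi> * w \<xi>) \<longlonglongrightarrow> (LINT \<xi>|lborel. g \<xi> * w \<xi>)"
    by (rule integral_mult_tendsto[OF sqF sq(2) w has_fourier_L2D(3)[OF fg]])
  have 2: "(\<lambda>k. LINT x|lborel. trunc (real k) f x * of_real (normal_density 0 \<epsilon> (x - y)))
      \<longlonglongrightarrow> (LINT x|lborel. f x * of_real (normal_density 0 \<epsilon> (x - y)))"
    by (rule integral_mult_tendsto[OF square_integrable_trunc(1)[OF sq(1)] sq(1)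
          square_integrable_normal_density[OF pos] energy_trunc_tendsto[OF sq(1) filterlim_real_sequentially]])
  have "(LINT \<xi>|lborel. fourier_L1 (trunc (real k) f) \<xi> * w \<xi>)
      = (LINT x|lborel. trunc (real k) f x * of_real (normal_density 0 \<epsilon> (x - y)))" for k
    using fourier_L1_inversion_gauss[OF integrable_trunc[OF sq(1)] pos, of "real k" y]
    unfolding fourier_L1_gauss_mult conv_normal_density_eq w_def by simp
  with 1 2 have "(LINT \<xi>|lborel. g \<xi> * w \<xi>) = (LINT x|lborel. f x * of_real (normal_density 0 \<epsilon> (x - y)))"
    by (simp add: LIMSEQ_unique)
  then show ?thesis unfolding fourier_L1_gauss_mult conv_normal_density_eq w_def .
qed

lemma integrable_mult_gauss:
  assumes "square_integrable g" "0 < \<epsilon>"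
  shows "integrable lborel (\<lambda>\<xi>. g \<xi> * gauss \<epsilon> \<xi>)"
  by (rule integrable_mult_square_integrable[OF assms(1) square_integrable_gauss[OF assms(2)]])

text \<open>The other half of Plancherel's theorem. Up to reflection the mollifications of \<open>f\<close> are transforms of cut-offs of \<open>g\<close>, so the
first half bounds their energy by that of \<open>g\<close>.\<close>
lemma energy_le_fourier_L2:
  assumes fg: "has_fourier_L2 f g"
  shows "energy f \<le> energy g"
proof -
  note sq = has_fourier_L2D(1,2)[OF fg]
  have [measurable]: "f \<in> borel_measurable borel" "g \<in> borel_measurable borel"
    using sq by (auto simp: square_integrable_iff_energy)
  obtain \<epsilon> :: "nat \<Rightarrow> real" where pos: "\<And>k. 0 < \<epsilon> k"
    and lim: "AE x in lborel. (\<lambda>k. conv (normal_density 0 (\<epsilon> k)) f x) \<longlonglongrightarrow> f x"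
    using mollify_AE_subseq[OF sq(1)] by auto
  show ?thesis
  proof (rule energy_Fatou[OF _ lim])
    fix k
    define G where "G \<xi> = gauss (\<epsilon> k) \<xi> * g \<xi>" for \<xi>
    have G: "integrable lborel G" "square_integrable G" "energy G \<le> ennreal (1\<^sup>2) * energy g"
      unfolding G_def using integrable_mult_gauss[OF sq(2) pos, of k]
        square_integrable_bounded_mult[OF sq(2), of "gauss (\<epsilon> k)" 1] norm_gauss_le
      by (auto simp: mult.commute)
    have [measurable]: "G \<in> borel_measurable borel" unfolding G_def by measurable
    have "conv (normal_density 0 (\<epsilon> k)) f = (\<lambda>y. fourier_L1 G (0 - y))"
      using fourier_L2_inversion_gauss[OF fg pos, of k] by (simp add: G_def[abs_def] fun_eq_iff mult.commute)
    then have "energy (conv (normal_density 0 (\<epsilon> k)) f) = energy (\<lambda>y. fourier_L1 G (0 - y))" by simp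
    also have "\<dots> = energy (fourier_L1 G)"
      using nn_integral_real_affine[of "\<lambda>x. ennreal ((norm (fourier_L1 G x))\<^sup>2)" "-1" 0]
      by (simp add: energy_def)
    also have "\<dots> \<le> energy G" by (rule energy_fourier_L1_le[OF G(1,2)])
    also have "\<dots> \<le> energy g" using G(3) by simp
    finally show "energy (conv (normal_density 0 (\<epsilon> k)) f) \<le> energy g" .
  qed measurable
qed

lemma has_fourier_L2_inj:
  assumes "has_fourier_L2 f1 g1" "has_fourier_L2 f2 g2" "AE \<xi> in lborel. g1 \<xi> = g2 \<xi>"
  shows "AE x in lborel. f1 x = f2 x"
proof -
  have [measurable]: "f1 \<in> borel_measurable borel" "f2 \<in> borel_measurable borel"
    using has_fourier_L2D(1)[OF assms(1)] has_fourier_L2D(1)[OF assms(2)]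
    by (auto simp: square_integrable_iff_energy)
  have "energy (\<lambda>x. f1 x - f2 x) \<le> energy (\<lambda>\<xi>. g1 \<xi> - g2 \<xi>)"
    by (rule energy_le_fourier_L2[OF has_fourier_L2_diff[OF assms(1,2)]])
  also have "\<dots> = energy (\<lambda>_. 0)" using assms(3) by (intro energy_cong_AE) auto
  finally have "energy (\<lambda>x. f1 x - f2 x) = 0" by (simp add: energy_def)
  then show ?thesis by (subst (asm) energy_eq_0_iff) auto
qed

text \<open>By the regularised inversion formula all mollifications of \<open>f\<close> satisfy the bound.\<close>
lemma AE_norm_le_integral_fourier_L2:
  assumes fg: "has_fourier_L2 f g" and int: "integrable lborel g"
  shows "AE x in lborel. norm (f x) \<le> (1 / sqrt (2 * pi)) * (LINT \<xi>|lborel. norm (g \<xi>))"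
proof -
  note sq = has_fourier_L2D(1,2)[OF fg]
  obtain \<epsilon> :: "nat \<Rightarrow> real" where pos: "\<And>k. 0 < \<epsilon> k"
    and lim: "AE x in lborel. (\<lambda>k. conv (normal_density 0 (\<epsilon> k)) f x) \<longlonglongrightarrow> f x"
    using mollify_AE_subseq[OF sq(1)] by auto
  have le: "norm (conv (normal_density 0 (\<epsilon> k)) f x) \<le> (1 / sqrt (2 * pi)) * (LINT \<xi>|lborel. norm (g \<xi>))" for k x
  proof -
    have "norm (conv (normal_density 0 (\<epsilon> k)) f x)
        \<le> (1 / sqrt (2 * pi)) * (LINT \<xi>|lborel. norm (g \<xi> * gauss (\<epsilon> k) \<xi>))"
      unfolding fourier_L2_inversion_gauss[OF fg pos, symmetric] by (rule norm_fourier_L1_le)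
    also have "(LINT \<xi>|lborel. norm (g \<xi> * gauss (\<epsilon> k) \<xi>)) \<le> (LINT \<xi>|lborel. norm (g \<xi>))"
      using integrable_mult_gauss[OF sq(2) pos, of k] int norm_gauss_le
      by (intro integral_mono integrable_norm) (auto simp: norm_mult intro: mult_left_le)
    finally show ?thesis by (simp add: divide_right_mono)
  qed
  show ?thesis
    using lim
  proof eventually_elim
    fix x assume "(\<lambda>k. conv (normal_density 0 (\<epsilon> k)) f x) \<longlonglongrightarrow> f x"
    then have "(\<lambda>k. norm (conv (normal_density 0 (\<epsilon> k)) f x)) \<longlonglongrightarrow> norm (f x)" by (rule tendsto_norm)
    then show "norm (f x) \<le> (1 / sqrt (2 * pi)) * (LINT \<xi>|lborel. norm (g \<xi>))"
      by (rule LIMSEQ_le_const2) (use le in auto)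
  qed
qed

section \<open>Fourier multipliers with integrable kernel\<close>

text \<open>The variable of the kernel comes first, so that the inner integral over the other variable is translation invariant.\<close>
lemma integrable_conv_pair:
  fixes f :: "real \<Rightarrow> complex"
  assumes P: "integrable lborel P" and f: "integrable lborel f"
  shows "integrable (lborel \<Otimes>\<^sub>M lborel) (\<lambda>(y, x). P y *\<^sub>R f (x - y))"
proof (rule lborel_pair.Fubini_integrable)
  have [measurable]: "P \<in> borel_measurable borel" "f \<in> borel_measurable borel" using P f by auto
  show "(\<lambda>(y, x). P y *\<^sub>R f (x - y)) \<in> borel_measurable (lborel \<Otimes>\<^sub>M lborel)" by measurable
  have shift: "integrable lborel (\<lambda>x. f (x - y))" for y
    using lborel_integrable_real_affine[OF f, of 1 "-y"] by simp
  show "AE y in lborel. integrable lborel (\<lambda>x. case (y, x) of (y, x) \<Rightarrow> P y *\<^sub>R f (x - y))"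
    using shift by auto
  have "(LINT x|lborel. norm (f (x - y))) = (LINT x|lborel. norm (f x))" for y
    using lborel_integral_real_affine[of 1 "\<lambda>x. norm (f x)" "-y"] by simp
  then have "(LINT x|lborel. norm (case (y, x) of (y, x) \<Rightarrow> P y *\<^sub>R f (x - y)))
      = \<bar>P y\<bar> * (LINT x|lborel. norm (f x))" for y
    by simp
  moreover have "integrable lborel (\<lambda>y. \<bar>P y\<bar> * (LINT x|lborel. norm (f x)))"
    using P by (intro integrable_mult_left) auto
  ultimately show "integrable lborel (\<lambda>y. LINT x|lborel. norm (case (y, x) of (y, x) \<Rightarrow> P y *\<^sub>R f (x - y)))"
    by presburger
qed

lemma integrable_conv:
  assumes "integrable lborel P" "integrable lborel f"
  shows "integrable lborel (conv P f)"
  unfolding conv_def[abs_def] by (rule lborel_pair.integrable_snd[OF integrable_conv_pair[OF assms]])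

text \<open>Fubini's theorem and translation invariance; the factor makes up for the second normalisation constant on the right.\<close>
lemma fourier_L1_conv:
  assumes P: "integrable lborel P" and f: "integrable lborel f"
  shows "fourier_L1 (conv P f) \<xi> = sqrt (2 * pi) *\<^sub>R (fourier_L1 (\<lambda>x. of_real (P x)) \<xi> * fourier_L1 f \<xi>)"
proof -
  have [measurable]: "P \<in> borel_measurable borel" "f \<in> borel_measurable borel" using P f by auto
  define E where "E x = exp (- (\<i> * of_real \<xi> * of_real x))" for x :: real
  have [measurable]: "E \<in> borel_measurable borel" unfolding E_def by measurable
  have [simp]: "norm (E x) = 1" for x by (simp add: E_def)
  have E_add: "E x = E (x - y) * E y" for x y
    by (simp add: E_def algebra_simps flip: exp_add)
  have int: "integrable (lborel \<Otimes>\<^sub>M lborel) (\<lambda>(y, x). P y *\<^sub>R f (x - y) * E x)"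
  proof (rule Bochner_Integration.integrable_bound[OF integrable_conv_pair[OF P f]])
    show "(\<lambda>(y, x). P y *\<^sub>R f (x - y) * E x) \<in> borel_measurable (lborel \<Otimes>\<^sub>M lborel)" by measurable
  qed (auto simp: norm_mult)
  have "(LINT x|lborel. conv P f x * E x) = (LINT x|lborel. LINT y|lborel. P y *\<^sub>R f (x - y) * E x)"
    unfolding conv_def by (simp only: integral_mult_left_zero)
  also have "\<dots> = (LINT y|lborel. LINT x|lborel. P y *\<^sub>R f (x - y) * E x)"
    by (rule lborel_pair.Fubini_integral[OF int])
  also have "\<dots> = (LINT y|lborel. (of_real (P y) * E y) * (LINT x|lborel. f x * E x))"
  proof (intro Bochner_Integration.integral_cong refl)
    fix y
    have "(LINT x|lborel. P y *\<^sub>R f (x - y) * E x) = (LINT x|lborel. (of_real (P y) * E y) * (f (x - y) * E (x - y)))"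
      by (subst E_add[of _ y]) (simp add: scaleR_conv_of_real ac_simps)
    also have "\<dots> = (of_real (P y) * E y) * (LINT x|lborel. f (x - y) * E (x - y))"
      by (rule integral_mult_right_zero)
    also have "(LINT x|lborel. f (x - y) * E (x - y)) = (LINT x|lborel. f x * E x)"
      using lborel_integral_real_affine[of 1 "\<lambda>x. f x * E x" "-y"] by simp
    finally show "(LINT x|lborel. P y *\<^sub>R f (x - y) * E x) = (of_real (P y) * E y) * (LINT x|lborel. f x * E x)" .
  qed
  also have "\<dots> = (LINT y|lborel. of_real (P y) * E y) * (LINT x|lborel. f x * E x)"
    by (rule integral_mult_left_zero)
  finally have "(LINT x|lborel. conv P f x * E x)
      = (LINT y|lborel. of_real (P y) * E y) * (LINT x|lborel. f x * E x)" .
  moreover have "1 / sqrt (2 * pi) = sqrt (2 * pi) / (2 * pi)"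
    by (simp add: field_simps flip: power2_eq_square)
  ultimately show ?thesis
    unfolding fourier_L1_def E_def by simp
qed

text \<open>The operator \<open>L\<close> in physical space. It is needed in this form because convolution with an integrable kernel is bounded
with respect to the supremum norm, which is invisible on the Fourier side.\<close>
definition kernel_op :: "(real \<Rightarrow> real) \<Rightarrow> (real \<Rightarrow> complex) \<Rightarrow> real \<Rightarrow> complex" where
  "kernel_op K f x = (1 / sqrt (2 * pi)) *\<^sub>R conv K f x"

lemma kernel_op_measurable [measurable]:
  assumes [measurable]: "K \<in> borel_measurable borel" "f \<in> borel_measurable borel"
  shows "kernel_op K f \<in> borel_measurable borel"
  unfolding kernel_op_def[abs_def] by measurable

lemma energy_kernel_op_le:
  assumes [measurable]: "K \<in> borel_measurable borel" "f \<in> borel_measurable borel"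
  shows "energy (kernel_op K f) \<le> ennreal (1 / (2 * pi)) * ((\<integral>\<^sup>+y. \<bar>K y\<bar> \<partial>lborel)\<^sup>2 * energy f)"
proof -
  have "energy (kernel_op K f) = energy (\<lambda>x. of_real (1 / sqrt (2 * pi)) * conv K f x)"
    by (simp add: kernel_op_def[abs_def] scaleR_conv_of_real)
  also have "\<dots> = ennreal ((norm (complex_of_real (1 / sqrt (2 * pi))))\<^sup>2) * energy (conv K f)"
    by (rule energy_cmult) measurable
  also have "(norm (complex_of_real (1 / sqrt (2 * pi))))\<^sup>2 = 1 / (2 * pi)"
    by (simp add: norm_divide power_divide)
  finally show ?thesis by (simp add: energy_conv_le mult_left_mono)
qed

lemma square_integrable_kernel_op:
  assumes K: "integrable lborel K" and f: "square_integrable f"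
  shows "square_integrable (kernel_op K f)"
proof -
  have [measurable]: "K \<in> borel_measurable borel" "f \<in> borel_measurable borel" and "energy f < \<infinity>"
    using K f by (auto simp: square_integrable_iff_energy)
  moreover have "(\<integral>\<^sup>+y. \<bar>K y\<bar> \<partial>lborel) < \<infinity>" using K by (simp add: integrable_iff_bounded)
  ultimately have "ennreal (1 / (2 * pi)) * ((\<integral>\<^sup>+y. \<bar>K y\<bar> \<partial>lborel)\<^sup>2 * energy f) < \<infinity>"
    by (simp add: ennreal_mult_less_top power_less_top_ennreal)
  then have "energy (kernel_op K f) < \<infinity>"
    using energy_kernel_op_le[of K f] by (auto intro: le_less_trans)
  then show ?thesis by (simp add: square_integrable_iff_energy)
qed

text \<open>For square-integrable \<open>f\<close> the convolution integral exists for almost every point only; the bound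
\<open>a \<le> 1 + a\<^sup>2\<close> reduces this to the convolution of \<open>\<bar>K\<bar>\<close> with the integrable function \<open>\<bar>f\<bar>\<^sup>2\<close>.\<close>
lemma AE_integrable_conv:
  fixes f :: "real \<Rightarrow> complex"
  assumes K: "integrable lborel K" and f: "square_integrable f"
  shows "AE x in lborel. integrable lborel (\<lambda>y. K y *\<^sub>R f (x - y))"
proof -
  have [measurable]: "K \<in> borel_measurable borel" "f \<in> borel_measurable borel"
    using K f by (auto simp: square_integrable_iff_energy)
  have "integrable lborel (\<lambda>x. complex_of_real ((norm (f x))\<^sup>2))"
    using f by (intro integrable_of_real) (auto simp: square_integrable_def)
  from lborel_pair.AE_integrable_snd[OF integrable_conv_pair[OF K this]]
  show ?thesis
  proof eventually_elim
    fix x assume *: "integrable lborel (\<lambda>y. K y *\<^sub>R complex_of_real ((norm (f (x - y)))\<^sup>2))"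
    have "integrable lborel (\<lambda>y. \<bar>K y\<bar> + norm (K y *\<^sub>R complex_of_real ((norm (f (x - y)))\<^sup>2)))"
      using K * by (intro Bochner_Integration.integrable_add integrable_abs integrable_norm)
    then show "integrable lborel (\<lambda>y. K y *\<^sub>R f (x - y))"
    proof (rule Bochner_Integration.integrable_bound)
      show "AE y in lborel. norm (K y *\<^sub>R f (x - y))
          \<le> norm (\<bar>K y\<bar> + norm (K y *\<^sub>R complex_of_real ((norm (f (x - y)))\<^sup>2)))"
      proof (rule AE_I2)
        fix y
        have "norm (f (x - y)) \<le> 1 + (norm (f (x - y)))\<^sup>2"
          using sum_squares_bound[of "norm (f (x - y))" 1] norm_ge_zero[of "f (x - y)"]
          by (simp only: mult_1_right one_power2)
        then have "\<bar>K y\<bar> * norm (f (x - y)) \<le> \<bar>K y\<bar> * (1 + (norm (f (x - y)))\<^sup>2)"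
          by (intro mult_left_mono) auto
        then show "norm (K y *\<^sub>R f (x - y))
          \<le> norm (\<bar>K y\<bar> + norm (K y *\<^sub>R complex_of_real ((norm (f (x - y)))\<^sup>2)))"
          by (simp add: norm_power distrib_left)
      qed
    qed measurable
  qed
qed

lemma kernel_op_diff_AE:
  assumes K: "integrable lborel K" and f: "square_integrable f" and g: "square_integrable g"
  shows "AE x in lborel. kernel_op K (\<lambda>x. f x - g x) x = kernel_op K f x - kernel_op K g x"
  using AE_integrable_conv[OF K f] AE_integrable_conv[OF K g]
  by eventually_elim (simp add: kernel_op_def conv_def scaleR_diff_right)

text \<open>The convolution theorem in L2, obtained from the one in L1 by approximation: both sides are continuous in L2, the left by
Young's inequality and the right because the symbol is bounded.\<close>
lemma has_fourier_L2_kernel_op: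
  assumes K: "integrable lborel K"
    and m: "\<And>\<xi>. fourier_L1 (\<lambda>x. of_real (K x)) \<xi> = of_real (m \<xi>)"
    and fg: "has_fourier_L2 f g"
  shows "has_fourier_L2 (kernel_op K f) (\<lambda>\<xi>. of_real (m \<xi>) * g \<xi>)"
proof -
  note sq = has_fourier_L2D(1,2)[OF fg]
  define h where "h k = trunc (real k) f" for k
  have h: "square_integrable (h k)" "integrable lborel (h k)" for k
    unfolding h_def by (intro square_integrable_trunc integrable_trunc sq)+
  have [measurable]: "K \<in> borel_measurable borel" "f \<in> borel_measurable borel" "g \<in> borel_measurable borel"
    "\<And>k. h k \<in> borel_measurable borel"
    using K sq h by (auto simp: square_integrable_iff_energy)
  define B where "B = (1 / sqrt (2 * pi)) * (LINT x|lborel. \<bar>K x\<bar>)"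
  have mB: "norm (complex_of_real (m \<xi>)) \<le> B" for \<xi>
    unfolding m[symmetric] B_def using norm_fourier_L1_le[of "\<lambda>x. of_real (K x)" \<xi>] by simp
  have m_meas[measurable]: "(\<lambda>\<xi>. complex_of_real (m \<xi>)) \<in> borel_measurable borel"
    unfolding m[symmetric] by measurable
  have F: "fourier_L1 (kernel_op K (h k)) \<xi> = of_real (m \<xi>) * fourier_L1 (h k) \<xi>" for k \<xi>
  proof -
    have "fourier_L1 (kernel_op K (h k)) \<xi> = of_real (1 / sqrt (2 * pi)) * fourier_L1 (conv K (h k)) \<xi>"
      unfolding kernel_op_def[abs_def] scaleR_conv_of_real by (rule fourier_L1_cmult)
    also have "\<dots> = of_real (m \<xi>) * fourier_L1 (h k) \<xi>"
      unfolding fourier_L1_conv[OF K h(2)] m by (simp add: scaleR_conv_of_real)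
    finally show ?thesis .
  qed
  show ?thesis
  proof (rule has_fourier_L2I[where h = "\<lambda>k. kernel_op K (h k)"])
    show "square_integrable (kernel_op K f)" "square_integrable (kernel_op K (h k))" for k
      by (intro square_integrable_kernel_op K sq h)+
    show "square_integrable (\<lambda>\<xi>. of_real (m \<xi>) * g \<xi>)"
      by (rule square_integrable_bounded_mult[OF sq(2) m_meas mB])
    show "integrable lborel (kernel_op K (h k))" for k
      unfolding kernel_op_def[abs_def] by (intro integrable_scaleR_right integrable_conv K h)
    define c where "c = ennreal (1 / (2 * pi)) * (\<integral>\<^sup>+y. \<bar>K y\<bar> \<partial>lborel)\<^sup>2"
    have c: "c < \<infinity>"
      unfolding c_def using K by (simp add: integrable_iff_bounded ennreal_mult_less_top power_less_top_ennreal)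
    have le: "energy (\<lambda>x. kernel_op K (h k) x - kernel_op K f x) \<le> c * energy (\<lambda>x. h k x - f x)" for k
    proof -
      have "energy (\<lambda>x. kernel_op K (h k) x - kernel_op K f x) = energy (kernel_op K (\<lambda>x. h k x - f x))"
        using kernel_op_diff_AE[OF K h(1) sq(1), of k] by (intro energy_cong_AE) (auto elim: eventually_mono)
      also have "\<dots> \<le> c * energy (\<lambda>x. h k x - f x)"
        using energy_kernel_op_le[of K "\<lambda>x. h k x - f x"] by (simp add: c_def mult.assoc)
      finally show ?thesis .
    qed
    have "(\<lambda>k. c * energy (\<lambda>x. h k x - f x)) \<longlonglongrightarrow> c * 0"
      unfolding h_def using c
      by (intro tendsto_mult_ennreal tendsto_const energy_trunc_tendsto[OF sq(1) filterlim_real_sequentially]) auto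
    then have "(\<lambda>k. c * energy (\<lambda>x. h k x - f x)) \<longlonglongrightarrow> 0" by simp
    from tendsto_sandwich[OF _ _ tendsto_const this]
    show "(\<lambda>k. energy (\<lambda>x. kernel_op K (h k) x - kernel_op K f x)) \<longlonglongrightarrow> 0"
      using le by simp
    have le2: "energy (\<lambda>\<xi>. fourier_L1 (kernel_op K (h k)) \<xi> - of_real (m \<xi>) * g \<xi>)
        \<le> ennreal (B\<^sup>2) * energy (\<lambda>\<xi>. fourier_L1 (h k) \<xi> - g \<xi>)" for k
    proof -
      have "energy (fourier_L1 (h k)) < \<infinity>"
        using energy_fourier_L1_le[OF h(2,1)] h(1)[of k]
        by (auto simp: square_integrable_iff_energy intro: le_less_trans)
      then have "square_integrable (fourier_L1 (h k))"
        by (simp add: square_integrable_iff_energy)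
      from square_integrable_bounded_mult(2)[OF square_integrable_diff[OF this sq(2)] m_meas mB]
      show ?thesis by (simp add: F right_diff_distrib)
    qed
    have "(\<lambda>k. ennreal (B\<^sup>2) * energy (\<lambda>\<xi>. fourier_L1 (h k) \<xi> - g \<xi>)) \<longlonglongrightarrow> ennreal (B\<^sup>2) * 0"
      unfolding h_def
      by (intro tendsto_mult_ennreal tendsto_const has_fourier_L2D(3)[OF fg]) auto
    then have "(\<lambda>k. ennreal (B\<^sup>2) * energy (\<lambda>\<xi>. fourier_L1 (h k) \<xi> - g \<xi>)) \<longlonglongrightarrow> 0" by simp
    from tendsto_sandwich[OF _ _ tendsto_const this]
    show "(\<lambda>k. energy (\<lambda>\<xi>. fourier_L1 (kernel_op K (h k)) \<xi> - of_real (m \<xi>) * g \<xi>)) \<longlonglongrightarrow> 0"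
      using le2 by simp
  qed
qed

lemma has_fourier_L2_kernel_op_power:
  assumes K: "integrable lborel K"
    and m: "\<And>\<xi>. fourier_L1 (\<lambda>x. of_real (K x)) \<xi> = of_real (m \<xi>)"
    and fg: "has_fourier_L2 f g"
  shows "has_fourier_L2 ((kernel_op K ^^ j) f) (\<lambda>\<xi>. of_real (m \<xi>) ^ j * g \<xi>)"
proof (induction j)
  case 0
  then show ?case using fg by simp
next
  case (Suc j)
  from has_fourier_L2_kernel_op[OF K m this] show ?case by (simp add: mult.assoc)
qed

lemma kernel_op_bounded:
  assumes K: "integrable lborel K" and [measurable]: "f \<in> borel_measurable borel"
    and B: "AE x in lborel. norm (f x) \<le> B"
  shows "norm (kernel_op K f x) \<le> (1 / sqrt (2 * pi)) * (LINT x|lborel. \<bar>K x\<bar>) * B"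
proof -
  have [measurable]: "K \<in> borel_measurable borel" using K by auto
  have AE: "AE y in lborel. norm (f (x - y)) \<le> B"
    using AE_borel_affine[of "-1" "\<lambda>x. norm (f x) \<le> B" x] B by simp
  have int: "integrable lborel (\<lambda>y. \<bar>K y\<bar> * B)" using K by (intro integrable_mult_left) auto
  have le: "AE y in lborel. norm (K y *\<^sub>R f (x - y)) \<le> \<bar>K y\<bar> * B"
    using AE by eventually_elim (auto intro: mult_left_mono)
  have "norm (conv K f x) \<le> (LINT y|lborel. norm (K y *\<^sub>R f (x - y)))"
    unfolding conv_def by (rule integral_norm_bound)
  also have "\<dots> \<le> (LINT y|lborel. \<bar>K y\<bar> * B)"
  proof (rule integral_mono_AE[OF _ int le])
    show "integrable lborel (\<lambda>y. norm (K y *\<^sub>R f (x - y)))"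
      by (rule Bochner_Integration.integrable_bound[OF int])
         (use le in \<open>auto elim!: eventually_mono intro: order_trans[OF _ abs_ge_self]\<close>)
  qed
  also have "\<dots> = (LINT x|lborel. \<bar>K x\<bar>) * B" by simp
  finally show ?thesis by (simp add: kernel_op_def divide_right_mono)
qed

lemma kernel_op_power_bounded:
  assumes K: "integrable lborel K" and f: "f \<in> borel_measurable borel"
    and B: "AE x in lborel. norm (f x) \<le> B"
  shows "AE x in lborel. norm ((kernel_op K ^^ j) f x) \<le> ((1 / sqrt (2 * pi)) * (LINT x|lborel. \<bar>K x\<bar>)) ^ j * B"
proof (induction j)
  case 0
  then show ?case using B by simp
next
  case (Suc j)
  have [measurable]: "K \<in> borel_measurable borel" using K by auto
  have "(kernel_op K ^^ j) f \<in> borel_measurable borel"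
    by (induction j) (use f in auto)
  from kernel_op_bounded[OF K this Suc] show ?case by (auto simp: mult.assoc)
qed

text \<open>The multiplier operator is defined by an arbitrary choice; by injectivity of the transform every choice is the
convolution with the kernel.\<close>
lemma fourier_multiplier_eq_kernel_op:
  assumes K: "integrable lborel K"
    and m: "\<And>\<xi>. fourier_L1 (\<lambda>x. of_real (K x)) \<xi> = of_real (m \<xi>)"
    and f: "square_integrable f"
  shows "AE x in lborel. fourier_multiplier m f x = kernel_op K f x"
proof -
  let ?P = "\<lambda>w. square_integrable w \<and>
    (AE \<xi> in lborel. fourier_L2 w \<xi> = of_real (m \<xi>) * fourier_L2 f \<xi>)"
  note Kf = has_fourier_L2_kernel_op[OF K m has_fourier_L2_fourier_L2[OF f]]
  have "?P (kernel_op K f)"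
    using has_fourier_L2_unique[OF has_fourier_L2_fourier_L2 Kf] has_fourier_L2D(1)[OF Kf] by auto
  then have P: "?P (fourier_multiplier m f)"
    unfolding fourier_multiplier_def by (rule someI[of ?P])
  then have "has_fourier_L2 (fourier_multiplier m f) (fourier_L2 (fourier_multiplier m f))"
    by (intro has_fourier_L2_fourier_L2) auto
  from has_fourier_L2_inj[OF this Kf] P show ?thesis by auto
qed

text \<open>By linearity the left-hand side of the equation has the transform \<open>m * v - \<nu> * v + g\<close>. It vanishes almost everywhere, and the
transform is determined by the class of a function.\<close>
lemma solves_steady_fourier:
  fixes u n m :: "real \<Rightarrow> real"
  assumes K: "integrable lborel K"
    and m: "\<And>\<xi>. fourier_L1 (\<lambda>x. of_real (K x)) \<xi> = of_real (m \<xi>)"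
    and f: "has_fourier_L2 (\<lambda>x. of_real (u x)) v" and n: "has_fourier_L2 (\<lambda>x. of_real (n (u x))) g"
    and sol: "solves_steady m n \<nu> u"
  shows "AE \<xi> in lborel. of_real (\<nu> - m \<xi>) * v \<xi> = g \<xi>"
proof -
  let ?f = "\<lambda>x. complex_of_real (u x)" and ?n = "\<lambda>x. complex_of_real (n (u x))"
  have F: "has_fourier_L2 (\<lambda>x. (kernel_op K ?f x - of_real \<nu> * ?f x) + ?n x)
      (\<lambda>\<xi>. (of_real (m \<xi>) * v \<xi> - of_real \<nu> * v \<xi>) + g \<xi>)"
    by (intro has_fourier_L2_add has_fourier_L2_diff has_fourier_L2_cmult has_fourier_L2_kernel_op[OF K m] f n)
  have zero: "AE x in lborel. 0 = (kernel_op K ?f x - of_real \<nu> * ?f x) + ?n x"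
    using sol fourier_multiplier_eq_kernel_op[OF K m has_fourier_L2D(1)[OF f]]
    unfolding solves_steady_def by eventually_elim simp
  have "has_fourier_L2 (\<lambda>x. 0) (\<lambda>\<xi>. (of_real (m \<xi>) * v \<xi> - of_real \<nu> * v \<xi>) + g \<xi>)"
    using has_fourier_L2D(2)[OF F]
    by (intro has_fourier_L2_cong_AE[OF F _ _ zero]) (auto simp: square_integrable_iff_energy)
  moreover have "has_fourier_L2 (\<lambda>x. 0) (\<lambda>\<xi>. 0)"
    using has_fourier_L2_cmult[OF f, of 0] by simp
  ultimately have "AE \<xi> in lborel. (of_real (m \<xi>) * v \<xi> - of_real \<nu> * v \<xi>) + g \<xi> = 0"
    by (rule has_fourier_L2_unique)
  then show ?thesis
  proof eventually_elim
    fix \<xi> assume "(of_real (m \<xi>) * v \<xi> - of_real \<nu> * v \<xi>) + g \<xi> = 0"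
    then have "g \<xi> = of_real \<nu> * v \<xi> - of_real (m \<xi>) * v \<xi>"
      by (metis add.commute add_diff_cancel_left' diff_0 minus_diff_eq)
    then show "of_real (\<nu> - m \<xi>) * v \<xi> = g \<xi>" by (simp add: left_diff_distrib)
  qed
qed

text \<open>Read off on the Fourier side, where the \<open>j\<close>-fold application of the operator is multiplication by \<open>m^j\<close>.\<close>
lemma kernel_op_power_equation:
  assumes K: "integrable lborel K"
    and m: "\<And>\<xi>. fourier_L1 (\<lambda>x. of_real (K x)) \<xi> = of_real (m \<xi>)"
    and f: "has_fourier_L2 f v" and n: "has_fourier_L2 h g"
    and eq: "AE \<xi> in lborel. of_real (\<nu> - m \<xi>) * v \<xi> = g \<xi>"
  shows "AE x in lborel. of_real \<nu> * (kernel_op K ^^ j) f x = (kernel_op K ^^ Suc j) f x + (kernel_op K ^^ j) h x"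
proof (rule has_fourier_L2_inj)
  show "has_fourier_L2 (\<lambda>x. of_real \<nu> * (kernel_op K ^^ j) f x) (\<lambda>\<xi>. of_real \<nu> * (of_real (m \<xi>) ^ j * v \<xi>))"
    by (intro has_fourier_L2_cmult has_fourier_L2_kernel_op_power[OF K m] f)
  show "has_fourier_L2 (\<lambda>x. (kernel_op K ^^ Suc j) f x + (kernel_op K ^^ j) h x)
      (\<lambda>\<xi>. of_real (m \<xi>) ^ Suc j * v \<xi> + of_real (m \<xi>) ^ j * g \<xi>)"
    by (intro has_fourier_L2_add has_fourier_L2_kernel_op_power[OF K m] f n)
  show "AE \<xi> in lborel. of_real \<nu> * (of_real (m \<xi>) ^ j * v \<xi>) = of_real (m \<xi>) ^ Suc j * v \<xi> + of_real (m \<xi>) ^ j * g \<xi>"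
    using eq
  proof eventually_elim
    fix \<xi> assume "of_real (\<nu> - m \<xi>) * v \<xi> = g \<xi>"
    then show "of_real \<nu> * (of_real (m \<xi>) ^ j * v \<xi>) = of_real (m \<xi>) ^ Suc j * v \<xi> + of_real (m \<xi>) ^ j * g \<xi>"
      by (simp add: left_diff_distrib right_diff_distrib[symmetric] mult.left_commute mult.commute) (simp add: algebra_simps flip: \<open>_ = g \<xi>\<close>)
  qed
qed

section \<open>The symbol and the nonlinearity\<close>

lemma continuous_symbol:
  assumes K: "integrable lborel K"
    and m: "\<And>\<xi>. fourier_L1 (\<lambda>x. of_real (K x)) \<xi> = of_real (m \<xi>)"
  shows "continuous_on UNIV m"
proof -
  have "continuous_on UNIV (fourier_L1 (\<lambda>x. of_real (K x)))"
    using K by (intro fourier_L1_continuous integrable_of_real)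
  then have "continuous_on UNIV (\<lambda>\<xi>. Re (fourier_L1 (\<lambda>x. of_real (K x)) \<xi>))"
    by (intro continuous_intros)
  then show ?thesis by (simp add: m)
qed

text \<open>Near 0 this is the Maclaurin expansion, whose leading coefficient is negative. Away from 0 the symbol stays below
its maximum by a fixed amount: on compact sets by continuity and strictness of the maximum, at infinity by decay.\<close>
lemma symbol_coercive:
  assumes "admissible_symbol m \<sigma> l"
  shows "\<exists>c>0. (\<forall>\<xi>. \<bar>\<xi>\<bar> \<le> 1 \<longrightarrow> c * \<bar>\<xi>\<bar> ^ (2 * l) \<le> m 0 - m \<xi>) \<and> (\<forall>\<xi>. 1 \<le> \<bar>\<xi>\<bar> \<longrightarrow> c \<le> m 0 - m \<xi>)"
proof -
  define a where "a = - ((deriv ^^ (2 * l)) m 0 / fact (2 * l))"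
  obtain C K where C: "C > 0" "\<And>\<xi>. \<bar>m \<xi>\<bar> \<le> C * bracket \<xi> powr \<sigma>"
    and K: "integrable lborel K" "\<And>\<xi>. fourier_L1 (\<lambda>x. of_real (K x)) \<xi> = of_real (m \<xi>)"
    and m: "m 0 > 0" "\<And>\<xi>. \<xi> \<noteq> 0 \<Longrightarrow> m \<xi> < m 0" and \<sigma>: "\<sigma> < 0"
    and deriv: "(deriv ^^ (2 * l)) m 0 < 0"
    and O: "(\<lambda>\<xi>. m \<xi> - (m 0 + (deriv ^^ (2 * l)) m 0 / fact (2 * l) * \<xi> ^ (2 * l)))
       \<in> O[at 0](\<lambda>\<xi>. \<bar>\<xi>\<bar> ^ (2 * l + 2))"
    using assms unfolding admissible_symbol_def by blast
  have a: "a > 0" unfolding a_def using deriv by (simp add: divide_neg_pos)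
  obtain M where M: "M > 0" and ev: "eventually (\<lambda>\<xi>.
      norm (m \<xi> - (m 0 + (deriv ^^ (2 * l)) m 0 / fact (2 * l) * \<xi> ^ (2 * l)))
        \<le> M * norm (\<bar>\<xi>\<bar> ^ (2 * l + 2))) (at 0)"
    using O by (elim landau_o.bigE)
  obtain r0 where r0: "r0 > 0" "\<And>\<xi>. \<xi> \<noteq> 0 \<Longrightarrow> \<bar>\<xi>\<bar> < r0 \<Longrightarrow>
      \<bar>m \<xi> - (m 0 - a * \<xi> ^ (2 * l))\<bar> \<le> M * \<bar>\<xi>\<bar> ^ (2 * l + 2)"
    using ev unfolding eventually_at a_def by (auto simp: dist_real_def)
  (* Within radius r the remainder is at most half the leading term a * \<xi>^(2l). *)
  define r where "r = min (r0 / 2) (sqrt (a / (2 * M)))"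
  have r: "0 < r" "r < r0" "M * r\<^sup>2 \<le> a / 2"
  proof -
    show "0 < r" "r < r0" using r0(1) a M by (auto simp: r_def)
    have "r\<^sup>2 \<le> (sqrt (a / (2 * M)))\<^sup>2"
      using \<open>0 < r\<close> by (intro power_mono) (auto simp: r_def)
    also have "\<dots> = a / (2 * M)" using a M by simp
    finally show "M * r\<^sup>2 \<le> a / 2" using M by (simp add: field_simps)
  qed
  have near: "a / 2 * \<bar>\<xi>\<bar> ^ (2 * l) \<le> m 0 - m \<xi>" if "\<bar>\<xi>\<bar> \<le> r" "\<xi> \<noteq> 0" for \<xi>
  proof -
    have ev: "\<xi> ^ (2 * l) = \<bar>\<xi>\<bar> ^ (2 * l)" by (simp add: power_even_abs)
    have "M * \<bar>\<xi>\<bar>\<^sup>2 \<le> M * r\<^sup>2" using that(1) M by (intro mult_left_mono power_mono) auto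
    then have "M * \<bar>\<xi>\<bar>\<^sup>2 * \<bar>\<xi>\<bar> ^ (2 * l) \<le> a / 2 * \<bar>\<xi>\<bar> ^ (2 * l)"
      using r(3) by (intro mult_right_mono) auto
    moreover have "\<bar>m \<xi> - (m 0 - a * \<bar>\<xi>\<bar> ^ (2 * l))\<bar> \<le> M * \<bar>\<xi>\<bar>\<^sup>2 * \<bar>\<xi>\<bar> ^ (2 * l)"
      using r0(2)[OF that(2)] that(1) r(2)
      unfolding ev power_add by (simp add: mult.assoc mult.commute[of "\<xi>\<^sup>2"])
    ultimately show ?thesis by linarith
  qed
  have "((\<lambda>x::real. C * x powr \<sigma>) \<longlongrightarrow> C * 0) at_top"
    by (intro tendsto_mult tendsto_const tendsto_neg_powr \<sigma> filterlim_ident)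
  then have "eventually (\<lambda>x::real. C * x powr \<sigma> < m 0 / 2) at_top"
    by (rule order_tendstoD) (use m in auto)
  then obtain T0 where T0: "\<And>x. x \<ge> T0 \<Longrightarrow> C * x powr \<sigma> < m 0 / 2"
    by (auto simp: eventually_at_top_linorder)
  define T where "T = max T0 (max r 1)"
  have far: "m 0 / 2 \<le> m 0 - m \<xi>" if "T \<le> \<bar>\<xi>\<bar>" for \<xi>
  proof -
    have "\<bar>\<xi>\<bar> \<le> bracket \<xi>" by (simp add: bracket_def real_le_rsqrt)
    moreover have "0 < \<bar>\<xi>\<bar>" using that by (auto simp: T_def)
    ultimately have "bracket \<xi> powr \<sigma> \<le> \<bar>\<xi>\<bar> powr \<sigma>" using \<sigma> by (intro powr_mono2') auto
    then have "\<bar>m \<xi>\<bar> \<le> C * \<bar>\<xi>\<bar> powr \<sigma>"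
      using C by (meson mult_left_mono order_trans less_imp_le)
    also have "\<dots> < m 0 / 2" using that by (intro T0) (auto simp: T_def)
    finally show ?thesis by linarith
  qed
  (* Between r and T the symbol is continuous and strictly below its value at 0. *)
  have comp: "compact ({-T..-r} \<union> {r..T})" by (intro compact_Un compact_Icc)
  have "r \<in> {-T..-r} \<union> {r..T}" by (auto simp: T_def)
  moreover have "continuous_on ({-T..-r} \<union> {r..T}) m"
    using continuous_symbol[OF K] by (rule continuous_on_subset) auto
  ultimately obtain \<xi>0 where \<xi>0: "\<xi>0 \<in> {-T..-r} \<union> {r..T}" "\<And>\<xi>. \<xi> \<in> {-T..-r} \<union> {r..T} \<Longrightarrow> m \<xi> \<le> m \<xi>0"
    using continuous_attains_sup[OF comp] by blast
  have pos0: "0 < m 0 - m \<xi>0" using m(2)[of \<xi>0] \<xi>0(1) r(1) by auto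
  define c where "c = min (a / 2) (min (m 0 / 2) (m 0 - m \<xi>0))"
  have c: "0 < c" "c \<le> a / 2" "c \<le> m 0 / 2" "c \<le> m 0 - m \<xi>0"
    using a m(1) pos0 unfolding c_def by linarith+
  have away: "c \<le> m 0 - m \<xi>" if "r \<le> \<bar>\<xi>\<bar>" for \<xi>
  proof (cases "\<bar>\<xi>\<bar> \<le> T")
    case True
    then have "m \<xi> \<le> m \<xi>0" using that by (intro \<xi>0(2)) auto
    then show ?thesis using c by linarith
  next
    case False
    then show ?thesis using far[of \<xi>] c by linarith
  qed
  show ?thesis
  proof (intro exI[of _ c] conjI allI impI)
    show "0 < c" by (rule c)
    fix \<xi> :: real
    show "c * \<bar>\<xi>\<bar> ^ (2 * l) \<le> m 0 - m \<xi>" if 1: "\<bar>\<xi>\<bar> \<le> 1"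
    proof (cases "\<xi> = 0")
      case True
      have "l \<ge> 1" using assms by (simp add: admissible_symbol_def)
      then have "l \<noteq> 0" by simp
      then show ?thesis using True by (simp add: power_0_left)
    next
      case False
      show ?thesis
      proof (cases "\<bar>\<xi>\<bar> \<le> r")
        case True
        have "c * \<bar>\<xi>\<bar> ^ (2 * l) \<le> a / 2 * \<bar>\<xi>\<bar> ^ (2 * l)" using c by (intro mult_right_mono) auto
        then show ?thesis using near[OF True False] by linarith
      next
        case False
        have "c * \<bar>\<xi>\<bar> ^ (2 * l) \<le> c * 1" using 1 c by (intro mult_left_mono power_le_one) auto
        then show ?thesis using away[of \<xi>] False by linarith
      qed
    qed
    show "c \<le> m 0 - m \<xi>" if 1: "1 \<le> \<bar>\<xi>\<bar>"
    proof (cases "\<bar>\<xi>\<bar> \<le> r")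
      case True
      have "c * 1 \<le> a / 2 * \<bar>\<xi>\<bar> ^ (2 * l)" using c a 1 by (intro mult_mono one_le_power) auto
      moreover have "\<xi> \<noteq> 0" using 1 by auto
      ultimately show ?thesis using near[OF True] by linarith
    qed (use away in auto)
  qed
qed

text \<open>Continuity yields \<open>n 0 = 0\<close>, which is needed because the asymptotic condition at 0 does not see the value at 0 itself.\<close>
lemma nonlinearity_bound:
  assumes n: "admissible_nonlinearity n q" and \<zeta>: "0 < \<zeta>" "\<zeta> < 1 + q" "holder_loc \<zeta> n"
  shows "continuous_on UNIV n"
    and "\<exists>c>0. \<exists>\<epsilon>>0. \<forall>x. \<bar>x\<bar> < \<epsilon> \<longrightarrow> \<bar>n x\<bar> \<le> c * \<bar>x\<bar> powr (1 + q)"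
proof -
  have lip: "local_lipschitz (UNIV :: real set) UNIV (\<lambda>_. n)"
    using n by (simp add: admissible_nonlinearity_def)
  show cont: "continuous_on UNIV n"
    using local_lipschitz_continuous_on[OF lip, of 0] by simp
  obtain nq nr where n_eq: "\<And>x. n x = nq x + nr x"
    and nq: "(\<exists>\<gamma>. \<gamma> \<noteq> 0 \<and> (\<forall>x. nq x = \<gamma> * \<bar>x\<bar> powr (1 + q))) \<or>
         (\<exists>\<gamma>>0. \<forall>x. nq x = \<gamma> * x * \<bar>x\<bar> powr q)"
    and nr: "\<And>\<zeta>. 0 < \<zeta> \<and> \<zeta> < 1 + q \<and> holder_loc \<zeta> n \<Longrightarrow>
           (\<forall>j\<le>nat \<lfloor>\<zeta>\<rfloor>. (deriv ^^ j) nr \<in> o[at 0](\<lambda>x. \<bar>x\<bar> powr (1 + q - real j)))"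
    using n unfolding admissible_nonlinearity_def by blast
  have abs_powr: "\<bar>x\<bar> * \<bar>x\<bar> powr q = \<bar>x\<bar> powr (1 + q)" for x :: real
    by (cases "x = 0") (simp_all add: powr_add)
  obtain \<gamma> where \<gamma>: "\<And>x. \<bar>nq x\<bar> = \<bar>\<gamma>\<bar> * \<bar>x\<bar> powr (1 + q)"
    using nq
  proof
    assume "\<exists>\<gamma>. \<gamma> \<noteq> 0 \<and> (\<forall>x. nq x = \<gamma> * \<bar>x\<bar> powr (1 + q))"
    then obtain \<gamma> where "\<And>x. nq x = \<gamma> * \<bar>x\<bar> powr (1 + q)" by blast
    then show ?thesis by (intro that[of \<gamma>]) (simp add: abs_mult)
  next
    assume "\<exists>\<gamma>>0. \<forall>x. nq x = \<gamma> * x * \<bar>x\<bar> powr q"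
    then obtain \<gamma> where "\<And>x. nq x = \<gamma> * x * \<bar>x\<bar> powr q" by blast
    then show ?thesis by (intro that[of \<gamma>]) (simp add: abs_mult mult.assoc abs_powr)
  qed
  have "nr \<in> o[at 0](\<lambda>x. \<bar>x\<bar> powr (1 + q))"
    using nr[of \<zeta>] \<zeta> by auto
  then have "eventually (\<lambda>x. norm (nr x) \<le> 1 * norm (\<bar>x\<bar> powr (1 + q))) (at 0)"
    by (rule landau_o.smallD) simp
  then obtain \<epsilon> where \<epsilon>: "\<epsilon> > 0" "\<And>x. x \<noteq> 0 \<Longrightarrow> \<bar>x\<bar> < \<epsilon> \<Longrightarrow> \<bar>nr x\<bar> \<le> \<bar>x\<bar> powr (1 + q)"
    unfolding eventually_at by (auto simp: dist_real_def)
  define c where "c = \<bar>\<gamma>\<bar> + 1"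
  have bd: "\<bar>n x\<bar> \<le> c * \<bar>x\<bar> powr (1 + q)" if "x \<noteq> 0" "\<bar>x\<bar> < \<epsilon>" for x
    using \<epsilon>(2)[OF that] abs_triangle_ineq[of "nq x" "nr x"] \<gamma>[of x]
    by (simp add: n_eq c_def distrib_right)
  have "n 0 = 0"
  proof -
    have "(n \<longlongrightarrow> n 0) (at 0)" using cont by (simp add: continuous_on_def)
    moreover have "(n \<longlongrightarrow> 0) (at 0)"
    proof (rule Lim_null_comparison)
      show "eventually (\<lambda>x. norm (n x) \<le> c * \<bar>x\<bar> powr (1 + q)) (at 0)"
        unfolding eventually_at using bd \<epsilon>(1) by (auto simp: dist_real_def intro!: exI[of _ \<epsilon>])
      have "((\<lambda>x::real. \<bar>x\<bar> powr (1 + q)) \<longlongrightarrow> \<bar>0\<bar> powr (1 + q)) (at 0)"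
        using \<zeta> by (intro tendsto_powr2 tendsto_intros) (auto simp: always_eventually)
      from tendsto_mult_left[OF this, of c]
      show "((\<lambda>x::real. c * \<bar>x\<bar> powr (1 + q)) \<longlongrightarrow> 0) (at 0)" by simp
    qed
    ultimately show ?thesis using LIM_unique by blast
  qed
  then have "\<forall>x. \<bar>x\<bar> < \<epsilon> \<longrightarrow> \<bar>n x\<bar> \<le> c * \<bar>x\<bar> powr (1 + q)"
    using bd by (metis abs_zero mult_zero_right order_refl powr_0)
  moreover have "c > 0" by (simp add: c_def add_nonneg_pos)
  ultimately show "\<exists>c>0. \<exists>\<epsilon>>0. \<forall>x. \<bar>x\<bar> < \<epsilon> \<longrightarrow> \<bar>n x\<bar> \<le> c * \<bar>x\<bar> powr (1 + q)"
    using \<epsilon>(1) by blast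
qed

section \<open>Estimates in frequency space\<close>

text \<open>A weight in L2 concentrated on frequencies of size at most \<open>\<mu>\<close>, with squared norm proportional to \<open>\<mu>\<close>. By Cauchy--Schwarz,
the product of an L2 function with the weight is in L1, at the cost of a factor proportional to \<open>sqrt \<mu>\<close>, as for
functions with frequencies up to \<open>\<mu>\<close> only.\<close>
definition lorentz_weight :: "real \<Rightarrow> real \<Rightarrow> complex" where
  "lorentz_weight \<mu> \<xi> = of_real (1 / sqrt (1 + (\<xi> / \<mu>)\<^sup>2))"

lemma lorentz_weight_measurable [measurable]: "lorentz_weight \<mu> \<in> borel_measurable borel"
  unfolding lorentz_weight_def[abs_def] by measurable

lemma norm_lorentz_weight: "norm (lorentz_weight \<mu> \<xi>) = 1 / sqrt (1 + (\<xi> / \<mu>)\<^sup>2)"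
  unfolding lorentz_weight_def norm_of_real by simp

lemma energy_lorentz_weight:
  assumes \<mu>: "0 < \<mu>"
  shows "energy (lorentz_weight \<mu>) = ennreal (pi * \<mu>)"
proof -
  have int: "integrable lborel (\<lambda>x::real. inverse (1 + x\<^sup>2))" and pi: "(LINT x|lborel. inverse (1 + x\<^sup>2 :: real)) = pi"
    using integrable_inverse_1_plus_square LBINT_inverse_1_plus_square
    by (simp_all add: set_integrable_def interval_lebesgue_integral_def set_lebesgue_integral_def einterval_def)
  have "energy (lorentz_weight \<mu>) = (\<integral>\<^sup>+\<xi>. ennreal (inverse (1 + (\<xi> / \<mu>)\<^sup>2)) \<partial>lborel)"
    unfolding energy_def norm_lorentz_weight
    by (intro nn_integral_cong) (simp add: power_divide inverse_eq_divide)
  also have "\<dots> = ennreal \<mu> * (\<integral>\<^sup>+x. ennreal (inverse (1 + x\<^sup>2)) \<partial>lborel)"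
    using nn_integral_real_affine[of "\<lambda>\<xi>. ennreal (inverse (1 + (\<xi> / \<mu>)\<^sup>2))" \<mu> 0] \<mu> by simp
  also have "(\<integral>\<^sup>+x. ennreal (inverse (1 + x\<^sup>2)) \<partial>lborel) = ennreal pi"
    using nn_integral_eq_integral[OF int] pi by simp
  finally show ?thesis using \<mu> by (simp add: mult.commute flip: ennreal_mult)
qed

lemma lorentz_weight_L1:
  assumes \<mu>: "0 < \<mu>" and f: "square_integrable f"
  shows "integrable lborel (\<lambda>\<xi>. norm (lorentz_weight \<mu> \<xi>) * norm (f \<xi> :: complex))"
    and "(LINT \<xi>|lborel. norm (lorentz_weight \<mu> \<xi>) * norm (f \<xi>)) \<le> sqrt (pi * \<mu>) * L2_norm f"
proof -
  have [measurable]: "f \<in> borel_measurable borel" using f by (simp add: square_integrable_iff_energy)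
  have w: "square_integrable (lorentz_weight \<mu>)"
    by (simp add: square_integrable_iff_energy energy_lorentz_weight[OF \<mu>])
  from integrable_norm[OF integrable_mult_square_integrable[OF w f]]
  show int: "integrable lborel (\<lambda>\<xi>. norm (lorentz_weight \<mu> \<xi>) * norm (f \<xi>))" by (simp add: norm_mult)
  define I where "I = (LINT \<xi>|lborel. norm (lorentz_weight \<mu> \<xi>) * norm (f \<xi>))"
  have I0: "0 \<le> I" unfolding I_def by simp
  have "(ennreal I)\<^sup>2 = (\<integral>\<^sup>+\<xi>. ennreal (norm (lorentz_weight \<mu> \<xi>)) * ennreal (norm (f \<xi>)) \<partial>lborel)\<^sup>2"
    unfolding I_def by (subst nn_integral_eq_integral[OF int, symmetric]) (auto simp: ennreal_mult)
  also have "\<dots> \<le> energy (lorentz_weight \<mu>) * energy f"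
    unfolding energy_def ennreal_norm_power2 by (rule Cauchy_Schwarz_nn_integral) auto
  also have "\<dots> = ennreal (pi * \<mu> * (L2_norm f)\<^sup>2)"
    using \<mu> by (simp add: energy_lorentz_weight energy_eq_L2_norm[OF f] ennreal_mult)
  finally have "I\<^sup>2 \<le> pi * \<mu> * (L2_norm f)\<^sup>2"
    using I0 \<mu> by (simp add: ennreal_power)
  then have "I \<le> sqrt (pi * \<mu> * (L2_norm f)\<^sup>2)" by (rule real_le_rsqrt)
  also have "\<dots> = sqrt (pi * \<mu>) * L2_norm f"
    by (simp add: real_sqrt_mult L2_norm_def)
  finally show "I \<le> sqrt (pi * \<mu>) * L2_norm f" .
qed

text \<open>Three regions of frequency. Up to \<open>\<mu>\<close> the weight is bounded below, and \<open>v\<close> is kept. Between \<open>\<mu>\<close> and 1 the equation is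
elliptic with \<open>\<nu> - m \<xi> \<ge> c / 2 * \<bar>\<xi>\<bar>^(2l)\<close>, and \<open>(\<bar>\<xi>\<bar> / \<mu>)^(2l)\<close> dominates the inverse of the weight up to the factor 2. Beyond 1
one has \<open>\<nu> - m \<xi> \<ge> c / 2\<close>, and the \<open>N\<close>-th power of the symbol supplies the decay.\<close>
lemma spectral_pointwise_bound:
  fixes v g :: complex
  assumes eq: "of_real (\<nu> - mx) * v = g" and c: "0 < c" and \<mu>: "0 < \<mu>" and l: "1 \<le> l"
    and near: "\<bar>\<xi>\<bar> \<le> 1 \<Longrightarrow> c * \<bar>\<xi>\<bar> ^ (2 * l) \<le> m0 - mx" and far: "1 \<le> \<bar>\<xi>\<bar> \<Longrightarrow> c \<le> m0 - mx"
    and \<nu>: "- (c / 2) * \<mu> ^ (2 * l) \<le> \<nu> - m0" "- (c / 2) \<le> \<nu> - m0"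
    and D: "0 \<le> D" "\<bar>mx\<bar> ^ N \<le> D / bracket \<xi>"
  shows "\<bar>mx\<bar> ^ N * norm v \<le> D * (2 * (norm (lorentz_weight \<mu> \<xi>) * norm v)
      + 4 / c / \<mu> ^ (2 * l) * (norm (lorentz_weight \<mu> \<xi>) * norm g)
      + 2 / c * (norm (lorentz_weight 1 \<xi>) * norm g))"
proof -
  have g: "norm g = \<bar>\<nu> - mx\<bar> * norm v" unfolding eq[symmetric] norm_mult norm_of_real ..
  have w1: "norm (lorentz_weight 1 \<xi>) = 1 / bracket \<xi>" by (simp add: norm_lorentz_weight bracket_def)
  have br: "1 \<le> bracket \<xi>" by (simp add: bracket_def)
  define w where "w = norm (lorentz_weight \<mu> \<xi>)"
  define t where "t = \<bar>\<xi>\<bar> / \<mu>"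
  have t0: "0 \<le> t" using \<mu> by (simp add: t_def)
  have w: "w = 1 / sqrt (1 + t\<^sup>2)" by (simp add: w_def norm_lorentz_weight t_def power_divide)
  have w0: "0 < w" unfolding w by (simp add: add_pos_nonneg)
  have ws: "w * sqrt (1 + t\<^sup>2) = 1"
  proof -
    have "0 < sqrt (1 + t\<^sup>2)" by (simp add: add_pos_nonneg)
    then show ?thesis unfolding w by simp
  qed
  have nn: "0 \<le> 2 * (w * norm v)" "0 \<le> 4 / c / \<mu> ^ (2 * l) * (w * norm g)" "0 \<le> 2 / c * (1 / bracket \<xi> * norm g)"
    using w0 c \<mu> br by auto
  show ?thesis
  proof (cases "\<bar>\<xi>\<bar> \<le> 1")
    case True
    have "D / bracket \<xi> \<le> D" using D(1) br by (simp add: divide_le_eq mult_le_cancel_left1)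
    then have mD: "\<bar>mx\<bar> ^ N \<le> D" using D(2) by linarith
    have "norm v \<le> 2 * (w * norm v) + 4 / c / \<mu> ^ (2 * l) * (w * norm g)"
    proof (cases "t \<le> 1")
      case True
      have "t\<^sup>2 \<le> 1\<^sup>2" using True t0 by (intro power_mono) auto
      then have "sqrt (1 + t\<^sup>2) \<le> sqrt (2\<^sup>2)" by (intro real_sqrt_le_mono) simp
      then have "sqrt (1 + t\<^sup>2) \<le> 2" by simp
      then have "w * sqrt (1 + t\<^sup>2) \<le> w * 2" using w0 by (intro mult_left_mono) auto
      then have "1 * norm v \<le> (w * 2) * norm v" unfolding ws by (intro mult_right_mono) auto
      then show ?thesis using nn by simp
    next
      case False
      then have "\<mu> \<le> \<bar>\<xi>\<bar>" using \<mu> by (simp add: t_def field_simps)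
      then have "\<mu> ^ (2 * l) \<le> \<bar>\<xi>\<bar> ^ (2 * l)" using \<mu> by (intro power_mono) auto
      then have "c / 2 * \<mu> ^ (2 * l) \<le> c / 2 * \<bar>\<xi>\<bar> ^ (2 * l)" using c by (intro mult_left_mono) auto
      then have "c / 2 * \<bar>\<xi>\<bar> ^ (2 * l) \<le> \<bar>\<nu> - mx\<bar>" using near[OF True] \<nu>(1) by linarith
      then have "c / 2 * \<bar>\<xi>\<bar> ^ (2 * l) * norm v \<le> norm g"
        unfolding g by (intro mult_right_mono) auto
      moreover have "\<bar>\<xi>\<bar> ^ (2 * l) = t ^ (2 * l) * \<mu> ^ (2 * l)"
        using \<mu> by (simp add: t_def power_divide)
      ultimately have 1: "2 * t ^ (2 * l) * norm v \<le> 4 / c / \<mu> ^ (2 * l) * norm g"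
        using c \<mu> by (simp add: field_simps)
      have "1 \<le> t\<^sup>2" using False by (intro one_le_power) auto
      then have "1 + t\<^sup>2 \<le> (2 * t)\<^sup>2" by (simp add: power_mult_distrib)
      then have "sqrt (1 + t\<^sup>2) \<le> 2 * t" using t0 by (intro real_le_lsqrt) auto
      also have "t \<le> t ^ (2 * l)" using False l self_le_power[of t "2 * l"] by simp
      finally have "sqrt (1 + t\<^sup>2) * norm v \<le> 2 * t ^ (2 * l) * norm v"
        by (intro mult_right_mono) auto
      with 1 have "sqrt (1 + t\<^sup>2) * norm v \<le> 4 / c / \<mu> ^ (2 * l) * norm g" by linarith
      then have "w * (sqrt (1 + t\<^sup>2) * norm v) \<le> w * (4 / c / \<mu> ^ (2 * l) * norm g)"
        using w0 by (intro mult_left_mono) auto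
      then have "norm v \<le> 4 / c / \<mu> ^ (2 * l) * (w * norm g)"
        unfolding mult.assoc[symmetric] ws by (simp add: mult.commute mult.left_commute)
      then show ?thesis using nn by linarith
    qed
    then have "norm v \<le> 2 * (w * norm v) + 4 / c / \<mu> ^ (2 * l) * (w * norm g) + 2 / c * (1 / bracket \<xi> * norm g)"
      using nn by linarith
    then show ?thesis
      unfolding w_def[symmetric] w1 using mD D(1) by (intro mult_mono) auto
  next
    case False
    then have "c / 2 \<le> \<bar>\<nu> - mx\<bar>" using far \<nu>(2) by linarith
    then have "c / 2 * norm v \<le> norm g" unfolding g by (intro mult_right_mono) auto
    then have v: "norm v \<le> 2 / c * norm g" using c by (simp add: field_simps)
    have "\<bar>mx\<bar> ^ N * norm v \<le> D / bracket \<xi> * (2 / c * norm g)"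
      using D br v by (intro mult_mono) auto
    also have "\<dots> = D * (2 / c * (1 / bracket \<xi> * norm g))" by simp
    also have "\<dots> \<le> D * (2 * (w * norm v) + 4 / c / \<mu> ^ (2 * l) * (w * norm g) + 2 / c * (1 / bracket \<xi> * norm g))"
      using nn D(1) by (intro mult_left_mono) auto
    finally show ?thesis unfolding w_def w1 .
  qed
qed

lemma spectral_integral_bound:
  fixes v g :: "real \<Rightarrow> complex"
  assumes sq: "square_integrable v" "square_integrable g" and [measurable]: "m \<in> borel_measurable borel"
    and eq: "AE \<xi> in lborel. of_real (\<nu> - m \<xi>) * v \<xi> = g \<xi>" and c: "0 < c" and \<mu>: "0 < \<mu>" and l: "1 \<le> l"
    and near: "\<And>\<xi>. \<bar>\<xi>\<bar> \<le> 1 \<Longrightarrow> c * \<bar>\<xi>\<bar> ^ (2 * l) \<le> m 0 - m \<xi>"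
    and far: "\<And>\<xi>. 1 \<le> \<bar>\<xi>\<bar> \<Longrightarrow> c \<le> m 0 - m \<xi>"
    and \<nu>: "- (c / 2) * \<mu> ^ (2 * l) \<le> \<nu> - m 0" "- (c / 2) \<le> \<nu> - m 0"
    and D: "0 \<le> D" "\<And>\<xi>. \<bar>m \<xi>\<bar> ^ N \<le> D / bracket \<xi>"
  shows "integrable lborel (\<lambda>\<xi>. of_real (m \<xi>) ^ N * v \<xi>)"
    and "(LINT \<xi>|lborel. norm (of_real (m \<xi>) ^ N * v \<xi>)) \<le> D * (2 * (sqrt (pi * \<mu>) * L2_norm v)
      + 4 / c / \<mu> ^ (2 * l) * (sqrt (pi * \<mu>) * L2_norm g) + 2 / c * (sqrt (pi * 1) * L2_norm g))"
proof -
  have [measurable]: "v \<in> borel_measurable borel" "g \<in> borel_measurable borel"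
    using sq by (auto simp: square_integrable_iff_energy)
  define R where "R \<xi> = D * (2 * (norm (lorentz_weight \<mu> \<xi>) * norm (v \<xi>))
      + 4 / c / \<mu> ^ (2 * l) * (norm (lorentz_weight \<mu> \<xi>) * norm (g \<xi>))
      + 2 / c * (norm (lorentz_weight 1 \<xi>) * norm (g \<xi>)))" for \<xi>
  note 1 = lorentz_weight_L1[OF \<mu> sq(1)] lorentz_weight_L1[OF \<mu> sq(2)] lorentz_weight_L1[OF zero_less_one sq(2)]
  have R_int: "integrable lborel R"
    unfolding R_def by (intro integrable_mult_right Bochner_Integration.integrable_add 1)
  have le: "AE \<xi> in lborel. norm (of_real (m \<xi>) ^ N * v \<xi>) \<le> R \<xi>"
    using eq
  proof eventually_elim
    fix \<xi> assume e: "of_real (\<nu> - m \<xi>) * v \<xi> = g \<xi>"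
    show "norm (of_real (m \<xi>) ^ N * v \<xi>) \<le> R \<xi>"
      using spectral_pointwise_bound[OF e c \<mu> l near far \<nu> D]
      by (simp add: R_def norm_mult norm_power)
  qed
  show int: "integrable lborel (\<lambda>\<xi>. of_real (m \<xi>) ^ N * v \<xi>)"
    by (rule Bochner_Integration.integrable_bound[OF R_int])
       (use le in \<open>auto elim!: eventually_mono intro: order_trans[OF _ abs_ge_self]\<close>)
  have "(LINT \<xi>|lborel. norm (of_real (m \<xi>) ^ N * v \<xi>)) \<le> (LINT \<xi>|lborel. R \<xi>)"
    by (rule integral_mono_AE[OF integrable_norm[OF int] R_int le])
  also have "\<dots> = D * (2 * (LINT \<xi>|lborel. norm (lorentz_weight \<mu> \<xi>) * norm (v \<xi>))
      + 4 / c / \<mu> ^ (2 * l) * (LINT \<xi>|lborel. norm (lorentz_weight \<mu> \<xi>) * norm (g \<xi>))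
      + 2 / c * (LINT \<xi>|lborel. norm (lorentz_weight 1 \<xi>) * norm (g \<xi>)))"
    unfolding R_def using 1 by (simp add: Bochner_Integration.integral_add)
  also have "\<dots> \<le> D * (2 * (sqrt (pi * \<mu>) * L2_norm v)
      + 4 / c / \<mu> ^ (2 * l) * (sqrt (pi * \<mu>) * L2_norm g) + 2 / c * (sqrt (pi * 1) * L2_norm g))"
    using c \<mu> D(1) 1 by (intro mult_left_mono add_mono) auto
  finally show "(LINT \<xi>|lborel. norm (of_real (m \<xi>) ^ N * v \<xi>)) \<le> D * (2 * (sqrt (pi * \<mu>) * L2_norm v)
      + 4 / c / \<mu> ^ (2 * l) * (sqrt (pi * \<mu>) * L2_norm g) + 2 / c * (sqrt (pi * 1) * L2_norm g))" .
qed

section \<open>Nonexistence of small solutions\<close>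

lemma Linf_AE:
  assumes "u \<in> Linf"
  shows "AE x in lborel. \<bar>u x\<bar> \<le> Linf_norm u"
proof -
  have [measurable]: "u \<in> borel_measurable borel" and fin: "esssup lborel (\<lambda>x. ereal \<bar>u x\<bar>) < \<infinity>"
    using assms by (auto simp: Linf_def)
  have AE: "AE x in lborel. ereal \<bar>u x\<bar> \<le> esssup lborel (\<lambda>x. ereal \<bar>u x\<bar>)" by (rule esssup_AE)
  have "0 \<le> esssup lborel (\<lambda>x. ereal \<bar>u x\<bar>)"
  proof -
    have "esssup lborel (\<lambda>x::real. 0::ereal) \<le> esssup lborel (\<lambda>x. ereal \<bar>u x\<bar>)"
      by (rule esssup_mono) auto
    then show ?thesis by (subst (asm) esssup_const) auto
  qed
  with fin have "esssup lborel (\<lambda>x. ereal \<bar>u x\<bar>) = ereal (Linf_norm u)"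
    unfolding Linf_norm_def by (cases "esssup lborel (\<lambda>x. ereal \<bar>u x\<bar>)") auto
  with AE show ?thesis by simp
qed

lemma Linf_norm_le:
  assumes [measurable]: "u \<in> borel_measurable borel" and AE: "AE x in lborel. \<bar>u x\<bar> \<le> B"
  shows "Linf_norm u \<le> B"
proof -
  have "esssup lborel (\<lambda>x. ereal \<bar>u x\<bar>) \<le> ereal B"
    using AE by (intro esssup_I) auto
  moreover have "0 \<le> esssup lborel (\<lambda>x. ereal \<bar>u x\<bar>)"
  proof -
    have "esssup lborel (\<lambda>x::real. 0::ereal) \<le> esssup lborel (\<lambda>x. ereal \<bar>u x\<bar>)"
      by (rule esssup_mono) auto
    then show ?thesis by (subst (asm) esssup_const) auto
  qed
  ultimately show ?thesis
    unfolding Linf_norm_def by (cases "esssup lborel (\<lambda>x. ereal \<bar>u x\<bar>)") auto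
qed

text \<open>Here \<open>a j\<close> stands for the modulus at a point of the \<open>j\<close>-fold iterate of \<open>L\<close> applied to \<open>u\<close>. Solving the inequalities successively for
\<open>a (N - 1), \<dots>, a 0\<close> bounds \<open>u\<close> by an iterate of arbitrarily high order, at the cost of a constant that does not depend on \<open>u\<close>.\<close>
lemma iterated_bound:
  assumes \<nu>0: "0 < (\<nu>0::real)" and \<kappa>: "0 \<le> \<kappa>"
  shows "\<exists>A>0. \<forall>a S B. (\<forall>j. \<nu>0 * a j \<le> a (Suc j) + \<kappa> ^ j * S) \<and> a N \<le> B \<and> 0 \<le> S \<and> 0 \<le> B
    \<longrightarrow> a 0 \<le> A * (B + S)"
proof (induction N)
  case 0
  show ?case by (intro exI[of _ 1]) auto
next
  case (Suc N)
  then obtain A where A: "A > 0" "\<And>a S B. (\<And>j. \<nu>0 * a j \<le> a (Suc j) + \<kappa> ^ j * S) \<Longrightarrow> a N \<le> B \<Longrightarrow>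
      0 \<le> S \<Longrightarrow> 0 \<le> B \<Longrightarrow> a 0 \<le> A * (B + S)" by blast
  define t where "t = 1 / \<nu>0 + \<kappa> ^ N / \<nu>0 + 1"
  have t: "t > 0" using \<nu>0 \<kappa> by (auto simp: t_def intro!: add_nonneg_pos)
  show ?case
  proof (intro exI[of _ "A * t"] conjI allI impI)
    show "0 < A * t" using A(1) t by simp
    fix a :: "nat \<Rightarrow> real" and S B
    assume *: "(\<forall>j. \<nu>0 * a j \<le> a (Suc j) + \<kappa> ^ j * S) \<and> a (Suc N) \<le> B \<and> 0 \<le> S \<and> 0 \<le> B"
    have "\<nu>0 * a N \<le> B + \<kappa> ^ N * S" using * by (meson add_right_mono order_trans)
    then have "a N \<le> (B + \<kappa> ^ N * S) / \<nu>0" using \<nu>0 by (simp add: field_simps)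
    then have "a 0 \<le> A * ((B + \<kappa> ^ N * S) / \<nu>0 + S)"
      using * \<nu>0 \<kappa> by (intro A(2)) auto
    also have "(B + \<kappa> ^ N * S) / \<nu>0 + S \<le> t * (B + S)"
    proof -
      have "t * (B + S) = (B + \<kappa> ^ N * S) / \<nu>0 + S + (S / \<nu>0 + \<kappa> ^ N * B / \<nu>0 + B)"
        using \<nu>0 by (simp add: t_def field_simps)
      moreover have "0 \<le> S / \<nu>0 + \<kappa> ^ N * B / \<nu>0 + B" using * \<nu>0 \<kappa> by auto
      ultimately show ?thesis by linarith
    qed
    finally show "a 0 \<le> A * t * (B + S)" using A(1) by (simp add: mult.assoc)
  qed
qed

text \<open>The supremum \<open>U\<close> of \<open>\<bar>u\<bar>\<close> is at most \<open>A * (B + S)\<close>, where \<open>S\<close> bounds \<open>n u\<close> and \<open>B\<close> is the L1 norm of the transform of an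
iterate of \<open>L\<close> applied to \<open>u\<close>. Both are at most a constant times \<open>\<delta> * U\<close>, which forces \<open>U = 0\<close> for small \<open>\<delta>\<close>.
The Sobolev norm enters through \<open>L2_norm v \<le> sobolev_norm s u\<close>.\<close>
lemma no_small_solutions:
  fixes m n :: "real \<Rightarrow> real"
  assumes m: "admissible_symbol m \<sigma> l" and n: "admissible_nonlinearity n q"
    and \<zeta>: "0 < \<zeta>" "\<zeta> < 1 + q" "holder_loc \<zeta> n" and s: "0 \<le> s" and q: "q \<ge> 4 * real l" and C: "0 < C"
  shows "\<exists>\<delta>>0. \<forall>u \<nu>. u \<in> sobolev s \<inter> Linf \<and> solves_steady m n \<nu> u \<and>
           \<nu> - m 0 \<ge> - C * Linf_norm u powr q \<and>
           sobolev_norm s u < \<delta> \<and> Linf_norm u < \<delta>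
           \<longrightarrow> (AE x in lborel. u x = 0)"
proof -
  obtain D0 K where D0: "D0 > 0" "\<And>\<xi>. \<bar>m \<xi>\<bar> \<le> D0 * bracket \<xi> powr \<sigma>"
    and K: "integrable lborel K" and mK: "\<And>\<xi>. fourier_L1 (\<lambda>x. of_real (K x)) \<xi> = of_real (m \<xi>)"
    and m0: "m 0 > 0" and \<sigma>: "\<sigma> < 0" and l: "1 \<le> l"
    using m unfolding admissible_symbol_def by blast
  have m_meas: "m \<in> borel_measurable borel"
    by (rule borel_measurable_continuous_onI[OF continuous_symbol[OF K mK]])
  obtain c where c: "c > 0" and near: "\<And>\<xi>. \<bar>\<xi>\<bar> \<le> 1 \<Longrightarrow> c * \<bar>\<xi>\<bar> ^ (2 * l) \<le> m 0 - m \<xi>"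
    and far: "\<And>\<xi>. 1 \<le> \<bar>\<xi>\<bar> \<Longrightarrow> c \<le> m 0 - m \<xi>"
    using symbol_coercive[OF m] by blast
  obtain cn \<epsilon> where cn: "cn > 0" "\<epsilon> > 0" and n_le: "\<And>x. \<bar>x\<bar> < \<epsilon> \<Longrightarrow> \<bar>n x\<bar> \<le> cn * \<bar>x\<bar> powr (1 + q)"
    using nonlinearity_bound(2)[OF n \<zeta>] by blast
  have n_meas[measurable]: "n \<in> borel_measurable borel"
    by (rule borel_measurable_continuous_onI[OF nonlinearity_bound(1)[OF n \<zeta>]])
  define \<kappa> where "\<kappa> = (1 / sqrt (2 * pi)) * (LINT x|lborel. \<bar>K x\<bar>)"
  have \<kappa>: "0 \<le> \<kappa>" unfolding \<kappa>_def by simp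
  (* So many iterations that m^N decays like 1 / bracket, which is square integrable. *)
  obtain N :: nat where "1 / (- \<sigma>) \<le> real N" using real_arch_simple by blast
  then have N: "\<sigma> * real N \<le> -1" using \<sigma> by (simp add: field_simps)
  define D where "D = D0 ^ N"
  have D: "0 < D" using D0(1) by (simp add: D_def)
  have mN: "\<bar>m \<xi>\<bar> ^ N \<le> D / bracket \<xi>" for \<xi>
  proof -
    have br: "1 \<le> bracket \<xi>" by (simp add: bracket_def)
    have "\<bar>m \<xi>\<bar> ^ N \<le> (D0 * bracket \<xi> powr \<sigma>) ^ N" by (intro power_mono D0(2)) auto
    also have "\<dots> = D * bracket \<xi> powr (\<sigma> * real N)"
      using br by (simp add: D_def power_mult_distrib powr_powr flip: powr_realpow)
    also have "\<dots> \<le> D * bracket \<xi> powr (-1)"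
      using N br D by (intro mult_left_mono powr_mono) auto
    finally show ?thesis using br by (simp add: powr_minus_divide)
  qed
  obtain A where A: "A > 0" and iter: "\<And>a S B. (\<And>j. m 0 / 2 * a j \<le> a (Suc j) + \<kappa> ^ j * S) \<Longrightarrow> a N \<le> B
      \<Longrightarrow> 0 \<le> S \<Longrightarrow> 0 \<le> B \<Longrightarrow> a 0 \<le> A * (B + S)"
    using iterated_bound[of "m 0 / 2" \<kappa> N] m0 \<kappa> by auto
  (* E * U bounds sqrt \<mu> for the threshold \<mu> below, Q * \<delta> * U bounds the L1 norm of
     m^N v. In \<delta>, the entries with C keep \<nu> - m 0 above -c/2 and \<nu> above m 0 / 2, and the last entry makes the final factor of U at most 1/2. *)
  define E where "E = (2 * C / c) powr (1 / (4 * real l))"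
  define Q where "Q = D * (2 * (sqrt pi * E) + 2 * cn / C * (sqrt pi * E) + 2 / c * (sqrt pi * cn))"
  have E: "0 < E" using C c by (simp add: E_def)
  have Q: "0 < Q" unfolding Q_def using D E C c cn by (intro mult_pos_pos add_pos_pos) auto
  define \<delta> where "\<delta> = Min {1, \<epsilon>, c / (2 * C), m 0 / (2 * C), 1 / (2 * (A * (Q + cn)))}"
  have \<delta>_le: "\<delta> \<le> 1" "\<delta> \<le> \<epsilon>" "\<delta> \<le> c / (2 * C)" "\<delta> \<le> m 0 / (2 * C)" "\<delta> \<le> 1 / (2 * (A * (Q + cn)))"
    unfolding \<delta>_def by (rule Min_le; simp)+
  have \<delta>: "0 < \<delta>" unfolding \<delta>_def using cn c C m0 A Q by (subst Min_gr_iff) auto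
  have "AE x in lborel. u x = 0"
    if u: "u \<in> sobolev s" "u \<in> Linf" and sol: "solves_steady m n \<nu> u"
      and \<nu>: "\<nu> - m 0 \<ge> - C * Linf_norm u powr q"
      and small: "sobolev_norm s u < \<delta>" "Linf_norm u < \<delta>" for u \<nu>
  proof (rule ccontr)
    assume nonzero: "\<not> (AE x in lborel. u x = 0)"
    define U where "U = Linf_norm u"
    have uU: "AE x in lborel. \<bar>u x\<bar> \<le> U" unfolding U_def by (rule Linf_AE[OF u(2)])
    have [measurable]: "u \<in> borel_measurable borel" using u(2) by (simp add: Linf_def)
    have U: "0 < U"
    proof (rule ccontr)
      assume "\<not> 0 < U"
      with uU have "AE x in lborel. u x = 0" by (auto elim!: eventually_mono)
      with nonzero show False by simp
    qed
    have U1: "U < \<delta>" "U \<le> 1" using small(2) \<delta>_le(1) by (auto simp: U_def)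
    have Uq: "U powr q \<le> U"
      using powr_mono'[of 1 q U] U U1 q l by simp
    have Uq0: "0 < U powr q" using U by simp

    define f where "f x = complex_of_real (u x)" for x
    define h where "h x = complex_of_real (n (u x))" for x
    define v where "v = fourier_L2 f"
    define g where "g = fourier_L2 h"
    define S where "S = cn * U powr q * U"
    have S: "0 \<le> S" using cn U by (simp add: S_def)
    have [measurable]: "f \<in> borel_measurable borel" "h \<in> borel_measurable borel"
      unfolding f_def[abs_def] h_def[abs_def] by measurable
    have f: "square_integrable f"
      using u(1) by (simp add: sobolev_def square_integrable_def f_def)
    have h_le: "AE x in lborel. norm (h x) \<le> norm (of_real (cn * U powr q) * f x) \<and> norm (h x) \<le> S"
      using uU
    proof eventually_elim
      fix x assume x: "\<bar>u x\<bar> \<le> U"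
      have "\<bar>u x\<bar> powr (1 + q) = \<bar>u x\<bar> powr q * \<bar>u x\<bar>"
        by (cases "u x = 0") (simp_all add: powr_add)
      moreover have "\<bar>u x\<bar> powr q \<le> U powr q" using x q by (intro powr_mono2) auto
      ultimately have "\<bar>u x\<bar> powr (1 + q) \<le> U powr q * \<bar>u x\<bar>" by (simp add: mult_right_mono)
      then have 1: "\<bar>n (u x)\<bar> \<le> cn * (U powr q * \<bar>u x\<bar>)"
        using n_le[of "u x"] x U1(1) \<delta>_le(2) cn(1) by (meson le_less_trans less_le_trans mult_left_mono order_trans less_imp_le)
      also have "\<dots> \<le> S" unfolding S_def using x cn by (simp add: mult.assoc mult_left_mono)
      finally show "norm (h x) \<le> norm (of_real (cn * U powr q) * f x) \<and> norm (h x) \<le> S"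
        using 1 cn by (simp add: h_def f_def norm_mult abs_mult mult.assoc)
    qed
    have h_energy: "energy h \<le> ennreal ((cn * U powr q)\<^sup>2) * energy f"
    proof -
      have "energy h \<le> energy (\<lambda>x. of_real (cn * U powr q) * f x)"
        using h_le by (intro energy_mono_AE) (auto elim: eventually_mono)
      also have "\<dots> = ennreal ((norm (complex_of_real (cn * U powr q)))\<^sup>2) * energy f"
        by (rule energy_cmult) measurable
      also have "(norm (complex_of_real (cn * U powr q)))\<^sup>2 = (cn * U powr q)\<^sup>2"
        unfolding norm_of_real by simp
      finally show ?thesis .
    qed
    have h: "square_integrable h"
    proof -
      have "ennreal ((cn * U powr q)\<^sup>2) * energy f < \<infinity>"
        using f by (simp add: square_integrable_iff_energy ennreal_mult_less_top)
      with h_energy show ?thesis by (auto simp: square_integrable_iff_energy intro: le_less_trans)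
    qed
    have fv: "has_fourier_L2 f v" and hg: "has_fourier_L2 h g"
      unfolding v_def g_def by (intro has_fourier_L2_fourier_L2 f h)+
    note v = has_fourier_L2D(2)[OF fv] and g = has_fourier_L2D(2)[OF hg]
    have v_small: "L2_norm v \<le> \<delta>"
    proof -
      have sw: "square_integrable (sobolev_weighted s u)" using u(1) by (simp add: sobolev_def)
      have "norm (v \<xi>) \<le> norm (sobolev_weighted s u \<xi>)" for \<xi>
      proof -
        have "1 \<le> bracket \<xi> powr s" using s by (intro ge_one_powr_ge_zero) (auto simp: bracket_def)
        then have "1 * norm (v \<xi>) \<le> bracket \<xi> powr s * norm (v \<xi>)" by (intro mult_right_mono) auto
        then show ?thesis by (simp add: sobolev_weighted_def v_def f_def[abs_def])
      qed
      then have "L2_norm v \<le> 1 * L2_norm (sobolev_weighted s u)"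
        using v sw by (intro L2_norm_mono) (auto intro: energy_mono_AE)
      then show ?thesis using small(1) by (simp add: sobolev_norm_def)
    qed
    have g_small: "L2_norm g \<le> cn * U powr q * \<delta>"
    proof -
      have "energy g \<le> energy h" by (rule energy_fourier_L2_le[OF hg])
      also note h_energy
      also have "ennreal ((cn * U powr q)\<^sup>2) * energy f \<le> ennreal ((cn * U powr q)\<^sup>2) * energy v"
        by (intro mult_left_mono energy_le_fourier_L2[OF fv]) auto
      finally have "L2_norm g \<le> (cn * U powr q) * L2_norm v"
        using v g cn by (intro L2_norm_mono) auto
      also have "\<dots> \<le> (cn * U powr q) * \<delta>" using v_small cn by (intro mult_left_mono) auto
      finally show ?thesis .
    qed
    have eq: "AE \<xi> in lborel. of_real (\<nu> - m \<xi>) * v \<xi> = g \<xi>"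
      using fv hg unfolding f_def[abs_def] h_def[abs_def]
      by (rule solves_steady_fourier[OF K mK _ _ sol])

    (* The threshold \<mu> solves c/2 * \<mu>^(2l) = C * U^q: beyond it the coercivity of m 0 - m beats
       the possible subcriticality of the speed. *)
    define X where "X = 2 * C / c * U powr q"
    define \<mu> where "\<mu> = X powr (1 / (2 * real l))"
    have X: "0 < X" using C c Uq0 by (simp add: X_def)
    have \<mu>: "0 < \<mu>" using X by (simp add: \<mu>_def)
    have \<mu>_pow: "\<mu> ^ (2 * l) = X"
      using X l \<mu> by (simp add: \<mu>_def powr_powr flip: powr_realpow)
    have \<mu>_sqrt: "sqrt \<mu> \<le> E * U"
    proof -
      have "sqrt \<mu> = \<mu> powr (1 / 2)" using \<mu> by (simp add: powr_half_sqrt)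
      also have "\<dots> = X powr (1 / (4 * real l))" by (simp add: \<mu>_def powr_powr)
      also have "\<dots> = E * U powr (q / (4 * real l))"
        unfolding X_def E_def using C c by (subst powr_mult) (auto simp: powr_powr)
      (* This is where q \<ge> 4 l is decisive: the exponent of U is at least 1. *)
      also have "U powr (q / (4 * real l)) \<le> U powr 1"
        using q l U U1 by (intro powr_mono') auto
      finally show ?thesis using U E by simp
    qed
    have CU: "C * U powr q \<le> C * \<delta>" using Uq U1 C by (intro mult_left_mono) auto
    have "C * \<delta> \<le> c / 2" "C * \<delta> \<le> m 0 / 2" using \<delta>_le(3,4) C by (simp_all add: field_simps)
    then have \<nu>1: "- (c / 2) \<le> \<nu> - m 0" and \<nu>2: "m 0 / 2 \<le> \<nu>"
      using \<nu> CU unfolding U_def[symmetric] by linarith+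
    have \<nu>3: "- (c / 2) * \<mu> ^ (2 * l) \<le> \<nu> - m 0"
      using \<nu> c unfolding \<mu>_pow X_def U_def[symmetric] by simp

    note spec = spectral_integral_bound[OF v g m_meas eq c \<mu> l near far \<nu>3 \<nu>1 less_imp_le[OF D] mN]
    define B where "B = (LINT \<xi>|lborel. norm (of_real (m \<xi>) ^ N * v \<xi>))"
    have B0: "0 \<le> B" unfolding B_def by simp
    have B: "B \<le> Q * (\<delta> * U)"
    proof -
      have 1: "sqrt (pi * \<mu>) * L2_norm v \<le> (sqrt pi * (E * U)) * \<delta>"
        using \<mu>_sqrt v_small L2_norm_nonneg E U \<mu> unfolding real_sqrt_mult by (intro mult_mono) auto
      have 2: "4 / c / \<mu> ^ (2 * l) * (sqrt (pi * \<mu>) * L2_norm g) \<le> 2 * cn / C * (sqrt pi * (E * U) * \<delta>)"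
      proof -
        have "sqrt (pi * \<mu>) * L2_norm g \<le> (sqrt pi * (E * U)) * (cn * U powr q * \<delta>)"
          using \<mu>_sqrt g_small L2_norm_nonneg E U \<mu> unfolding real_sqrt_mult by (intro mult_mono) auto
        then have "4 / c / X * (sqrt (pi * \<mu>) * L2_norm g)
            \<le> 4 / c / X * ((sqrt pi * (E * U)) * (cn * U powr q * \<delta>))"
          using c X by (intro mult_left_mono) auto
        also have "\<dots> = 2 * cn / C * (sqrt pi * (E * U) * \<delta>)"
          using c C Uq0 by (simp add: X_def field_simps)
        finally show ?thesis unfolding \<mu>_pow .
      qed
      have 3: "2 / c * (sqrt (pi * 1) * L2_norm g) \<le> 2 / c * (sqrt pi * (cn * U * \<delta>))"
      proof -
        have "L2_norm g \<le> cn * U * \<delta>"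
          using g_small Uq cn \<delta> by (meson mult_left_mono mult_right_mono less_imp_le order_trans)
        then show ?thesis using c by (intro mult_left_mono) auto
      qed
      have "B \<le> D * (2 * (sqrt (pi * \<mu>) * L2_norm v)
          + 4 / c / \<mu> ^ (2 * l) * (sqrt (pi * \<mu>) * L2_norm g) + 2 / c * (sqrt (pi * 1) * L2_norm g))"
        unfolding B_def by (rule spec(2))
      also have "\<dots> \<le> D * (2 * ((sqrt pi * (E * U)) * \<delta>) + 2 * cn / C * (sqrt pi * (E * U) * \<delta>)
          + 2 / c * (sqrt pi * (cn * U * \<delta>)))"
        by (rule mult_left_mono[OF add_mono[OF add_mono[OF mult_left_mono[OF 1] 2] 3]]) (use D in auto)
      also have "\<dots> = Q * (\<delta> * U)" by (simp add: Q_def algebra_simps)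
      finally show ?thesis .
    qed
    have spec_int: "integrable lborel (\<lambda>\<xi>. of_real (m \<xi>) ^ N * v \<xi>)" by (rule spec(1))
    have fN: "AE x in lborel. norm ((kernel_op K ^^ N) f x) \<le> B"
      using AE_norm_le_integral_fourier_L2[OF has_fourier_L2_kernel_op_power[OF K mK fv] spec_int]
    proof eventually_elim
      fix x assume "norm ((kernel_op K ^^ N) f x)
        \<le> 1 / sqrt (2 * pi) * (LINT \<xi>|lborel. norm (of_real (m \<xi>) ^ N * v \<xi>))"
      also have "\<dots> \<le> 1 * B"
        unfolding B_def
      proof (rule mult_right_mono)
        have "1 \<le> 2 * pi" using pi_ge_two by linarith
        then have "1 \<le> sqrt (2 * pi)" using real_sqrt_le_mono[of 1 "2 * pi"] by simp
        then show "1 / sqrt (2 * pi) \<le> 1" by simp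
      qed simp
      finally show "norm ((kernel_op K ^^ N) f x) \<le> B" by simp
    qed
    have step: "AE x in lborel. \<forall>j. m 0 / 2 * norm ((kernel_op K ^^ j) f x)
        \<le> norm ((kernel_op K ^^ Suc j) f x) + \<kappa> ^ j * S"
    proof (subst AE_all_countable, intro allI)
      fix j
      have "AE x in lborel. norm (h x) \<le> S" using h_le by (auto elim: eventually_mono)
      from kernel_op_power_bounded[OF K _ this, of j]
      have "AE x in lborel. norm ((kernel_op K ^^ j) h x) \<le> \<kappa> ^ j * S" by (simp add: \<kappa>_def)
      then show "AE x in lborel. m 0 / 2 * norm ((kernel_op K ^^ j) f x)
          \<le> norm ((kernel_op K ^^ Suc j) f x) + \<kappa> ^ j * S"
        using kernel_op_power_equation[OF K mK fv hg eq, of j]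
      proof eventually_elim
        fix x
        assume 1: "norm ((kernel_op K ^^ j) h x) \<le> \<kappa> ^ j * S"
          and 2: "of_real \<nu> * (kernel_op K ^^ j) f x = (kernel_op K ^^ Suc j) f x + (kernel_op K ^^ j) h x"
        have "m 0 / 2 * norm ((kernel_op K ^^ j) f x) \<le> \<bar>\<nu>\<bar> * norm ((kernel_op K ^^ j) f x)"
          using \<nu>2 by (intro mult_right_mono) auto
        also have "\<dots> = norm ((kernel_op K ^^ Suc j) f x + (kernel_op K ^^ j) h x)"
          unfolding 2[symmetric] norm_mult norm_of_real ..
        also have "\<dots> \<le> norm ((kernel_op K ^^ Suc j) f x) + norm ((kernel_op K ^^ j) h x)"
          by (rule norm_triangle_ineq)
        finally show "m 0 / 2 * norm ((kernel_op K ^^ j) f x)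
            \<le> norm ((kernel_op K ^^ Suc j) f x) + \<kappa> ^ j * S" using 1 by linarith
      qed
    qed
    have "AE x in lborel. \<bar>u x\<bar> \<le> A * (B + S)"
      using fN step
    proof eventually_elim
      fix x
      assume "norm ((kernel_op K ^^ N) f x) \<le> B"
        and "\<forall>j. m 0 / 2 * norm ((kernel_op K ^^ j) f x) \<le> norm ((kernel_op K ^^ Suc j) f x) + \<kappa> ^ j * S"
      then have "norm ((kernel_op K ^^ 0) f x) \<le> A * (B + S)"
        using S B0 by (intro iter[of "\<lambda>j. norm ((kernel_op K ^^ j) f x)"]) auto
      then show "\<bar>u x\<bar> \<le> A * (B + S)" by (simp add: f_def)
    qed
    then have "U \<le> A * (B + S)" unfolding U_def by (intro Linf_norm_le) auto
    also have "\<dots> \<le> A * (Q * (\<delta> * U) + cn * \<delta> * U)"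
    proof -
      have "cn * U powr q * U \<le> cn * \<delta> * U"
        using Uq U1(1) cn U by (intro mult_left_mono mult_right_mono) auto
      then show ?thesis using B A unfolding S_def by (intro mult_left_mono add_mono) auto
    qed
    also have "\<dots> = (A * (Q + cn)) * \<delta> * U" by (simp add: algebra_simps)
    also have "\<dots> \<le> 1 / 2 * U"
    proof (rule mult_right_mono)
      have "0 < A * (Q + cn)" using A Q cn by simp
      then show "A * (Q + cn) * \<delta> \<le> 1 / 2" using \<delta>_le(5) by (simp add: field_simps)
    qed (use U in auto)
    finally show False using U by simp
  qed
  with \<delta> show ?thesis by blast
qed

theorem theorem7p1:
  fixes m n :: "real \<Rightarrow> real" and \<sigma> s \<zeta> q :: real and l :: nat
  assumes "admissible_symbol m \<sigma> l"
    and "admissible_nonlinearity n q"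
    and "s > 0" and "1 / 2 - \<bar>\<sigma>\<bar> < s" and "s < \<zeta>"
    and "holder_loc \<zeta> n" and "\<zeta> < 1 + q"
    and "q \<ge> 4 * real l"
  shows "(\<forall>C>0. \<exists>\<delta>>0. \<forall>u \<nu>.
           u \<in> sobolev s \<inter> Linf \<and> solves_steady m n \<nu> u \<and>
           \<nu> - m 0 \<ge> - C * Linf_norm u powr q \<and>
           sobolev_norm s u < \<delta> \<and> Linf_norm u < \<delta>
           \<longrightarrow> (AE x in lborel. u x = 0)) \<and>
         (\<exists>\<delta>>0. \<not> (\<exists>u \<nu>.
           u \<in> sobolev s \<inter> Linf \<and> \<not> (AE x in lborel. u x = 0) \<and>
           solves_steady m n \<nu> u \<and> \<nu> > m 0 \<and>
           sobolev_norm s u < \<delta> \<and> Linf_norm u < \<delta>))"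
proof
  have main: "\<exists>\<delta>>0. \<forall>u \<nu>. u \<in> sobolev s \<inter> Linf \<and> solves_steady m n \<nu> u \<and>
           \<nu> - m 0 \<ge> - C * Linf_norm u powr q \<and>
           sobolev_norm s u < \<delta> \<and> Linf_norm u < \<delta>
           \<longrightarrow> (AE x in lborel. u x = 0)" if "C > 0" for C
    using assms that by (intro no_small_solutions[of m \<sigma> l n q \<zeta> s C]) auto
  then show "\<forall>C>0. \<exists>\<delta>>0. \<forall>u \<nu>.
           u \<in> sobolev s \<inter> Linf \<and> solves_steady m n \<nu> u \<and>
           \<nu> - m 0 \<ge> - C * Linf_norm u powr q \<and>
           sobolev_norm s u < \<delta> \<and> Linf_norm u < \<delta>
           \<longrightarrow> (AE x in lborel. u x = 0)" by blast
  (* A supercritical speed satisfies the lower bound for every constant, in particular for 1. *)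
  obtain \<delta> where \<delta>: "\<delta> > 0" "\<And>u \<nu>. u \<in> sobolev s \<inter> Linf \<Longrightarrow> solves_steady m n \<nu> u \<Longrightarrow>
           \<nu> - m 0 \<ge> - 1 * Linf_norm u powr q \<Longrightarrow>
           sobolev_norm s u < \<delta> \<Longrightarrow> Linf_norm u < \<delta> \<Longrightarrow> AE x in lborel. u x = 0"
    using main[OF zero_less_one] by blast
  have speed: "\<nu> - m 0 \<ge> - 1 * Linf_norm u powr q" if "\<nu> > m 0" for u \<nu>
    using that powr_ge_zero[of "Linf_norm u" q] by linarith
  show "\<exists>\<delta>>0. \<not> (\<exists>u \<nu>.
           u \<in> sobolev s \<inter> Linf \<and> \<not> (AE x in lborel. u x = 0) \<and>
           solves_steady m n \<nu> u \<and> \<nu> > m 0 \<and>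
           sobolev_norm s u < \<delta> \<and> Linf_norm u < \<delta>)"
    using \<delta> speed by blast
qed

end
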